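(* Assume the setting of the context with $\Theta=[0,1]^k$ and $N$ independent copies of the regression model. Let condition $(\mathrm D)$ hold for the original model: for each $n$ there is a random partition $\{\Delta_i;\ i\le n\}$ of $\Theta$ into $n$ Borel-measurable sets with $\delta_n:=\max_{i\le n}d(\Delta_i\cup\{X_i\})\to0$ in probability as $n\to\infty$. Suppose $$\mathbf E\sup_{t\in[0,1]^k}|f(t)|<\infty,$$ and let a sequence $\varepsilon\equiv\varepsilon_n\to0$ of positive numbers and a sequence of naturals $N\equiv N_n\to\infty$ satisfy, as $n\to\infty$, $$\varepsilon^{-k(p/2+1)}\,\mathbf E(\delta_n^{kp/2})\to0\quad\text{and}\quad N\,\mathbf P\big(\delta_n>\varepsilon\min\{1,\rho(k2^{k+1}L)^{-1}\}\big)\to0.$$ Then, as $n\to\infty$, $$\sup_{t\in[0,1]^k}\big|\overline{f^*}_{N,n,\varepsilon}(t)-\mathbf Ef(t)\big|\to0\quad\text{in probability}.$$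
   Context: Model. Let $k\ge1$, $\Theta=[0,1]^k$. $\|\cdot\|$ denotes the sup-norm on $\mathbb R^k$ and $d(A)=\sup_{x,y\in A}\|x-y\|$. The original model is $Y_i=f(X_i)+\xi_i$, $i=1,\dots,n$, where $f$ is an unknown real-valued random field on $\Theta$ with a.s. continuous paths, and the design points $X_i$ are random vectors with values in $\Theta$ (arbitrary, not necessarily independent or identically distributed, possibly depending on $n$, possibly deterministic; $f$ need not be independent of the design). The errors $\{\xi_i\}$ (possibly depending on $n$) form a martingale difference sequence, are independent of $(\{X_i\},f(\cdot))$, and satisfy $M_p:=\sup_i\mathbf E|\xi_i|^p<\infty$ for some $p>k$, $p\ge2$ (if the errors depend on $n$, the supremum is also over $n$). Partition. The random partition $\{\Delta_i\}_{i\le n}$ of $\Theta$ is determined by (a measurable function of) the design points; $\Delta_i$ is the cell corresponding to $X_i$. $\Lambda$ denotes Lebesgue measure on $\mathbb R^k$. Kernel. $K:\mathbb R^k\to[0,\infty)$ vanishes outside $[-1,1]^k$, satisfies $K(s)=K(-s)$ and $\int K(s)\,ds=1$, and $|K(x)-K(y)|\le L\sum_{r=1}^k|x^{(r)}-y^{(r)}|$ for all $x,y\in\mathbb R^k$ with a constant $L\ge1$. Put $K_\varepsilon(s)=\varepsilon^{-k}K(\varepsilon^{-1}s)$. Standing assumption: there are constants $\rho>0$, $\varepsilon_0\in(0,1]$ with $\int_\Theta K_\varepsilon(t-x)\,\Lambda(dx)\ge\rho$ for all $t\in\Theta$, $0<\varepsilon\le\varepsilon_0$. Estimator. $$f^*_{n,\varepsilon}(t)=\frac{\sum_{i=1}^nY_iK_\varepsilon(t-X_i)\Lambda(\Delta_i)}{\sum_{i=1}^nK_\varepsilon(t-X_i)\Lambda(\Delta_i)}\quad(0/0:=0).$$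 Copies. One observes $N$ independent copies of this model (design, partition, random field and errors): $Y_{i,j}=f_j(X_{i,j})+\xi_{i,j}$, $i=1,\dots,n$, $j=1,\dots,N$, where $f,f_1,\dots,f_N$ are i.i.d. a.s. continuous random fields on $[0,1]^k$. $f^*_{n,\varepsilon,j}$ is the estimator $f^*_{n,\varepsilon}$ computed from the $j$-th copy, and $$\overline{f^*}_{N,n,\varepsilon}(t)=\frac1N\sum_{j=1}^Nf^*_{n,\varepsilon,j}(t).$$ *)

theory Defs
  imports "HOL-Probability.Probability"
begin

section \<open>Geometry\<close>

definition unit_cube :: "(real ^ 'k) set" where
  "unit_cube = {t. \<forall>r. 0 \<le> t $ r \<and> t $ r \<le> 1}"

text \<open>The norm on \<open>real ^ 'k\<close> is the sup-norm, i.e. the library constant \<^const>\<open>infnorm\<close>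
  (not the Euclidean \<^const>\<open>norm\<close>). The real supremum below is only applied to nonempty
  bounded sets.\<close>

definition sup_diam :: "(real ^ 'k) set \<Rightarrow> real" where
  "sup_diam A = (SUP z\<in>A \<times> A. infnorm (fst z - snd z))"

text \<open>Cells are indexed by \<open>1, \<dots>, n\<close> and may be empty.\<close>

definition borel_partition :: "nat \<Rightarrow> (nat \<Rightarrow> (real ^ 'k) set) \<Rightarrow> bool" where
  "borel_partition n C \<longleftrightarrow>
     (\<forall>i\<in>{1..n}. C i \<in> sets borel) \<and>
     disjoint_family_on C {1..n} \<and>
     (\<Union>i\<in>{1..n}. C i) = unit_cube"

definition mesh :: "nat \<Rightarrow> (nat \<Rightarrow> real ^ 'k) \<Rightarrow> (nat \<Rightarrow> (real ^ 'k) set) \<Rightarrow> real" where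
  "mesh n x C = Max ((\<lambda>i. sup_diam (C i \<union> {x i})) ` {1..n})"


section \<open>Kernel and estimator\<close>

definition smoothing_kernel :: "real \<Rightarrow> (real ^ 'k \<Rightarrow> real) \<Rightarrow> bool" where
  "smoothing_kernel L K \<longleftrightarrow>
     1 \<le> L \<and>
     (\<forall>s. 0 \<le> K s) \<and>
     (\<forall>s. (\<exists>r. \<bar>s $ r\<bar> > 1) \<longrightarrow> K s = 0) \<and>
     (\<forall>s. K (- s) = K s) \<and>
     integrable lborel K \<and> (\<integral>s. K s \<partial>lborel) = 1 \<and>
     (\<forall>x y. \<bar>K x - K y\<bar> \<le> L * (\<Sum>r\<in>UNIV. \<bar>x $ r - y $ r\<bar>))"

definition scaled_kernel :: "(real ^ 'k \<Rightarrow> real) \<Rightarrow> real \<Rightarrow> real ^ 'k \<Rightarrow> real" where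
  "scaled_kernel K e s = K (s /\<^sub>R e) / e ^ CARD('k)"

definition boundary_condition :: "real \<Rightarrow> real \<Rightarrow> (real ^ 'k \<Rightarrow> real) \<Rightarrow> bool" where
  "boundary_condition \<rho> e\<^sub>0 K \<longleftrightarrow>
     0 < \<rho> \<and> 0 < e\<^sub>0 \<and> e\<^sub>0 \<le> 1 \<and>
     (\<forall>t\<in>unit_cube. \<forall>e. 0 < e \<and> e \<le> e\<^sub>0 \<longrightarrow>
        (LINT x:unit_cube|lborel. scaled_kernel K e (t - x)) \<ge> \<rho>)"

text \<open>Design points \<open>x\<close>, cells \<open>C\<close>, observations \<open>y\<close>. The convention 0/0 = 0 is that of
  division in HOL.\<close>

definition kernel_estimator ::
  "(real ^ 'k \<Rightarrow> real) \<Rightarrow> real \<Rightarrow> nat \<Rightarrow> (nat \<Rightarrow> real ^ 'k) \<Rightarrow> (nat \<Rightarrow> (real ^ 'k) set)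
     \<Rightarrow> (nat \<Rightarrow> real) \<Rightarrow> real ^ 'k \<Rightarrow> real" where
  "kernel_estimator K e n x C y t =
     (\<Sum>i=1..n. y i * scaled_kernel K e (t - x i) * measure lborel (C i)) /
     (\<Sum>i=1..n. scaled_kernel K e (t - x i) * measure lborel (C i))"


section \<open>The regression model\<close>

text \<open>Random objects take the sample point as their last argument: \<open>X i \<omega>\<close>, \<open>f t \<omega>\<close>, \<open>\<xi> i \<omega>\<close>.
  Random fields carry the cylinder sigma-algebra.\<close>

abbreviation design_space :: "nat \<Rightarrow> (nat \<Rightarrow> real ^ 'k) measure" where
  "design_space n \<equiv> Pi\<^sub>M {1..n} (\<lambda>_. restrict_space borel unit_cube)"

abbreviation field_space :: "(real ^ 'k \<Rightarrow> real) measure" where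
  "field_space \<equiv> Pi\<^sub>M unit_cube (\<lambda>_. borel)"

abbreviation error_space :: "nat \<Rightarrow> (nat \<Rightarrow> real) measure" where
  "error_space n \<equiv> Pi\<^sub>M {1..n} (\<lambda>_. borel)"

definition design_vec :: "nat \<Rightarrow> (nat \<Rightarrow> 'a \<Rightarrow> real ^ 'k) \<Rightarrow> 'a \<Rightarrow> nat \<Rightarrow> real ^ 'k" where
  "design_vec n X \<omega> = (\<lambda>i\<in>{1..n}. X i \<omega>)"

definition field_path :: "(real ^ 'k \<Rightarrow> 'a \<Rightarrow> real) \<Rightarrow> 'a \<Rightarrow> real ^ 'k \<Rightarrow> real" where
  "field_path f \<omega> = (\<lambda>t\<in>unit_cube. f t \<omega>)"

definition error_vec :: "nat \<Rightarrow> (nat \<Rightarrow> 'a \<Rightarrow> real) \<Rightarrow> 'a \<Rightarrow> nat \<Rightarrow> real" where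
  "error_vec n \<xi> \<omega> = (\<lambda>i\<in>{1..n}. \<xi> i \<omega>)"

definition continuous_field :: "'a measure \<Rightarrow> (real ^ 'k \<Rightarrow> 'a \<Rightarrow> real) \<Rightarrow> bool" where
  "continuous_field M f \<longleftrightarrow>
     (\<forall>t\<in>unit_cube. f t \<in> borel_measurable M) \<and>
     (AE \<omega> in M. continuous_on unit_cube (\<lambda>t. f t \<omega>))"

text \<open>Martingale differences with respect to the natural filtration; the conditioning
  sigma-algebra for \<open>i = 1\<close> is trivial.\<close>

definition martingale_differences :: "'a measure \<Rightarrow> nat \<Rightarrow> (nat \<Rightarrow> 'a \<Rightarrow> real) \<Rightarrow> bool" where
  "martingale_differences M n \<xi> \<longleftrightarrow>
     (\<forall>i\<in>{1..n}. integrable M (\<xi> i) \<and>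
        (AE \<omega> in M.
           real_cond_exp M
             (vimage_algebra (space M) (error_vec (i - 1) \<xi>) (error_space (i - 1)))
             (\<xi> i) \<omega> = 0))"

text \<open>Independence of the errors from the pair (design, field) is stated for the generated
  sigma-algebras, because \<^const>\<open>prob_space.indep_var\<close> needs both variables to have the same
  type.\<close>

definition regression_model ::
  "'a measure \<Rightarrow> nat \<Rightarrow> (nat \<Rightarrow> 'a \<Rightarrow> real ^ 'k) \<Rightarrow> (real ^ 'k \<Rightarrow> 'a \<Rightarrow> real)
     \<Rightarrow> (nat \<Rightarrow> 'a \<Rightarrow> real) \<Rightarrow> bool" where
  "regression_model M n X f \<xi> \<longleftrightarrow>
     (\<forall>i\<in>{1..n}. X i \<in> borel_measurable M \<and> (\<forall>\<omega>\<in>space M. X i \<omega> \<in> unit_cube)) \<and>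
     continuous_field M f \<and>
     martingale_differences M n \<xi> \<and>
     prob_space.indep_set M
       (sets (vimage_algebra (space M) (error_vec n \<xi>) (error_space n)))
       (sets (vimage_algebra (space M) (\<lambda>\<omega>. (design_vec n X \<omega>, field_path f \<omega>))
          (design_space n \<Otimes>\<^sub>M field_space)))"

text \<open>A random partition is a rule \<open>D\<close> that maps a design to cells. Its measurability is
  required only for the functionals of it that are used, the volumes of the cells and the mesh.\<close>

definition partition_rule ::
  "nat \<Rightarrow> ((nat \<Rightarrow> real ^ 'k) \<Rightarrow> nat \<Rightarrow> (real ^ 'k) set) \<Rightarrow> bool" where
  "partition_rule n D \<longleftrightarrow>
     (\<forall>x\<in>space (design_space n). borel_partition n (D x)) \<and>
     (\<forall>i\<in>{1..n}. (\<lambda>x. measure lborel (D x i)) \<in> borel_measurable (design_space n)) \<and>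
     (\<lambda>x. mesh n x (D x)) \<in> borel_measurable (design_space n)"

definition model_vec ::
  "nat \<Rightarrow> (nat \<Rightarrow> 'a \<Rightarrow> real ^ 'k) \<Rightarrow> (real ^ 'k \<Rightarrow> 'a \<Rightarrow> real) \<Rightarrow> (nat \<Rightarrow> 'a \<Rightarrow> real)
     \<Rightarrow> 'a \<Rightarrow> (nat \<Rightarrow> real ^ 'k) \<times> (real ^ 'k \<Rightarrow> real) \<times> (nat \<Rightarrow> real)" where
  "model_vec n X f \<xi> \<omega> = (design_vec n X \<omega>, field_path f \<omega>, error_vec n \<xi> \<omega>)"

abbreviation model_space ::
  "nat \<Rightarrow> ((nat \<Rightarrow> real ^ 'k) \<times> (real ^ 'k \<Rightarrow> real) \<times> (nat \<Rightarrow> real)) measure" where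
  "model_space n \<equiv> design_space n \<Otimes>\<^sub>M (field_space \<Otimes>\<^sub>M error_space n)"

text \<open>The partition is a function of the design and hence is copied along with it. Continuity of
  the copied fields has to be required: it is not a property of the law on the cylinder
  sigma-algebra.\<close>

definition independent_copies ::
  "'a measure \<Rightarrow> nat \<Rightarrow> (nat \<Rightarrow> 'a \<Rightarrow> real ^ 'k) \<Rightarrow> (real ^ 'k \<Rightarrow> 'a \<Rightarrow> real)
     \<Rightarrow> (nat \<Rightarrow> 'a \<Rightarrow> real) \<Rightarrow> nat \<Rightarrow> (nat \<Rightarrow> nat \<Rightarrow> 'a \<Rightarrow> real ^ 'k)
     \<Rightarrow> (nat \<Rightarrow> real ^ 'k \<Rightarrow> 'a \<Rightarrow> real) \<Rightarrow> (nat \<Rightarrow> nat \<Rightarrow> 'a \<Rightarrow> real) \<Rightarrow> bool" where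
  "independent_copies M n X f \<xi> N X' f' \<xi>' \<longleftrightarrow>
     prob_space.indep_vars M (\<lambda>_. model_space n) (\<lambda>j. model_vec n (X' j) (f' j) (\<xi>' j)) {1..N} \<and>
     (\<forall>j\<in>{1..N}.
        continuous_field M (f' j) \<and>
        distr M (model_space n) (model_vec n (X' j) (f' j) (\<xi>' j)) =
        distr M (model_space n) (model_vec n X f \<xi>))"


section \<open>Convergence in probability\<close>

text \<open>For nonnegative, possibly infinite functions. Since paths are continuous only almost surely,
  suprema over the cube need not be measurable on an incomplete space; outer measure agrees with
  the probability on measurable events and avoids the value 0 that \<^const>\<open>emeasure\<close> takes on
  nonmeasurable ones.\<close>

definition tends_to_0_in_prob :: "'a measure \<Rightarrow> (nat \<Rightarrow> 'a \<Rightarrow> ennreal) \<Rightarrow> bool" where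
  "tends_to_0_in_prob M Z \<longleftrightarrow>
     (\<forall>\<eta>::real. 0 < \<eta> \<longrightarrow>
        (\<lambda>n. outer_measure_of M {\<omega> \<in> space M. Z n \<omega> > ennreal \<eta>}) \<longlonglongrightarrow> 0)"

end

theory Submission
  imports Defs "HOL-Real_Asymp.Real_Asymp"
begin

text \<open>
  On the event that the mesh of a copy is at most \<open>\<epsilon> min {1, \<rho> / (k 2\<^sup>k\<^sup>+\<^sup>1 L)}\<close> the denominator of the
  estimator is at least \<open>\<rho> / 2\<close>, so the error of that copy is at most the oscillation of its field at
  scale \<open>\<epsilon>\<close> plus \<open>2 / \<rho>\<close> times the supremum of a noise field, a sum of martingale differences with
  weights that depend on the design only. By the tail condition all copies are in this event with
  probability tending to 1. Given the design, the \<open>p\<close>-th moments of the noise field and of its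
  increments are controlled by a moment inequality for martingale transforms, and dyadic chaining
  (where \<open>p > k\<close> enters) bounds the expected supremum in terms of the rate in the hypothesis. The
  remaining term, the average of the fields minus their mean, is handled by a weak law of large
  numbers at finitely many grid points and by the expected oscillation between them. All
  expectations depend only on the law of a single copy, so one application of Markov's inequality
  concludes.
\<close>

section \<open>Moments of martingale transforms\<close>

text \<open>The rate in the hypothesis can be read off in advance. The squared weights of a design
  with mesh d sum to order (d/e)^k, so the noise at one point has p-th moment of order (d/e)^(kp/2);
  about e^(-k) grid points resolve the scale e, and adding their p-th moments gives e^(-k(p/2+1))
  d^(kp/2). Chaining below that scale costs only a constant factor. With only p-th moments at hand,
  maxima of the noise are reduced to finite sums of p-th powers by |y| <= c + c^(1-p) |y|^p; the
  level stays free until the end, where it is made small before the rate tends to 0. The noise of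
  each copy is small by itself, so no cancellation between copies is used for it; averaging serves
  the fields alone. These have only a first moment, so the law of large numbers goes through
  truncation. Paths are continuous only almost surely and fields carry the cylinder sigma-algebra,
  so the suprema whose expectations are estimated range over dyadic points; continuity is used
  pathwise to return to the cube.\<close>

text \<open>\<open>ln (1 + u) \<le> u\<close> turns the power into an exponential, whose
  second-order Taylor remainder is evaluated at some \<open>t \<le> p / 2\<close>. Only the terms of
  order 0 and 1 have to be sharp.\<close>

lemma powr_add_le_second_order:
  fixes u p :: real
  assumes "\<bar>u\<bar> \<le> 1/2" "p \<ge> 2"
  shows "(1 + u) powr p \<le> 1 + p * u + exp p * p\<^sup>2 * u\<^sup>2"
proof -
  have "(1 + u) powr p = exp (p * ln (1 + u))"
    using assms by (simp add: powr_def)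
  also have "\<dots> \<le> exp (p * u)"
    using assms ln_add_one_self_le_self2[of u] by (simp add: mult_left_mono)
  also obtain t where t: "\<bar>t\<bar> \<le> \<bar>p * u\<bar>"
    "exp (p * u) = (\<Sum>m<2. (p * u) ^ m / fact m) + exp t / fact 2 * (p * u) ^ 2"
    using Maclaurin_exp_le[of "p * u" 2] by blast
  have "t \<le> \<bar>p\<bar> * (1/2)"
    using t(1) mult_left_mono[OF assms(1), of "\<bar>p\<bar>"] by (simp add: abs_mult)
  then have "t \<le> p" using assms by simp
  then have "exp t / 2 \<le> exp p"
    by (smt (verit) exp_le_cancel_iff exp_gt_zero field_sum_of_halves)
  then have "exp t / 2 * (p * u)\<^sup>2 \<le> exp p * (p * u)\<^sup>2"
    by (rule mult_right_mono) auto
  then have "exp (p * u) \<le> 1 + p * u + exp p * p\<^sup>2 * u\<^sup>2"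
    using t(2) by (simp add: numeral_2_eq_2 power_mult_distrib mult_ac)
  finally show ?thesis .
qed

lemma abs_powr_add_le:
  fixes x y :: real
  shows "p \<ge> 0 \<Longrightarrow> \<bar>x + y\<bar> powr p \<le> 2 powr p * (\<bar>x\<bar> powr p + \<bar>y\<bar> powr p)"
proof -
  assume p: "p \<ge> 0"
  have "\<bar>x + y\<bar> powr p \<le> (2 * max \<bar>x\<bar> \<bar>y\<bar>) powr p"
    using p by (intro powr_mono2) auto
  also have "\<dots> = 2 powr p * max \<bar>x\<bar> \<bar>y\<bar> powr p" by (simp add: powr_mult)
  also have "\<dots> \<le> 2 powr p * (\<bar>x\<bar> powr p + \<bar>y\<bar> powr p)"
    by (intro mult_left_mono) (auto simp: max_def)
  finally show ?thesis .
qed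

text \<open>A crude form of Young's inequality: the larger base absorbs the smaller one, so no
  conjugate exponents appear.\<close>

lemma powr_mult_powr_le:
  fixes a b :: real
  assumes "a \<ge> 0" "b \<ge> 0" "r \<ge> 0" "s \<ge> 0"
  shows "a powr r * b powr s \<le> a powr (r + s) + b powr (r + s)"
proof (cases "a \<le> b")
  case True
  then have "a powr r * b powr s \<le> b powr r * b powr s"
    using assms by (intro mult_right_mono powr_mono2) auto
  then show ?thesis by (smt (verit) powr_add powr_ge_zero)
next
  case False
  then have "a powr r * b powr s \<le> a powr r * a powr s"
    using assms by (intro mult_left_mono powr_mono2) auto
  then show ?thesis by (smt (verit) powr_add powr_ge_zero)
qed

text \<open>The first summand serves increments with
  \<open>\<bar>x\<bar> \<le> 2 * \<bar>y\<bar>\<close>, where every term is of order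
  \<open>\<bar>y\<bar> powr p\<close>; the second serves relatively small increments, where the
  expansion applies to \<open>y / x\<close>.\<close>

definition powr_taylor_const :: "real \<Rightarrow> real" where
  "powr_taylor_const p = 4 powr p * (1 + p) + exp p * p\<^sup>2"

text \<open>The inequality is homogeneous, so for small \<open>y / x\<close> it is the second-order
  bound for \<open>(1 + u) powr p\<close> multiplied by \<open>x powr p\<close>; otherwise all terms
  are compared with \<open>\<bar>y\<bar> powr p\<close>. The linear term is kept exactly because its
  expectation vanishes when \<open>x\<close> depends on the past and \<open>y\<close> is a multiple
  of the next martingale difference.\<close>

lemma abs_powr_taylor:
  fixes x y p :: real
  assumes p: "p \<ge> 2"
  shows "\<bar>x + y\<bar> powr p \<le> \<bar>x\<bar> powr p + p * (sgn x * \<bar>x\<bar> powr (p - 1)) * y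
           + powr_taylor_const p * (\<bar>x\<bar> powr (p - 2) * y\<^sup>2 + \<bar>y\<bar> powr p)"
proof -
  have main: "\<bar>x + y\<bar> powr p \<le> \<bar>x\<bar> powr p + p * (sgn x * \<bar>x\<bar> powr (p - 1)) * y
           + powr_taylor_const p * (\<bar>x\<bar> powr (p - 2) * y\<^sup>2 + \<bar>y\<bar> powr p)"
    if x: "x \<ge> 0" for x y :: real
  proof (cases "x \<le> 2 * \<bar>y\<bar>")
    case True
    have "\<bar>x + y\<bar> powr p \<le> (4 * \<bar>y\<bar>) powr p"
      using True x p by (intro powr_mono2) auto
    then have 1: "\<bar>x + y\<bar> powr p \<le> 4 powr p * \<bar>y\<bar> powr p" by (simp add: powr_mult)
    have "\<bar>x\<bar> powr (p - 1) * \<bar>y\<bar> \<le> (4 * \<bar>y\<bar>) powr (p - 1) * (4 * \<bar>y\<bar>)"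
      using True x p by (intro mult_mono powr_mono2) auto
    also have "\<dots> = 4 powr p * \<bar>y\<bar> powr p"
      using powr_mult_base[of "4 * \<bar>y\<bar>" "p - 1"] by (simp add: powr_mult mult_ac)
    finally have "p * (\<bar>x\<bar> powr (p - 1) * \<bar>y\<bar>) \<le> p * (4 powr p * \<bar>y\<bar> powr p)"
      using p by (intro mult_left_mono) auto
    \<comment> \<open>The linear term may be negative, so the remainder has to outweigh it as well;
      this is the source of the factor \<open>1 + p\<close>.\<close>
    moreover have "\<bar>p * (sgn x * \<bar>x\<bar> powr (p - 1)) * y\<bar> \<le> p * (\<bar>x\<bar> powr (p - 1) * \<bar>y\<bar>)"
      using p by (auto simp: abs_mult sgn_if)
    ultimately have 2: "p * (sgn x * \<bar>x\<bar> powr (p - 1)) * y \<ge> - (p * (4 powr p * \<bar>y\<bar> powr p))"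
      by linarith
    have "powr_taylor_const p * (\<bar>x\<bar> powr (p - 2) * y\<^sup>2 + \<bar>y\<bar> powr p)
        \<ge> (4 powr p * (1 + p)) * (\<bar>y\<bar> powr p)"
      unfolding powr_taylor_const_def using p by (intro mult_mono) auto
    then show ?thesis using 1 2 by (simp add: algebra_simps) (smt (verit) powr_ge_zero)
  next
    case False
    then have xp: "x > 0" by linarith
    have "\<bar>y / x\<bar> \<le> 1/2" using False xp by (simp add: field_simps)
    from powr_add_le_second_order[OF this p]
    have "x powr p * (1 + y / x) powr p
        \<le> x powr p * (1 + p * (y / x) + exp p * p\<^sup>2 * (y / x)\<^sup>2)"
      by (intro mult_left_mono) auto
    moreover have "x powr p * (1 + y / x) powr p = \<bar>x + y\<bar> powr p"
    proof -
      have "x * (1 + y / x) = x + y" using xp by (simp add: field_simps)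
      moreover have "1 + y / x > 0" using \<open>\<bar>y / x\<bar> \<le> 1/2\<close> by linarith
      moreover have "x + y > 0" using False xp by linarith
      ultimately show ?thesis using xp by (simp flip: powr_mult)
    qed
    moreover have "x powr p = x powr (p - 1) * x" "x powr p = x powr (p - 2) * x\<^sup>2"
      using xp by (simp_all add: powr_diff powr_numeral)
    then have "x powr p * (1 + p * (y / x) + exp p * p\<^sup>2 * (y / x)\<^sup>2)
       = x powr p + p * x powr (p - 1) * y + exp p * p\<^sup>2 * (x powr (p - 2) * y\<^sup>2)"
      using xp by (simp add: field_simps power2_eq_square)
    moreover have "exp p * p\<^sup>2 * (x powr (p - 2) * y\<^sup>2)
       \<le> powr_taylor_const p * (x powr (p - 2) * y\<^sup>2 + \<bar>y\<bar> powr p)"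
      unfolding powr_taylor_const_def using p by (intro mult_mono) auto
    ultimately show ?thesis using xp by simp
  qed
  show ?thesis
  proof (cases "x \<ge> 0")
    case True then show ?thesis by (rule main)
  next
    case False
    then have "\<bar>- x + - y\<bar> powr p \<le> \<bar>- x\<bar> powr p + p * (sgn (- x) * \<bar>- x\<bar> powr (p - 1)) * (- y)
           + powr_taylor_const p * (\<bar>- x\<bar> powr (p - 2) * (- y)\<^sup>2 + \<bar>- y\<bar> powr p)"
      by (intro main) auto
    moreover have "\<bar>- x + - y\<bar> = \<bar>x + y\<bar>" by linarith
    ultimately show ?thesis by (simp add: sgn_minus)
  qed
qed

lemma powr_taylor_const_ge_1: "p \<ge> 2 \<Longrightarrow> powr_taylor_const p \<ge> 1"
proof -
  assume p: "p \<ge> 2"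
  have "1 * 1 \<le> 4 powr p * (1 + p)"
    using p by (intro mult_mono ge_one_powr_ge_zero) auto
  then show ?thesis unfolding powr_taylor_const_def
    by (smt (verit) mult_nonneg_nonneg exp_ge_zero zero_le_power2)
qed

section \<open>Orthogonality of martingale differences and the moment bound\<close>

text \<open>A function of the past is taken out of the conditional expectation. It is given as a
  function \<open>g\<close> of the error vector, so it is measurable for the generated sigma-algebra
  at once, and it may be unbounded, since integrability is asked of the product only.\<close>

lemma (in prob_space) martingale_difference_orthogonal:
  assumes md: "martingale_differences M n \<xi>" and i: "i \<in> {1..n}"
    and g: "g \<in> borel_measurable (error_space (i - 1))"
    and int: "integrable M (\<lambda>\<omega>. g (error_vec (i - 1) \<xi> \<omega>) * \<xi> i \<omega>)"
  shows "(\<integral>\<omega>. g (error_vec (i - 1) \<xi> \<omega>) * \<xi> i \<omega> \<partial>M) = 0"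
proof -
  let ?F = "vimage_algebra (space M) (error_vec (i - 1) \<xi>) (error_space (i - 1))"
  have meas: "\<xi> j \<in> borel_measurable M" if "j \<in> {1..n}" for j
    using md that unfolding martingale_differences_def by (auto dest: borel_measurable_integrable)
  have ev: "error_vec (i - 1) \<xi> \<in> measurable M (error_space (i - 1))"
    unfolding error_vec_def using i by (intro measurable_restrict meas) auto
  have "subalgebra M ?F"
    unfolding subalgebra_def using ev by (auto simp: sets_vimage_algebra2 measurable_space
        intro: measurable_sets)
  then interpret finite_measure_subalgebra M ?F
    by unfold_locales
  have gF: "(\<lambda>\<omega>. g (error_vec (i - 1) \<xi> \<omega>)) \<in> borel_measurable ?F"
    by (rule measurable_compose[OF measurable_vimage_algebra1 g])
       (use ev in \<open>auto dest: measurable_space\<close>)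
  have "(\<integral>\<omega>. g (error_vec (i - 1) \<xi> \<omega>) * \<xi> i \<omega> \<partial>M)
      = (\<integral>\<omega>. g (error_vec (i - 1) \<xi> \<omega>) * real_cond_exp M ?F (\<xi> i) \<omega> \<partial>M)"
    using int gF meas[OF i] by (rule real_cond_exp_intg(2)[symmetric])
  also have "\<dots> = (\<integral>\<omega>. 0 \<partial>M)"
  proof (rule integral_cong_AE)
    show "AE \<omega> in M. g (error_vec (i - 1) \<xi> \<omega>) * real_cond_exp M ?F (\<xi> i) \<omega> = 0"
      using md i unfolding martingale_differences_def by auto
    show "(\<lambda>\<omega>. g (error_vec (i - 1) \<xi> \<omega>) * real_cond_exp M ?F (\<xi> i) \<omega>) \<in> borel_measurable M"
      using measurable_compose[OF ev g] by simp
  qed auto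
  finally show ?thesis by simp
qed

text \<open>The 4 makes room in the induction for three multiples of
  \<open>powr_taylor_const p\<close>: two from the second-order term and one from the power of the
  new increment.\<close>

definition moment_const :: "real \<Rightarrow> real" where
  "moment_const p = (4 * powr_taylor_const p) powr (p / 2)"

text \<open>Induction on \<open>n\<close>: the first-order term of the Taylor bound integrates to 0, and the
  second-order term is estimated after scaling the partial sum by its expected size
  \<open>sqrt (B V)\<close>, which replaces Hoelder's inequality.\<close>

lemma (in prob_space) martingale_transform_moment:
  fixes a :: "nat \<Rightarrow> real"
  assumes md: "martingale_differences M n \<xi>" and p: "p \<ge> 2"
    and int: "\<And>i. i \<in> {1..n} \<Longrightarrow> integrable M (\<lambda>\<omega>. \<bar>\<xi> i \<omega>\<bar> powr p)"
    and bound: "\<And>i. i \<in> {1..n} \<Longrightarrow> (\<integral>\<omega>. \<bar>\<xi> i \<omega>\<bar> powr p \<partial>M) \<le> m"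
    and m: "m \<ge> 0"
  shows "integrable M (\<lambda>\<omega>. \<bar>\<Sum>i=1..n. a i * \<xi> i \<omega>\<bar> powr p) \<and>
    (\<integral>\<omega>. \<bar>\<Sum>i=1..n. a i * \<xi> i \<omega>\<bar> powr p \<partial>M)
      \<le> moment_const p * (\<Sum>i=1..n. (a i)\<^sup>2) powr (p / 2) * m"
proof -
  define C where "C = powr_taylor_const p"
  have C: "C \<ge> 1" unfolding C_def using p by (rule powr_taylor_const_ge_1)
  define q where "q = p / 2"
  have q: "q \<ge> 1" "p = 2 * q" unfolding q_def using p by auto
  define B where "B = 4 * C"
  have B: "B \<ge> 4" unfolding B_def using C by simp
  have mc: "moment_const p = B powr q" unfolding moment_const_def B_def C_def q_def ..
  have meas: "\<xi> j \<in> borel_measurable M" if "j \<in> {1..n}" for j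
    using md that unfolding martingale_differences_def by (auto dest: borel_measurable_integrable)
  have "k \<le> n \<Longrightarrow> integrable M (\<lambda>\<omega>. \<bar>\<Sum>i=1..k. a i * \<xi> i \<omega>\<bar> powr p) \<and>
    (\<integral>\<omega>. \<bar>\<Sum>i=1..k. a i * \<xi> i \<omega>\<bar> powr p \<partial>M)
      \<le> moment_const p * (\<Sum>i=1..k. (a i)\<^sup>2) powr (p / 2) * m" for k
  proof (induction k)
    case 0
    then show ?case by simp
  next
    case (Suc k)
    define S where "S = (\<lambda>\<omega>. \<Sum>i=1..k. a i * \<xi> i \<omega>)"
    define y where "y = (\<lambda>\<omega>. a (Suc k) * \<xi> (Suc k) \<omega>)"
    define V where "V = (\<Sum>i=1..k. (a i)\<^sup>2)"
    define h where "h = (a (Suc k))\<^sup>2"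
    have V: "V \<ge> 0" unfolding V_def by (intro sum_nonneg) auto
    have h: "h \<ge> 0" unfolding h_def by simp
    have k: "Suc k \<in> {1..n}" using Suc.prems by auto
    have mS[measurable]: "S \<in> borel_measurable M"
      unfolding S_def using Suc.prems by (intro borel_measurable_sum borel_measurable_times meas) auto
    have mx[measurable]: "\<xi> (Suc k) \<in> borel_measurable M" by (rule meas[OF k])
    have my[measurable]: "y \<in> borel_measurable M" unfolding y_def by measurable
    have Sint: "integrable M (\<lambda>\<omega>. \<bar>S \<omega>\<bar> powr p)"
      and Sb: "(\<integral>\<omega>. \<bar>S \<omega>\<bar> powr p \<partial>M) \<le> B powr q * V powr q * m"
      using Suc unfolding S_def V_def mc q_def by auto
    have ypow: "\<bar>y \<omega>\<bar> powr p = h powr q * \<bar>\<xi> (Suc k) \<omega>\<bar> powr p" for \<omega>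
    proof -
      have "h powr q = \<bar>a (Suc k)\<bar> powr p"
        unfolding h_def q(2) powr_powr[symmetric] by (simp add: powr_numeral)
      then show ?thesis unfolding y_def by (simp add: abs_mult powr_mult)
    qed
    have yint: "integrable M (\<lambda>\<omega>. \<bar>y \<omega>\<bar> powr p)"
      unfolding ypow using int[OF k] by simp
    have yb: "(\<integral>\<omega>. \<bar>y \<omega>\<bar> powr p \<partial>M) \<le> h powr q * m"
      unfolding ypow using bound[OF k] by (simp add: mult_left_mono)
    have Tint: "integrable M (\<lambda>\<omega>. \<bar>S \<omega> + y \<omega>\<bar> powr p)"
    proof (rule Bochner_Integration.integrable_bound)
      show "integrable M (\<lambda>\<omega>. 2 powr p * (\<bar>S \<omega>\<bar> powr p + \<bar>y \<omega>\<bar> powr p))"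
        using Sint yint by simp
      show "AE \<omega> in M. norm (\<bar>S \<omega> + y \<omega>\<bar> powr p) \<le> norm (2 powr p * (\<bar>S \<omega>\<bar> powr p + \<bar>y \<omega>\<bar> powr p))"
        using abs_powr_add_le[of p] p by (intro AE_I2) simp
    qed simp
    \<comment> \<open>Orthogonality needs this product to be integrable; the crude Young inequality
      with exponents \<open>p - 1\<close> and 1 bounds it by two integrable powers.\<close>
    have crossint: "integrable M (\<lambda>\<omega>. (sgn (S \<omega>) * \<bar>S \<omega>\<bar> powr (p - 1)) * \<xi> (Suc k) \<omega>)"
    proof (rule Bochner_Integration.integrable_bound)
      show "integrable M (\<lambda>\<omega>. \<bar>S \<omega>\<bar> powr p + \<bar>\<xi> (Suc k) \<omega>\<bar> powr p)"
        using Sint int[OF k] by simp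
      show "AE \<omega> in M. norm ((sgn (S \<omega>) * \<bar>S \<omega>\<bar> powr (p - 1)) * \<xi> (Suc k) \<omega>)
          \<le> norm (\<bar>S \<omega>\<bar> powr p + \<bar>\<xi> (Suc k) \<omega>\<bar> powr p)"
      proof (rule AE_I2)
        fix \<omega>
        have "\<bar>S \<omega>\<bar> powr (p - 1) * \<bar>\<xi> (Suc k) \<omega>\<bar> powr 1 \<le> \<bar>S \<omega>\<bar> powr p + \<bar>\<xi> (Suc k) \<omega>\<bar> powr p"
          using powr_mult_powr_le[of "\<bar>S \<omega>\<bar>" "\<bar>\<xi> (Suc k) \<omega>\<bar>" "p - 1" 1] p by simp
        then show "norm ((sgn (S \<omega>) * \<bar>S \<omega>\<bar> powr (p - 1)) * \<xi> (Suc k) \<omega>)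
          \<le> norm (\<bar>S \<omega>\<bar> powr p + \<bar>\<xi> (Suc k) \<omega>\<bar> powr p)"
          by (auto simp: abs_mult sgn_if)
      qed
    qed simp
    have crosszero: "(\<integral>\<omega>. (sgn (S \<omega>) * \<bar>S \<omega>\<bar> powr (p - 1)) * \<xi> (Suc k) \<omega> \<partial>M) = 0"
    proof -
      \<comment> \<open>Rewrites the partial sum as a function of the first \<open>k\<close> errors,
        the form of the past that orthogonality expects.\<close>
      define G where "G = (\<lambda>e::nat \<Rightarrow> real. \<Sum>i=1..k. a i * e i)"
      have "(\<lambda>e. e i) \<in> borel_measurable (error_space k)" if "i \<in> {1..k}" for i
        using that by (rule measurable_component_singleton)
      then have G[measurable]: "G \<in> borel_measurable (error_space k)"
        unfolding G_def by (intro borel_measurable_sum borel_measurable_times) auto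
      have SG: "S = (\<lambda>\<omega>. G (error_vec k \<xi> \<omega>))"
        unfolding S_def G_def error_vec_def by (intro ext sum.cong) auto
      have "(\<lambda>e. sgn (G e) * \<bar>G e\<bar> powr (p - 1)) \<in> borel_measurable (error_space (Suc k - 1))"
        unfolding diff_Suc_1 by measurable
      from martingale_difference_orthogonal[OF md k this] crossint
      show ?thesis unfolding SG by simp
    qed
    define c where "c = B powr q * (V + h) powr q"
    show ?case
    \<comment> \<open>The scale \<open>sqrt (B * V)\<close> used below must be positive; if
      \<open>V = 0\<close>, all earlier coefficients vanish and only \<open>y\<close> is
      left.\<close>
    proof (cases "V = 0")
      case True
      then have "\<And>i. i \<in> {1..k} \<Longrightarrow> a i = 0"
        unfolding V_def by (subst (asm) sum_nonneg_eq_0_iff) auto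
      then have S0: "S = (\<lambda>_. 0)" unfolding S_def by (intro ext sum.neutral) auto
      have "1 * (h powr q * m) \<le> B powr q * (h powr q * m)"
        using B q m by (intro mult_right_mono ge_one_powr_ge_zero) auto
      then have "(\<integral>\<omega>. \<bar>S \<omega> + y \<omega>\<bar> powr p \<partial>M) \<le> B powr q * (V + h) powr q * m"
        using yb True S0 by (simp add: mult_ac)
      then show ?thesis using Tint unfolding S_def y_def V_def h_def mc q_def by simp
    next
      case False
      then have Vp: "V > 0" using V by simp
      define R where "R = (B * V) powr (q - 1)"
      have BV: "B * V > 0" using B Vp by simp
      \<comment> \<open>Dividing \<open>S\<close> by \<open>sqrt (B * V)\<close> balances the
        product: by the induction hypothesis and the moment bound, each of the two resulting powers
        has expectation at most \<open>m\<close>.\<close>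
      have quad: "\<bar>S \<omega>\<bar> powr (p - 2) * (y \<omega>)\<^sup>2
          \<le> h * R * (\<bar>S \<omega>\<bar> powr p / (B * V) powr q + \<bar>\<xi> (Suc k) \<omega>\<bar> powr p)" for \<omega>
      proof -
        define s where "s = sqrt (B * V)"
        have s: "s > 0" "s\<^sup>2 = B * V" unfolding s_def using BV by auto
        have sR: "s powr (p - 2) = R" "s powr p = (B * V) powr q"
          unfolding R_def s(2)[symmetric] q(2) using s(1)
          by (simp_all add: powr_powr algebra_simps flip: powr_numeral)
        have "(\<bar>S \<omega>\<bar> / s) powr (p - 2) * \<bar>\<xi> (Suc k) \<omega>\<bar> powr 2
            \<le> (\<bar>S \<omega>\<bar> / s) powr p + \<bar>\<xi> (Suc k) \<omega>\<bar> powr p"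
          using powr_mult_powr_le[of "\<bar>S \<omega>\<bar> / s" "\<bar>\<xi> (Suc k) \<omega>\<bar>" "p - 2" 2] p s by simp
        then have *: "(\<bar>S \<omega>\<bar> powr (p - 2) / R) * (\<xi> (Suc k) \<omega>)\<^sup>2
            \<le> \<bar>S \<omega>\<bar> powr p / (B * V) powr q + \<bar>\<xi> (Suc k) \<omega>\<bar> powr p"
          using s by (simp add: powr_divide sR powr_numeral)
        have "R > 0" unfolding R_def using B Vp by simp
        then have "\<bar>S \<omega>\<bar> powr (p - 2) * (y \<omega>)\<^sup>2
           = h * R * ((\<bar>S \<omega>\<bar> powr (p - 2) / R) * (\<xi> (Suc k) \<omega>)\<^sup>2)"
          unfolding y_def h_def by (simp add: power_mult_distrib)
        also have "\<dots> \<le> h * R * (\<bar>S \<omega>\<bar> powr p / (B * V) powr q + \<bar>\<xi> (Suc k) \<omega>\<bar> powr p)"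
          using * h \<open>R > 0\<close> by (intro mult_left_mono) auto
        finally show ?thesis .
      qed
      have point: "\<bar>S \<omega> + y \<omega>\<bar> powr p \<le> \<bar>S \<omega>\<bar> powr p
          + p * a (Suc k) * ((sgn (S \<omega>) * \<bar>S \<omega>\<bar> powr (p - 1)) * \<xi> (Suc k) \<omega>)
          + C * h * R * (\<bar>S \<omega>\<bar> powr p / (B * V) powr q + \<bar>\<xi> (Suc k) \<omega>\<bar> powr p)
          + C * \<bar>y \<omega>\<bar> powr p" for \<omega>
        using abs_powr_taylor[OF p, of "S \<omega>" "y \<omega>"] mult_left_mono[OF quad[of \<omega>], of C] C
        unfolding C_def[symmetric] by (simp add: y_def algebra_simps)
      have "(\<integral>\<omega>. \<bar>S \<omega> + y \<omega>\<bar> powr p \<partial>M) \<le> (\<integral>\<omega>. \<bar>S \<omega>\<bar> powr p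
          + p * a (Suc k) * ((sgn (S \<omega>) * \<bar>S \<omega>\<bar> powr (p - 1)) * \<xi> (Suc k) \<omega>)
          + C * h * R * (\<bar>S \<omega>\<bar> powr p / (B * V) powr q + \<bar>\<xi> (Suc k) \<omega>\<bar> powr p)
          + C * \<bar>y \<omega>\<bar> powr p \<partial>M)"
        using Sint yint Tint crossint int[OF k] point by (intro integral_mono) auto
      also have "\<dots> = (\<integral>\<omega>. \<bar>S \<omega>\<bar> powr p \<partial>M)
          + C * h * R * ((\<integral>\<omega>. \<bar>S \<omega>\<bar> powr p \<partial>M) / (B * V) powr q + (\<integral>\<omega>. \<bar>\<xi> (Suc k) \<omega>\<bar> powr p \<partial>M))
          + C * (\<integral>\<omega>. \<bar>y \<omega>\<bar> powr p \<partial>M)"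
        using Sint yint crossint int[OF k] crosszero by simp
      also have "\<dots> \<le> B powr q * V powr q * m + C * h * R * (m + m) + C * (h powr q * m)"
      proof (intro add_mono mult_left_mono Sb yb bound[OF k])
        have "(\<integral>\<omega>. \<bar>S \<omega>\<bar> powr p \<partial>M) \<le> (B * V) powr q * m"
          using Sb B V by (simp add: powr_mult)
        then show "(\<integral>\<omega>. \<bar>S \<omega>\<bar> powr p \<partial>M) / (B * V) powr q \<le> m"
          using B Vp by (simp add: pos_divide_le_eq mult.commute)
      qed (use C h in \<open>auto simp: R_def\<close>)
      also have "\<dots> = (B powr q * V powr q + (2 * C * R * h + C * h powr q)) * m"
        by (simp add: algebra_simps)
      \<comment> \<open>The target is an increment of \<open>v powr q\<close>: \<open>R\<close> and
        \<open>h powr (q - 1)\<close> are both compared with \<open>(V + h) powr (q - 1)\<close>, so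
        that \<open>V powr q + h * (V + h) powr (q - 1) \<le> (V + h) powr q\<close> closes the
        induction.\<close>
      also have "\<dots> \<le> (B powr q * V powr q + B powr q * (h * (V + h) powr (q - 1))) * m"
      proof (intro mult_right_mono[OF _ m] add_left_mono)
        have R': "R \<le> B powr (q - 1) * (V + h) powr (q - 1)"
          unfolding R_def using B V h q by (subst powr_mult[symmetric]) (auto intro!: powr_mono2)
        have hq: "h powr q = h * h powr (q - 1)" using powr_mult_base[OF h, of "q - 1"] by simp
        have hh: "h powr (q - 1) \<le> (V + h) powr (q - 1)" using V h q by (intro powr_mono2) auto
        have Bq: "B powr q = B * B powr (q - 1)" using powr_mult_base[of B "q - 1"] B by simp
        have B1: "B powr (q - 1) \<ge> 1" using B q by (intro ge_one_powr_ge_zero) auto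
        have "2 * C * R * h + C * h powr q
          \<le> 2 * C * (B powr (q - 1) * (V + h) powr (q - 1)) * h + C * (h * (V + h) powr (q - 1))"
          unfolding hq using C h R' hh by (intro add_mono mult_left_mono mult_right_mono) auto
        also have "\<dots> = (2 * C * B powr (q - 1) + C * 1) * (h * (V + h) powr (q - 1))"
          by (simp add: algebra_simps)
        also have "\<dots> \<le> (2 * C * B powr (q - 1) + C * B powr (q - 1)) * (h * (V + h) powr (q - 1))"
          using B1 C h by (intro mult_right_mono add_left_mono mult_left_mono) auto
        also have "\<dots> \<le> B powr q * (h * (V + h) powr (q - 1))"
        proof (intro mult_right_mono)
          have "(2 * C + C) * B powr (q - 1) \<le> B * B powr (q - 1)"
            unfolding B_def using C by (intro mult_right_mono) auto
          then show "2 * C * B powr (q - 1) + C * B powr (q - 1) \<le> B powr q"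
            unfolding Bq by (simp add: algebra_simps)
        qed (use h in auto)
        finally show "2 * C * R * h + C * h powr q \<le> B powr q * (h * (V + h) powr (q - 1))" .
      qed
      also have "\<dots> \<le> B powr q * (V + h) powr q * m"
      proof (intro mult_right_mono[OF _ m])
        have "V powr q = V * V powr (q - 1)" using powr_mult_base[OF V, of "q - 1"] by simp
        also have "\<dots> \<le> V * (V + h) powr (q - 1)"
          using V h q by (intro mult_left_mono powr_mono2) auto
        finally have "V powr q + h * (V + h) powr (q - 1) \<le> (V + h) * (V + h) powr (q - 1)"
          by (simp add: algebra_simps)
        also have "\<dots> = (V + h) powr q" using powr_mult_base[of "V + h" "q - 1"] V h by simp
        finally show "B powr q * V powr q + B powr q * (h * (V + h) powr (q - 1))
            \<le> B powr q * (V + h) powr q"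
          by (simp flip: distrib_left add: mult_left_mono)
      qed
      finally show ?thesis
        using Tint unfolding S_def y_def V_def h_def mc q_def by simp
    qed
  qed
  from this[of n] show ?thesis by simp
qed


section \<open>Dyadic chaining\<close>

lemma infnorm_le_iff_cart: "infnorm (x :: real ^ 'k) \<le> c \<longleftrightarrow> (\<forall>r. \<bar>x $ r\<bar> \<le> c)"
  by (auto simp: infnorm_Max Basis_vec_def inner_axis)

lemma unit_cube_eq_cbox: "(unit_cube :: (real ^ 'k) set) = cbox 0 1"
  by (auto simp: unit_cube_def mem_box_cart)

lemma compact_unit_cube: "compact (unit_cube :: (real ^ 'k) set)"
  by (simp add: unit_cube_eq_cbox compact_cbox)

definition dyadic_grid :: "nat \<Rightarrow> (real ^ 'k) set" where
  "dyadic_grid m = {t. \<forall>r. t $ r \<in> (\<lambda>j. real j / 2 ^ m) ` {0..2 ^ m}}"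

definition dyadic_points :: "(real ^ 'k) set" where
  "dyadic_points = (\<Union>m. dyadic_grid m)"

definition snap :: "nat \<Rightarrow> real ^ 'k \<Rightarrow> real ^ 'k" where
  "snap m t = (\<chi> r. of_int \<lfloor>2 ^ m * t $ r\<rfloor> / 2 ^ m)"

text \<open>Each axis carries \<open>2 ^ m + 1\<close> points; rounding this up to
  \<open>2 ^ Suc m\<close> keeps all later counts pure powers of 2.\<close>

lemma dyadic_grid_bound:
  shows finite_dyadic_grid: "finite (dyadic_grid m :: (real ^ 'k) set)"
    and card_dyadic_grid_le: "card (dyadic_grid m :: (real ^ 'k) set) \<le> (2 ^ Suc m) ^ CARD('k)"
proof -
  let ?S = "(\<lambda>j. real j / 2 ^ m) ` {0..2 ^ m :: nat}"
  let ?P = "Pi\<^sub>E (UNIV :: 'k set) (\<lambda>_. ?S)"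
  have sub: "(dyadic_grid m :: (real ^ 'k) set) \<subseteq> vec_lambda ` ?P"
  proof
    fix t :: "real ^ 'k" assume "t \<in> dyadic_grid m"
    then have "(\<lambda>r. t $ r) \<in> ?P" by (auto simp: dyadic_grid_def)
    then show "t \<in> vec_lambda ` ?P" by (metis imageI vec_nth_inverse)
  qed
  have fin: "finite ?P" by (intro finite_PiE) auto
  show "finite (dyadic_grid m :: (real ^ 'k) set)"
    using sub fin finite_surj by blast
  have "card (dyadic_grid m :: (real ^ 'k) set) \<le> card (vec_lambda ` ?P :: (real ^ 'k) set)"
    using sub fin by (intro card_mono) auto
  also have "\<dots> \<le> card ?P" using fin by (rule card_image_le)
  also have "\<dots> = card ?S ^ CARD('k)" by (simp add: card_PiE)
  also have "\<dots> \<le> (2 ^ Suc m) ^ CARD('k)"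
  proof (rule power_mono)
    have "card ?S \<le> card {0..2 ^ m :: nat}" by (rule card_image_le) simp
    also have "\<dots> \<le> 2 ^ Suc m" by simp
    finally show "card ?S \<le> 2 ^ Suc m" .
  qed simp
  finally show "card (dyadic_grid m :: (real ^ 'k) set) \<le> (2 ^ Suc m) ^ CARD('k)" .
qed

lemma dyadic_grid_subset_cube: "dyadic_grid m \<subseteq> unit_cube"
proof
  fix t :: "real ^ 'k" assume t: "t \<in> dyadic_grid m"
  show "t \<in> unit_cube" unfolding unit_cube_def
  proof safe
    fix r
    from t obtain j :: nat where "j \<le> 2 ^ m" "t $ r = real j / 2 ^ m"
      unfolding dyadic_grid_def by fastforce
    moreover from this(1) have "real j \<le> 2 ^ m"
      by (metis of_nat_le_iff of_nat_numeral of_nat_power)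
    ultimately show "0 \<le> t $ r" "t $ r \<le> 1" by simp_all
  qed
qed

lemma dyadic_points_subset_cube: "dyadic_points \<subseteq> unit_cube"
  unfolding dyadic_points_def using dyadic_grid_subset_cube by blast

lemma countable_dyadic_points: "countable (dyadic_points :: (real ^ 'k) set)"
  unfolding dyadic_points_def using finite_dyadic_grid by (auto intro: countable_finite)

lemma snap_in_dyadic_grid:
  assumes t: "t \<in> unit_cube"
  shows "snap m t \<in> dyadic_grid m"
  unfolding dyadic_grid_def
proof (rule CollectI, rule allI)
  fix r
  have b: "0 \<le> t $ r" "t $ r \<le> 1" using t by (auto simp: unit_cube_def)
  let ?z = "\<lfloor>2 ^ m * t $ r\<rfloor>"
  have "0 \<le> ?z" using b by simp
  moreover have "?z \<le> \<lfloor>2 ^ m * (1::real)\<rfloor>" using b by (intro floor_mono mult_left_mono) auto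
  then have "?z \<le> 2 ^ m"
    by (metis floor_of_int mult.right_neutral of_int_numeral of_int_power)
  ultimately have "nat ?z \<in> {0..2 ^ m}" "snap m t $ r = real (nat ?z) / 2 ^ m"
    by (auto simp: snap_def nat_le_iff)
  then show "snap m t $ r \<in> (\<lambda>j. real j / 2 ^ m) ` {0..2 ^ m}" by blast
qed

lemma infnorm_snap: "infnorm (t - snap m t) \<le> 1 / 2 ^ m"
  unfolding infnorm_le_iff_cart
proof
  fix r
  have "of_int \<lfloor>2 ^ m * t $ r\<rfloor> \<le> 2 ^ m * t $ r" "2 ^ m * t $ r \<le> of_int \<lfloor>2 ^ m * t $ r\<rfloor> + 1"
    by linarith+
  then have "of_int \<lfloor>2 ^ m * t $ r\<rfloor> / 2 ^ m \<le> t $ r" "t $ r \<le> of_int \<lfloor>2 ^ m * t $ r\<rfloor> / 2 ^ m + 1 / 2 ^ m"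
    by (simp_all add: field_simps)
  then show "\<bar>(t - snap m t) $ r\<bar> \<le> 1 / 2 ^ m" by (simp add: snap_def)
qed

lemma dyadic_grid_Suc: "dyadic_grid m \<subseteq> dyadic_grid (Suc m)"
proof
  fix t :: "real ^ 'k" assume t: "t \<in> dyadic_grid m"
  show "t \<in> dyadic_grid (Suc m)" unfolding dyadic_grid_def
  proof (rule CollectI, rule allI)
    fix r
    from t obtain j :: nat where "j \<le> 2 ^ m" "t $ r = real j / 2 ^ m"
      unfolding dyadic_grid_def by fastforce
    then have "2 * j \<in> {0..2 ^ Suc m}" "t $ r = real (2 * j) / 2 ^ Suc m" by auto
    then show "t $ r \<in> (\<lambda>j. real j / 2 ^ Suc m) ` {0..2 ^ Suc m}" by blast
  qed
qed

lemma dyadic_grid_mono: "m \<le> m' \<Longrightarrow> dyadic_grid m \<subseteq> dyadic_grid m'"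
  by (rule lift_Suc_mono_le[of dyadic_grid, OF dyadic_grid_Suc])

lemma snap_tendsto: "(\<lambda>m. snap m t) \<longlonglongrightarrow> (t :: real ^ 'k)"
proof (rule vec_tendstoI)
  fix r
  have "(\<lambda>m. 1 / 2 ^ m :: real) \<longlonglongrightarrow> 0" by real_asymp
  moreover have "\<bar>snap m t $ r - t $ r\<bar> \<le> 1 / 2 ^ m" for m
    using infnorm_snap[of t m] unfolding infnorm_le_iff_cart by (auto simp: abs_minus_commute)
  ultimately have "(\<lambda>m. snap m t $ r - t $ r) \<longlonglongrightarrow> 0"
    by (intro Lim_null_comparison[of "\<lambda>m. snap m t $ r - t $ r" "\<lambda>m. 1 / 2 ^ m"]) auto
  then show "(\<lambda>m. snap m t $ r) \<longlonglongrightarrow> t $ r" by (rule LIM_zero_cancel)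
qed

lemma continuous_snap_tendsto:
  assumes "continuous_on unit_cube g" "t \<in> unit_cube"
  shows "(\<lambda>m. g (snap m t)) \<longlonglongrightarrow> g (t :: real ^ 'k)"
proof (rule continuous_on_tendsto_compose[OF assms(1) snap_tendsto assms(2)])
  show "\<forall>\<^sub>F m in sequentially. snap m t \<in> unit_cube"
    using snap_in_dyadic_grid[OF assms(2)] dyadic_grid_subset_cube by (intro always_eventually) blast
qed

lemma snap_in_dyadic_points: "t \<in> unit_cube \<Longrightarrow> snap m t \<in> dyadic_points"
  unfolding dyadic_points_def using snap_in_dyadic_grid by blast

text \<open>Snapped points are dyadic and converge to \<open>t\<close>. Suprema over the countable
  set are measurable, and for continuous functions they may thus stand for suprema over the
  cube.\<close>

lemma SUP_dyadic_points_upper: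
  fixes g :: "real ^ 'k \<Rightarrow> real"
  assumes "continuous_on unit_cube g" "t \<in> unit_cube"
  shows "ennreal \<bar>g t\<bar> \<le> (SUP s\<in>dyadic_points. ennreal \<bar>g s\<bar>)"
proof (rule LIMSEQ_le_const2)
  show "(\<lambda>m. ennreal \<bar>g (snap m t)\<bar>) \<longlonglongrightarrow> ennreal \<bar>g t\<bar>"
    by (intro tendsto_intros continuous_snap_tendsto assms)
  show "\<exists>N. \<forall>n\<ge>N. ennreal \<bar>g (snap n t)\<bar> \<le> (SUP s\<in>dyadic_points. ennreal \<bar>g s\<bar>)"
    by (intro exI allI impI SUP_upper snap_in_dyadic_points assms)
qed

text \<open>Used with the level \<open>c\<close> free, this replaces Jensen's inequality.\<close>

lemma le_level_plus_powr:
  fixes y c p :: real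
  assumes "c > 0" "p \<ge> 1"
  shows "\<bar>y\<bar> \<le> c + c powr (1 - p) * \<bar>y\<bar> powr p"
proof (cases "\<bar>y\<bar> \<le> c")
  case True
  have "0 \<le> c powr (1 - p) * \<bar>y\<bar> powr p" by simp
  then show ?thesis using True by linarith
next
  case False
  then have "c powr (p - 1) \<le> \<bar>y\<bar> powr (p - 1)" using assms by (intro powr_mono2) auto
  then have "c powr (1 - p) * c powr (p - 1) * \<bar>y\<bar> \<le> c powr (1 - p) * \<bar>y\<bar> powr (p - 1) * \<bar>y\<bar>"
    by (intro mult_right_mono mult_left_mono) auto
  moreover have "c powr (1 - p) * c powr (p - 1) = 1"
    using assms by (simp flip: powr_add)
  moreover have "\<bar>y\<bar> powr (p - 1) * \<bar>y\<bar> = \<bar>y\<bar> powr p"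
    using powr_mult_base[of "\<bar>y\<bar>" "p - 1"] by (simp add: mult.commute)
  ultimately show ?thesis using assms by (simp add: mult.assoc)
qed

text \<open>The maximum of the p-th powers is bounded by their sum, which costs only the factor
  \<open>card F\<close>. Optimising \<open>c\<close> would give the order
  \<open>(card F * b) powr (1 / p)\<close>; the choice is left to the caller.\<close>

lemma nn_integral_finite_SUP_le:
  fixes Y :: "'i \<Rightarrow> 'a \<Rightarrow> real"
  assumes M: "prob_space M" and F: "finite F"
    and Y: "\<And>s. s \<in> F \<Longrightarrow> Y s \<in> borel_measurable M"
    and b: "\<And>s. s \<in> F \<Longrightarrow> (\<integral>\<^sup>+\<omega>. ennreal (\<bar>Y s \<omega>\<bar> powr p) \<partial>M) \<le> ennreal b" "b \<ge> 0"
    and l: "c > 0" and p: "p \<ge> 1"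
  shows "(\<integral>\<^sup>+\<omega>. (SUP s\<in>F. ennreal \<bar>Y s \<omega>\<bar>) \<partial>M)
     \<le> ennreal (c + c powr (1 - p) * (real (card F) * b))"
proof -
  interpret prob_space M by fact
  have "(\<integral>\<^sup>+\<omega>. (SUP s\<in>F. ennreal \<bar>Y s \<omega>\<bar>) \<partial>M)
     \<le> (\<integral>\<^sup>+\<omega>. ennreal c + ennreal (c powr (1 - p)) * (\<Sum>s\<in>F. ennreal (\<bar>Y s \<omega>\<bar> powr p)) \<partial>M)"
  proof (intro nn_integral_mono SUP_least)
    fix \<omega> s assume s: "s \<in> F"
    have "ennreal \<bar>Y s \<omega>\<bar> \<le> ennreal (c + c powr (1 - p) * \<bar>Y s \<omega>\<bar> powr p)"
      by (intro ennreal_leI le_level_plus_powr l p)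
    also have "\<dots> = ennreal c + ennreal (c powr (1 - p)) * ennreal (\<bar>Y s \<omega>\<bar> powr p)"
      using l by (simp add: ennreal_plus ennreal_mult)
    also have "\<dots> \<le> ennreal c + ennreal (c powr (1 - p)) * (\<Sum>s\<in>F. ennreal (\<bar>Y s \<omega>\<bar> powr p))"
      using s F by (intro add_left_mono mult_left_mono member_le_sum) auto
    finally show "ennreal \<bar>Y s \<omega>\<bar>
      \<le> ennreal c + ennreal (c powr (1 - p)) * (\<Sum>s\<in>F. ennreal (\<bar>Y s \<omega>\<bar> powr p))" .
  qed
  also have "\<dots> = ennreal c + ennreal (c powr (1 - p)) * (\<Sum>s\<in>F. \<integral>\<^sup>+\<omega>. ennreal (\<bar>Y s \<omega>\<bar> powr p) \<partial>M)"
  proof -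
    have m: "(\<lambda>\<omega>. ennreal (\<bar>Y s \<omega>\<bar> powr p)) \<in> borel_measurable M" if "s \<in> F" for s
      using Y[OF that] by measurable
    then have "(\<lambda>\<omega>. \<Sum>s\<in>F. ennreal (\<bar>Y s \<omega>\<bar> powr p)) \<in> borel_measurable M"
      by (rule borel_measurable_sum)
    then show ?thesis
      by (subst nn_integral_add) (auto simp: nn_integral_cmult nn_integral_sum[OF m]
          emeasure_space_1 simp del: sum_ennreal)
  qed
  also have "\<dots> \<le> ennreal c + ennreal (c powr (1 - p)) * (\<Sum>s\<in>F. ennreal b)"
    by (intro add_left_mono mult_left_mono sum_mono b) auto
  also have "\<dots> = ennreal (c + c powr (1 - p) * (real (card F) * b))"
    using l b(2) by (simp add: ennreal_plus ennreal_mult ennreal_of_nat_eq_real_of_nat)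
  finally show ?thesis .
qed

text \<open>A point of level \<open>m\<^sub>0 + j\<close> descends to level \<open>m\<^sub>0\<close>
  by \<open>j\<close> snaps, at the cost of one increment per level. Every dyadic point lies in some
  grid, so the telescoping sum is finite and neither continuity nor a limit enters.\<close>

lemma dyadic_chain_bound:
  fixes g :: "real ^ 'k \<Rightarrow> real"
  shows "(SUP t\<in>dyadic_points. ennreal \<bar>g t\<bar>) \<le> (SUP s\<in>dyadic_grid m\<^sub>0. ennreal \<bar>g s\<bar>)
     + (\<Sum>l. SUP s\<in>dyadic_grid (Suc (m\<^sub>0 + l)). ennreal \<bar>g s - g (snap (m\<^sub>0 + l) s)\<bar>)"
proof (rule SUP_least)
  let ?A = "SUP s\<in>dyadic_grid m\<^sub>0. ennreal \<bar>g s\<bar>"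
  let ?R = "\<lambda>l. SUP s\<in>dyadic_grid (Suc (m\<^sub>0 + l)). ennreal \<bar>g s - g (snap (m\<^sub>0 + l) s)\<bar>"
  have chain: "\<And>t. t \<in> dyadic_grid (m\<^sub>0 + j) \<Longrightarrow> ennreal \<bar>g t\<bar> \<le> ?A + (\<Sum>l<j. ?R l)" for j
  proof (induction j)
    case 0
    then show ?case by (auto intro: SUP_upper)
  next
    case (Suc j)
    let ?s = "snap (m\<^sub>0 + j) t"
    have "ennreal \<bar>g t\<bar> \<le> ennreal (\<bar>g ?s\<bar> + \<bar>g t - g ?s\<bar>)" by (intro ennreal_leI) auto
    also have "\<dots> = ennreal \<bar>g ?s\<bar> + ennreal \<bar>g t - g ?s\<bar>" by (simp add: ennreal_plus)
    also have "ennreal \<bar>g ?s\<bar> \<le> ?A + (\<Sum>l<j. ?R l)"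
      using Suc.prems dyadic_grid_subset_cube by (intro Suc.IH snap_in_dyadic_grid) blast
    also have "ennreal \<bar>g t - g ?s\<bar> \<le> ?R j"
      using Suc.prems by (intro SUP_upper) auto
    finally show ?case by (simp add: add.assoc add_mono)
  qed
  fix t :: "real ^ 'k" assume "t \<in> dyadic_points"
  then obtain m where "t \<in> dyadic_grid m" by (auto simp: dyadic_points_def)
  then have "t \<in> dyadic_grid (m\<^sub>0 + m)" using dyadic_grid_mono[of m "m\<^sub>0 + m"] by auto
  then have "ennreal \<bar>g t\<bar> \<le> ?A + (\<Sum>l<m. ?R l)" by (rule chain)
  also have "\<dots> \<le> ?A + (\<Sum>l. ?R l)" by (intro add_left_mono sum_le_suminf) auto
  finally show "ennreal \<bar>g t\<bar> \<le> ?A + (\<Sum>l. ?R l)" .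
qed

text \<open>With levels \<open>\<tau> q\<^sup>l\<close> the two terms of \<open>le_level_plus_powr\<close> decay at the same rate exactly
  for this ratio \<open>q\<close>.\<close>

definition chain_ratio :: "nat \<Rightarrow> real \<Rightarrow> real" where
  "chain_ratio k p = 2 powr (- (p - real k) / p)"

lemma chain_ratio: "p > real k \<Longrightarrow> 0 < chain_ratio k p \<and> chain_ratio k p < 1"
  unfolding chain_ratio_def using powr_less_mono[of "- (p - real k) / p" 0 2]
  by (auto simp: divide_less_0_iff)

text \<open>The increment bound gains over the bound for single values only at distances below
  \<open>e\<close>. The chain therefore starts at a grid of spacing about \<open>e\<close>, whose
  points are all charged with \<open>A\<close>; at each refinement the count grows by
  \<open>2 ^ k\<close> while the moment of a step shrinks by \<open>2 powr (- p)\<close>.\<close>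

lemma nn_integral_SUP_chaining:
  fixes g :: "real ^ 'k \<Rightarrow> 'a \<Rightarrow> real"
  assumes M: "prob_space M"
    and meas: "\<And>t. t \<in> unit_cube \<Longrightarrow> g t \<in> borel_measurable M"
    and bound: "\<And>t. t \<in> unit_cube \<Longrightarrow> (\<integral>\<^sup>+\<omega>. ennreal (\<bar>g t \<omega>\<bar> powr p) \<partial>M) \<le> ennreal A"
    and incr: "\<And>s t. s \<in> unit_cube \<Longrightarrow> t \<in> unit_cube \<Longrightarrow>
      (\<integral>\<^sup>+\<omega>. ennreal (\<bar>g s \<omega> - g t \<omega>\<bar> powr p) \<partial>M) \<le> ennreal (A * (infnorm (s - t) / e) powr p)"
    and A: "A \<ge> 0" and e: "0 < e" "e \<le> 1" and p: "p > real CARD('k)" and \<tau>: "\<tau> > 0"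
  shows "(\<integral>\<^sup>+\<omega>. (SUP t\<in>dyadic_points. ennreal \<bar>g t \<omega>\<bar>) \<partial>M)
    \<le> ennreal ((1 + 1 / (1 - chain_ratio CARD('k) p)) *
        (\<tau> + \<tau> powr (1 - p) * ((8 / e) ^ CARD('k) * A)))"
proof -
  interpret prob_space M by fact
  define k where "k = CARD('k)"
  define q where "q = chain_ratio k p"
  have q: "0 < q" "q < 1" using chain_ratio[of k p] p unfolding q_def k_def by auto
  have k1: "k \<ge> 1" unfolding k_def by (simp add: Suc_leI)
  have p1: "p > real k" using p unfolding k_def .
  moreover have "real k \<ge> 1" using k1 by simp
  ultimately have "p > 1" by linarith
  note p1 = this p1
  define T where "T = \<tau> + \<tau> powr (1 - p) * ((8 / e) ^ k * A)"
  have T: "T \<ge> 0" unfolding T_def using \<tau> A e by auto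
  \<comment> \<open>The least level with spacing at most \<open>e\<close>. Minimality bounds the
    number of its points, since the previous level has spacing above \<open>e\<close>; level 0 is
    covered by \<open>e \<le> 1\<close>.\<close>
  obtain m\<^sub>0 :: nat where m0: "2 ^ m\<^sub>0 \<le> 2 / e" "1 / 2 ^ m\<^sub>0 \<le> e"
  proof -
    obtain j :: nat where "1 / 2 ^ j \<le> e"
      using e real_arch_pow_inv[of e "1 / 2"] by (auto simp: power_one_over intro: less_imp_le)
    define m where "m = (LEAST j::nat. 1 / 2 ^ j \<le> e)"
    have 1: "1 / 2 ^ m \<le> e" unfolding m_def by (rule LeastI) fact
    have "(2::real) ^ m \<le> 2 / e"
    proof (cases m)
      case 0 then show ?thesis using e by (simp add: field_simps)
    next
      case (Suc i)
      then have "\<not> (1 / 2 ^ i \<le> e)" using not_less_Least[of i "\<lambda>j. 1 / 2 ^ j \<le> e"] unfolding m_def by auto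
      then show ?thesis using e Suc by (simp add: field_simps)
    qed
    then show ?thesis using 1 that by blast
  qed
  define R where "R l \<omega> = (SUP s\<in>dyadic_grid (Suc (m\<^sub>0 + l)). ennreal \<bar>g s \<omega> - g (snap (m\<^sub>0 + l) s) \<omega>\<bar>)"
    for l \<omega>
  have grid: "s \<in> unit_cube" if "s \<in> dyadic_grid m" for s :: "real ^ 'k" and m
    using that dyadic_grid_subset_cube by blast
  have Rmeas[measurable]: "R l \<in> borel_measurable M" for l
    unfolding R_def using finite_dyadic_grid
    by (intro borel_measurable_SUP countable_finite measurable_compose[OF _ measurable_ennreal]
       borel_measurable_abs borel_measurable_diff meas snap_in_dyadic_grid grid
       grid[OF snap_in_dyadic_grid]) auto
  define R0 where "R0 \<omega> = (SUP s\<in>dyadic_grid m\<^sub>0. ennreal \<bar>g s \<omega>\<bar>)" for \<omega>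
  have R0meas[measurable]: "R0 \<in> borel_measurable M"
    unfolding R0_def using finite_dyadic_grid
    by (intro borel_measurable_SUP countable_finite measurable_compose[OF _ measurable_ennreal]
       borel_measurable_abs meas grid) auto
  have R0int: "(\<integral>\<^sup>+\<omega>. R0 \<omega> \<partial>M) \<le> ennreal T"
  proof -
    have "(\<integral>\<^sup>+\<omega>. R0 \<omega> \<partial>M)
       \<le> ennreal (\<tau> + \<tau> powr (1 - p) * (real (card (dyadic_grid m\<^sub>0 :: (real ^ 'k) set)) * A))"
      unfolding R0_def using p1 by (intro nn_integral_finite_SUP_le M finite_dyadic_grid meas bound grid \<tau> A) auto
    also have "\<dots> \<le> ennreal T" unfolding T_def
    proof (intro ennreal_leI add_left_mono mult_left_mono mult_right_mono A)
      have "real (card (dyadic_grid m\<^sub>0 :: (real ^ 'k) set)) \<le> real ((2 ^ Suc m\<^sub>0) ^ k)"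
        using card_dyadic_grid_le[where ?'k = 'k, of m\<^sub>0] unfolding k_def of_nat_le_iff .
      also have "\<dots> = (2 * 2 ^ m\<^sub>0) ^ k" by simp
      also have "\<dots> \<le> (8 / e) ^ k" using m0 e by (intro power_mono) (auto simp: field_simps)
      finally show "real (card (dyadic_grid m\<^sub>0 :: (real ^ 'k) set)) \<le> (8 / e) ^ k" .
    qed auto
    finally show ?thesis .
  qed
  \<comment> \<open>The threshold at the \<open>l\<close>-th refinement is
    \<open>\<tau> * q ^ l\<close>, so that the bounds form a geometric series.\<close>
  have Rint: "(\<integral>\<^sup>+\<omega>. R l \<omega> \<partial>M) \<le> ennreal (T * q ^ l)" for l
  proof -
    define b where "b = A * (1 / 2 ^ l) powr p"
    have b0: "b \<ge> 0" unfolding b_def using A by simp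
    have lp: "\<tau> * q ^ l > 0" using \<tau> q by simp
    have bb: "(\<integral>\<^sup>+\<omega>. ennreal (\<bar>g s \<omega> - g (snap (m\<^sub>0 + l) s) \<omega>\<bar> powr p) \<partial>M) \<le> ennreal b"
      if s: "s \<in> dyadic_grid (Suc (m\<^sub>0 + l))" for s
    proof -
      have "infnorm (s - snap (m\<^sub>0 + l) s) / e \<le> (1 / 2 ^ (m\<^sub>0 + l)) / e"
        using e by (intro divide_right_mono infnorm_snap) auto
      also have "\<dots> = (1 / 2 ^ m\<^sub>0 / e) * (1 / 2 ^ l)" by (simp add: power_add)
      also have "\<dots> \<le> 1 * (1 / 2 ^ l)" 
      proof (rule mult_right_mono)
        show "1 / 2 ^ m\<^sub>0 / e \<le> 1" using m0(2) e by (simp add: field_simps)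
      qed simp
      finally have "infnorm (s - snap (m\<^sub>0 + l) s) / e \<le> 1 / 2 ^ l" by simp
      then have "A * (infnorm (s - snap (m\<^sub>0 + l) s) / e) powr p \<le> b"
        unfolding b_def using A e p1 by (intro mult_left_mono powr_mono2) (auto simp: infnorm_pos_le)
      then show ?thesis
        using incr[OF grid[OF s] grid[OF snap_in_dyadic_grid[OF grid[OF s]]]]
        by (meson ennreal_leI order_trans)
    qed
    have "(\<integral>\<^sup>+\<omega>. R l \<omega> \<partial>M) \<le> ennreal (\<tau> * q ^ l + (\<tau> * q ^ l) powr (1 - p) *
        (real (card (dyadic_grid (Suc (m\<^sub>0 + l)) :: (real ^ 'k) set)) * b))"
      unfolding R_def
      by (intro nn_integral_finite_SUP_le M finite_dyadic_grid bb b0 lp borel_measurable_diff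
          meas grid[OF snap_in_dyadic_grid] grid) (use p1 in auto)
    also have "\<dots> \<le> ennreal (T * q ^ l)"
    proof (rule ennreal_leI)
      \<comment> \<open>Two doublings, one for the next level and one from the crude count, together
        with \<open>2 ^ m\<^sub>0 \<le> 2 / e\<close> give the 8.\<close>
      have "real (card (dyadic_grid (Suc (m\<^sub>0 + l)) :: (real ^ 'k) set)) \<le> real ((2 ^ Suc (Suc (m\<^sub>0 + l))) ^ k)"
        using card_dyadic_grid_le[where ?'k = 'k, of "Suc (m\<^sub>0 + l)"] unfolding k_def of_nat_le_iff .
      also have "\<dots> = (4 * 2 ^ m\<^sub>0 * 2 ^ l) ^ k" by (simp add: power_add power_mult_distrib)
      also have "\<dots> \<le> (8 / e * 2 ^ l) ^ k"
        using m0 e by (intro power_mono mult_right_mono) (auto simp: field_simps)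
      finally have card: "real (card (dyadic_grid (Suc (m\<^sub>0 + l)) :: (real ^ 'k) set)) \<le> (8 / e) ^ k * (2 ^ l) ^ k"
        by (simp only: power_mult_distrib)
      \<comment> \<open>With \<open>q = 2 powr c\<close> the identity reads
        \<open>c * (1 - p) + k - p = c\<close>, that is \<open>c * p = k - p\<close>, the equation
        that determines the ratio.\<close>
      have ql: "(q ^ l) powr (1 - p) * ((2 ^ l) ^ k * (1 / 2 ^ l) powr p) = q ^ l"
      proof -
        define c where "c = - (p - real k) / p"
        have q_eq: "q ^ l = 2 powr (c * real l)"
          using powr_realpow[of q l] q unfolding q_def chain_ratio_def c_def
          by (simp only: powr_powr)
        have two: "(2::real) ^ l = 2 powr real l" by (simp add: powr_realpow)
        have "(q ^ l) powr (1 - p) = 2 powr (c * real l * (1 - p))"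
          unfolding q_eq by (rule powr_powr)
        moreover have "((2::real) ^ l) ^ k = 2 powr (real l * real k)"
          unfolding two by (subst powr_realpow[symmetric]) (simp_all add: powr_powr)
        moreover have "(1 / 2 ^ l :: real) powr p = 2 powr (- real l * p)"
          unfolding two by (simp add: powr_minus_divide[symmetric] powr_powr)
        moreover have "c * real l * (1 - p) + (real l * real k + - real l * p) = c * real l"
        proof -
          have "c * p = real k - p" using p1 unfolding c_def by simp
          moreover have "c * real l * (1 - p) = c * real l - real l * (c * p)"
            by (simp add: algebra_simps)
          ultimately have "c * real l * (1 - p) = c * real l - real l * (real k - p)" by simp
          then show ?thesis by (simp add: algebra_simps)
        qed
        moreover note q_eq
        ultimately show ?thesis by (simp only: powr_add[symmetric])
      qed
      have "\<tau> * q ^ l + (\<tau> * q ^ l) powr (1 - p) *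
          (real (card (dyadic_grid (Suc (m\<^sub>0 + l)) :: (real ^ 'k) set)) * b)
        \<le> \<tau> * q ^ l + (\<tau> * q ^ l) powr (1 - p) * (((8 / e) ^ k * (2 ^ l) ^ k) * b)"
        by (intro add_left_mono mult_left_mono mult_right_mono card b0) auto
      also have "\<dots> = \<tau> * q ^ l + \<tau> powr (1 - p) * ((8 / e) ^ k * A)
          * ((q ^ l) powr (1 - p) * ((2 ^ l) ^ k * (1 / 2 ^ l) powr p))"
      proof -
        have "(\<tau> * q ^ l) powr (1 - p) = \<tau> powr (1 - p) * (q ^ l) powr (1 - p)"
          using \<tau> q by (intro powr_mult)
        then show ?thesis unfolding b_def by (simp only: mult_ac)
      qed
      also have "\<dots> = T * q ^ l" unfolding ql T_def by (simp add: algebra_simps)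
      finally show "\<tau> * q ^ l + (\<tau> * q ^ l) powr (1 - p) *
          (real (card (dyadic_grid (Suc (m\<^sub>0 + l)) :: (real ^ 'k) set)) * b) \<le> T * q ^ l" .
    qed
    finally show ?thesis .
  qed
  have "(\<integral>\<^sup>+\<omega>. (SUP t\<in>dyadic_points. ennreal \<bar>g t \<omega>\<bar>) \<partial>M) \<le> (\<integral>\<^sup>+\<omega>. R0 \<omega> + (\<Sum>l. R l \<omega>) \<partial>M)"
    unfolding R0_def R_def by (intro nn_integral_mono dyadic_chain_bound)
  also have "\<dots> = (\<integral>\<^sup>+\<omega>. R0 \<omega> \<partial>M) + (\<Sum>l. \<integral>\<^sup>+\<omega>. R l \<omega> \<partial>M)"
    by (simp add: nn_integral_add nn_integral_suminf)
  also have "\<dots> \<le> ennreal T + (\<Sum>l. ennreal (T * q ^ l))"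
    by (intro add_mono R0int suminf_le Rint) auto
  also have "(\<Sum>l. ennreal (T * q ^ l)) = ennreal (T * (1 / (1 - q)))"
  proof (rule suminf_ennreal_eq)
    show "(\<lambda>l. T * q ^ l) sums (T * (1 / (1 - q)))"
      using q by (intro sums_mult geometric_sums) auto
  qed (use T q in auto)
  also have "ennreal T + ennreal (T * (1 / (1 - q))) = ennreal ((1 + 1 / (1 - q)) * T)"
    using T q by (subst ennreal_plus[symmetric]) (auto simp: algebra_simps)
  finally show ?thesis unfolding T_def q_def k_def .
qed


section \<open>Cells, kernel and weights\<close>

lemma infnorm_unit_cube: "s \<in> unit_cube \<Longrightarrow> t \<in> unit_cube \<Longrightarrow> infnorm (s - t) \<le> 1"
  unfolding infnorm_le_iff_cart unit_cube_def by (auto simp: abs_le_iff) (smt (verit))+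

text \<open>A supremum of reals is informative only for bounded sets; containment in the cube bounds
  all distances by 1.\<close>

lemma sup_diam_unit_cube:
  assumes A: "A \<subseteq> unit_cube"
  shows sup_diam_upper: "s \<in> A \<Longrightarrow> t \<in> A \<Longrightarrow> infnorm (s - t) \<le> sup_diam A"
    and sup_diam_le_1: "A \<noteq> {} \<Longrightarrow> sup_diam A \<le> 1"
proof -
  have b: "infnorm (fst z - snd z) \<le> 1" if "z \<in> A \<times> A" for z
    using that A by (intro infnorm_unit_cube) auto
  have "bdd_above ((\<lambda>z. infnorm (fst z - snd z)) ` (A \<times> A))"
    using b by (rule bdd_aboveI2)
  then show "s \<in> A \<Longrightarrow> t \<in> A \<Longrightarrow> infnorm (s - t) \<le> sup_diam A"
    unfolding sup_diam_def using cSUP_upper[of "(s, t)" "A \<times> A" "\<lambda>z. infnorm (fst z - snd z)"]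
    by auto
  show "A \<noteq> {} \<Longrightarrow> sup_diam A \<le> 1"
    unfolding sup_diam_def using b by (intro cSUP_least) auto
qed

lemma cbox_infnorm:
  fixes t :: "real ^ 'k"
  shows "{y. infnorm (y - t) \<le> r} = cbox (t - (\<chi> i. r)) (t + (\<chi> i. r))"
  by (auto simp: infnorm_le_iff_cart mem_box_cart abs_le_iff algebra_simps)

lemma measure_infnorm_ball:
  "r \<ge> 0 \<Longrightarrow> measure lborel {y. infnorm (y - t :: real ^ 'k) \<le> r} = (2 * r) ^ CARD('k)"
  unfolding cbox_infnorm by (subst content_cbox_cart) (auto simp: interval_ne_empty_cart)

lemma infnorm_ball_fmeasurable: "{y. infnorm (y - t :: real ^ 'k) \<le> r} \<in> fmeasurable lborel"
  unfolding cbox_infnorm by simp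

lemma measure_le_infnorm_ball:
  fixes t :: "real ^ 'k"
  assumes "A \<in> sets borel" "\<And>y. y \<in> A \<Longrightarrow> infnorm (y - t) \<le> r" "r \<ge> 0"
  shows "measure lborel A \<le> (2 * r) ^ CARD('k)"
  unfolding measure_infnorm_ball[OF assms(3), of t, symmetric]
  using assms by (intro measure_mono_fmeasurable infnorm_ball_fmeasurable) auto

text \<open>One design and its cells, frozen. Randomness returns only when the errors are integrated
  with the design held fixed.\<close>

locale design_partition =
  fixes n :: nat and x :: "nat \<Rightarrow> real ^ 'k" and C :: "nat \<Rightarrow> (real ^ 'k) set"
  assumes n: "n \<ge> 1" and x: "\<And>i. i \<in> {1..n} \<Longrightarrow> x i \<in> unit_cube"
    and C: "borel_partition n C"
begin

lemma cell_sets: "i \<in> {1..n} \<Longrightarrow> C i \<in> sets borel"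
  using C unfolding borel_partition_def by auto

lemma cell_subset: "i \<in> {1..n} \<Longrightarrow> C i \<union> {x i} \<subseteq> unit_cube"
  using C x unfolding borel_partition_def by auto

lemma sup_diam_le_mesh: "i \<in> {1..n} \<Longrightarrow> sup_diam (C i \<union> {x i}) \<le> mesh n x C"
  unfolding mesh_def by (intro Max_ge) auto

lemma mesh_nonneg: "0 \<le> mesh n x C"
proof -
  have "infnorm (x 1 - x 1) \<le> sup_diam (C 1 \<union> {x 1})"
    using n by (intro sup_diam_upper cell_subset) auto
  then show ?thesis using sup_diam_le_mesh[of 1] n by (simp add: infnorm_0)
qed

text \<open>Makes nonnegative powers of the random mesh integrable, so the expectation in the rate
  is a genuine integral and not a default value.\<close>

lemma mesh_le_1: "mesh n x C \<le> 1"
  unfolding mesh_def using n sup_diam_le_1[OF cell_subset] by (subst Max_le_iff) auto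

lemma infnorm_cell: "i \<in> {1..n} \<Longrightarrow> y \<in> C i \<Longrightarrow> infnorm (y - x i) \<le> mesh n x C"
  using sup_diam_upper[OF cell_subset, of i y "x i"] sup_diam_le_mesh[of i] by auto

lemma measure_cell_le: "i \<in> {1..n} \<Longrightarrow> measure lborel (C i) \<le> (2 * mesh n x C) ^ CARD('k)"
  using infnorm_cell by (intro measure_le_infnorm_ball[of _ "x i"] cell_sets mesh_nonneg) auto

lemma cell_fmeasurable: "i \<in> {1..n} \<Longrightarrow> C i \<in> fmeasurable lborel"
  using infnorm_cell[of i]
  by (intro fmeasurableI2[OF infnorm_ball_fmeasurable[of "x i" "mesh n x C"]]) (auto intro: cell_sets)

text \<open>These cells are disjoint and lie in the cube of sup-norm radius
  \<open>e + mesh n x C\<close> about \<open>t\<close>, so their volumes add up to at most its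
  volume.\<close>

lemma sum_cells_near_le:
  assumes e: "e \<ge> 0"
  shows "(\<Sum>i\<in>{i\<in>{1..n}. infnorm (t - x i) \<le> e}. measure lborel (C i)) \<le> (2 * (e + mesh n x C)) ^ CARD('k)"
proof -
  let ?I = "{i\<in>{1..n}. infnorm (t - x i) \<le> e}"
  have "disjoint_family_on C ?I"
    using C unfolding borel_partition_def by (auto elim: disjoint_family_on_mono[rotated])
  then have "(\<Sum>i\<in>?I. measure lborel (C i)) = measure lborel (\<Union>i\<in>?I. C i)"
    using cell_fmeasurable by (intro measure_finite_Union[symmetric]) (auto simp: fmeasurable_def less_top)
  also have "\<dots> \<le> (2 * (e + mesh n x C)) ^ CARD('k)"
  proof (rule measure_le_infnorm_ball)
    show "(\<Union>i\<in>?I. C i) \<in> sets borel" using cell_sets by (intro sets.finite_UN) auto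
    show "infnorm (y - t) \<le> e + mesh n x C" if "y \<in> (\<Union>i\<in>?I. C i)" for y
    proof -
      from that obtain i where i: "i \<in> {1..n}" "infnorm (t - x i) \<le> e" "y \<in> C i" by auto
      have "infnorm (y - t) \<le> infnorm (y - x i) + infnorm (x i - t)"
        using infnorm_triangle[of "y - x i" "x i - t"] by simp
      then show ?thesis using infnorm_cell[OF i(1,3)] i(2) by (simp add: infnorm_sub)
    qed
    show "0 \<le> e + mesh n x C" using e mesh_nonneg by simp
  qed
  finally show ?thesis .
qed

text \<open>One factor of each squared volume is bounded by the largest possible cell, the other is
  summed over the disjoint cells near \<open>J\<close>. The set \<open>J\<close> will be
  \<open>{t}\<close> for the weights at a point and \<open>{s, t}\<close> for their
  increments.\<close>

lemma sum_squares_cells_le: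
  fixes u :: "nat \<Rightarrow> real"
  assumes "finite J" "b \<ge> 0" "e \<ge> 0"
    and u: "\<And>i. i \<in> {1..n} \<Longrightarrow> \<bar>u i\<bar> \<le> b * measure lborel (C i)"
    and u0: "\<And>i. i \<in> {1..n} \<Longrightarrow> \<forall>t\<in>J. infnorm (t - x i) > e \<Longrightarrow> u i = 0"
  shows "(\<Sum>i=1..n. (u i)\<^sup>2)
    \<le> real (card J) * b\<^sup>2 * (2 * mesh n x C) ^ CARD('k) * (2 * (e + mesh n x C)) ^ CARD('k)"
proof -
  define m where "m = (2 * mesh n x C) ^ CARD('k)"
  have m: "m \<ge> 0" unfolding m_def using mesh_nonneg by simp
  \<comment> \<open>A design point near several points of \<open>J\<close> is counted once for each,
    which costs at most the factor \<open>card J\<close>.\<close>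
  have "(\<Sum>i=1..n. (u i)\<^sup>2)
     \<le> (\<Sum>i=1..n. \<Sum>t\<in>J. if infnorm (t - x i) \<le> e then b\<^sup>2 * m * measure lborel (C i) else 0)"
  proof (rule sum_mono)
    fix i assume i: "i \<in> {1..n}"
    show "(u i)\<^sup>2 \<le> (\<Sum>t\<in>J. if infnorm (t - x i) \<le> e then b\<^sup>2 * m * measure lborel (C i) else 0)"
    proof (cases "\<forall>t\<in>J. infnorm (t - x i) > e")
      case True
      then show ?thesis using u0[OF i] m by (auto intro!: sum_nonneg)
    next
      case False
      then obtain t where t: "t \<in> J" "infnorm (t - x i) \<le> e" by force
      have "(u i)\<^sup>2 \<le> (b * measure lborel (C i))\<^sup>2"
        using power_mono[OF u[OF i] abs_ge_zero, of 2] by simp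
      also have "\<dots> = b\<^sup>2 * (measure lborel (C i) * measure lborel (C i))"
        by (simp add: power2_eq_square)
      also have "\<dots> \<le> b\<^sup>2 * (m * measure lborel (C i))"
        using measure_cell_le[OF i] unfolding m_def by (intro mult_left_mono mult_right_mono) auto
      also have "\<dots> = (if infnorm (t - x i) \<le> e then b\<^sup>2 * m * measure lborel (C i) else 0)"
        using t by simp
      also have "\<dots> \<le> (\<Sum>t\<in>J. if infnorm (t - x i) \<le> e then b\<^sup>2 * m * measure lborel (C i) else 0)"
        using t(1) assms(1) m by (intro member_le_sum) auto
      finally show ?thesis .
    qed
  qed
  also have "\<dots> = (\<Sum>t\<in>J. b\<^sup>2 * m * (\<Sum>i\<in>{i\<in>{1..n}. infnorm (t - x i) \<le> e}. measure lborel (C i)))"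
    by (subst sum.swap, simp only: sum_distrib_left sum.inter_filter[OF finite_atLeastAtMost])
      (intro sum.cong refl, simp)
  also have "\<dots> \<le> (\<Sum>t\<in>J. b\<^sup>2 * m * (2 * (e + mesh n x C)) ^ CARD('k))"
    using assms m by (intro sum_mono mult_left_mono sum_cells_near_le) auto
  finally show ?thesis unfolding m_def by simp
qed

end

section \<open>Size, support and regularity of the kernel\<close>

lemma sum_abs_le_infnorm: "(\<Sum>r\<in>UNIV. \<bar>(s :: real ^ 'k) $ r\<bar>) \<le> real CARD('k) * infnorm s"
  using sum_bounded_above[of "UNIV :: 'k set" "\<lambda>r. \<bar>s $ r\<bar>" "infnorm s"]
  by (auto simp: component_le_infnorm_cart)

lemma kernel_zero:
  fixes K :: "real ^ 'k \<Rightarrow> real"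
  assumes "smoothing_kernel L K" "infnorm s > 1" shows "K s = 0"
proof -
  have "\<not> (\<forall>r. \<bar>s $ r\<bar> \<le> 1)" using assms(2) infnorm_le_iff_cart[of s 1] by auto
  then show ?thesis using assms(1) unfolding smoothing_kernel_def by (auto simp: not_le)
qed

text \<open>Moving one coordinate out of the support bounds the kernel by its Lipschitz constant.\<close>

lemma kernel_bound:
  fixes K :: "real ^ 'k \<Rightarrow> real"
  assumes K: "smoothing_kernel L K" shows "K s \<le> 3 * L"
proof (cases "infnorm s > 1")
  case True
  then show ?thesis using kernel_zero[OF K] K unfolding smoothing_kernel_def by auto
next
  case False
  then have s: "\<bar>s $ r\<bar> \<le> 1" for r using infnorm_le_iff_cart[of s 1] by auto
  fix r\<^sub>0 :: 'k
  \<comment> \<open>The value 2 lies outside the support and within 3 of every point of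
    \<open>[-1, 1]\<close>, whence \<open>3 * L\<close>.\<close>
  define s' where "s' = (\<chi> r. if r = r\<^sub>0 then 2 else s $ r)"
  have "\<bar>s' $ r\<^sub>0\<bar> > 1" unfolding s'_def by simp
  then have "K s' = 0" using K unfolding smoothing_kernel_def by blast
  moreover have "\<bar>K s - K s'\<bar> \<le> L * (\<Sum>r\<in>UNIV. \<bar>s $ r - s' $ r\<bar>)"
    using K unfolding smoothing_kernel_def by blast
  moreover have "(\<Sum>r\<in>UNIV. \<bar>s $ r - s' $ r\<bar>) = (\<Sum>r\<in>UNIV. if r = r\<^sub>0 then \<bar>s $ r - 2\<bar> else 0)"
    unfolding s'_def by (intro sum.cong) auto
  then have "(\<Sum>r\<in>UNIV. \<bar>s $ r - s' $ r\<bar>) = \<bar>s $ r\<^sub>0 - 2\<bar>" by simp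
  then have "L * (\<Sum>r\<in>UNIV. \<bar>s $ r - s' $ r\<bar>) \<le> L * 3"
    using s[of r\<^sub>0] K unfolding smoothing_kernel_def by (intro mult_left_mono) auto
  ultimately show ?thesis by linarith
qed

locale kernel_setup =
  fixes L :: real and K :: "real ^ 'k \<Rightarrow> real"
  assumes K: "smoothing_kernel L K"
begin

lemma L_ge_1: "L \<ge> 1" using K unfolding smoothing_kernel_def by auto

lemma kernel_lipschitz: "\<bar>K s - K s'\<bar> \<le> L * (real CARD('k) * infnorm (s - s'))"
proof -
  have "\<bar>K s - K s'\<bar> \<le> L * (\<Sum>r\<in>UNIV. \<bar>(s - s') $ r\<bar>)"
    using K unfolding smoothing_kernel_def by auto
  also have "\<dots> \<le> L * (real CARD('k) * infnorm (s - s'))"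
    using L_ge_1 by (intro mult_left_mono sum_abs_le_infnorm) auto
  finally show ?thesis .
qed

lemma scaled_kernel_nonneg: "e > 0 \<Longrightarrow> scaled_kernel K e s \<ge> 0"
  using K unfolding scaled_kernel_def smoothing_kernel_def by auto

lemma scaled_kernel_zero: "e > 0 \<Longrightarrow> infnorm s > e \<Longrightarrow> scaled_kernel K e s = 0"
  unfolding scaled_kernel_def using kernel_zero[OF K] by (simp add: infnorm_mul field_simps)

lemma scaled_kernel_le: "e > 0 \<Longrightarrow> scaled_kernel K e s \<le> 3 * L / e ^ CARD('k)"
  unfolding scaled_kernel_def using kernel_bound[OF K] by (intro divide_right_mono) auto

lemma scaled_kernel_lipschitz:
  assumes e: "e > 0"
  shows "\<bar>scaled_kernel K e s - scaled_kernel K e s'\<bar>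
    \<le> L * real CARD('k) / e ^ CARD('k) * (infnorm (s - s') / e)"
proof -
  have "\<bar>K (s /\<^sub>R e) - K (s' /\<^sub>R e)\<bar> \<le> L * (real CARD('k) * infnorm ((s - s') /\<^sub>R e))"
    using kernel_lipschitz[of "s /\<^sub>R e" "s' /\<^sub>R e"] by (simp add: scaleR_diff_right)
  then have "\<bar>K (s /\<^sub>R e) - K (s' /\<^sub>R e)\<bar> / e ^ CARD('k)
     \<le> L * (real CARD('k) * infnorm ((s - s') /\<^sub>R e)) / e ^ CARD('k)"
    using e by (intro divide_right_mono) auto
  then show ?thesis using e
    unfolding scaled_kernel_def infnorm_mul by (simp add: diff_divide_distrib[symmetric] field_simps)
qed

lemma continuous_kernel: "continuous_on S K"
proof -
  have "(L * real CARD('k))-lipschitz_on UNIV K"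
  proof (rule lipschitz_onI)
    fix s s'
    have "\<bar>K s - K s'\<bar> \<le> L * real CARD('k) * infnorm (s - s')"
      using kernel_lipschitz[of s s'] by (simp add: mult.assoc)
    also have "\<dots> \<le> L * real CARD('k) * norm (s - s')"
      using L_ge_1 by (intro mult_left_mono infnorm_le_norm) auto
    finally show "dist (K s) (K s') \<le> L * real CARD('k) * dist s s'"
      by (simp add: dist_norm)
  qed (use L_ge_1 in auto)
  then show ?thesis using lipschitz_on_continuous_on continuous_on_subset by blast
qed

lemma continuous_scaled_kernel:
  assumes "continuous_on S g" shows "continuous_on S (\<lambda>t. scaled_kernel K e (g t))"
proof -
  have "continuous_on S (\<lambda>t. K (g t /\<^sub>R e))"
    by (rule continuous_on_compose2[OF continuous_kernel[of UNIV]]) (auto intro!: continuous_intros assms)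
  then show ?thesis unfolding scaled_kernel_def by (auto simp: divide_inverse intro!: continuous_intros)
qed

lemma scaled_kernel_measurable[measurable]: "scaled_kernel K e \<in> borel_measurable borel"
  using continuous_scaled_kernel[of UNIV "\<lambda>t. t" e] by (intro borel_measurable_continuous_onI) simp

end

section \<open>Kernel weights of a frozen design\<close>

definition kernel_weight ::
  "(real ^ 'k \<Rightarrow> real) \<Rightarrow> real \<Rightarrow> (nat \<Rightarrow> real ^ 'k) \<Rightarrow> (nat \<Rightarrow> (real ^ 'k) set) \<Rightarrow> nat \<Rightarrow> real ^ 'k \<Rightarrow> real"
  where "kernel_weight K e x C i t = scaled_kernel K e (t - x i) * measure lborel (C i)"

text \<open>\<open>9 * L\<^sup>2\<close> squares the bound on the kernel,
  \<open>L\<^sup>2 * k\<^sup>2\<close> its Lipschitz constant in the sup-norm, and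
  \<open>8 ^ k\<close> comes from the volumes. A common constant for weights and increments lets
  chaining run with a single \<open>A\<close>.\<close>

definition weight_const :: "real \<Rightarrow> nat \<Rightarrow> real" where
  "weight_const L k = 9 * L\<^sup>2 * (real k)\<^sup>2 * 8 ^ k"

locale kernel_design = kernel_setup L K + design_partition n x C
  for L :: real and K :: "real ^ 'k \<Rightarrow> real" and n and x :: "nat \<Rightarrow> real ^ 'k" and C +
  fixes e :: real
  assumes e: "e > 0" and mesh_le: "mesh n x C \<le> e"
begin

abbreviation weight :: "nat \<Rightarrow> real ^ 'k \<Rightarrow> real" where
  "weight \<equiv> kernel_weight K e x C"

text \<open>The mesh is at most \<open>e\<close>, so the larger cube has side at most
  \<open>4 * e\<close>. Per dimension this leaves \<open>2 * 4 * e / e\<^sup>2\<close> times the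
  mesh.\<close>

lemma scaling: "(1 / e ^ CARD('k))\<^sup>2 * (2 * mesh n x C) ^ CARD('k) * (2 * (e + mesh n x C)) ^ CARD('k)
    \<le> 8 ^ CARD('k) * (mesh n x C / e) ^ CARD('k)"
proof -
  have "(1 / e ^ CARD('k))\<^sup>2 * (2 * mesh n x C) ^ CARD('k) * (2 * (e + mesh n x C)) ^ CARD('k)
     \<le> (1 / e ^ CARD('k))\<^sup>2 * (2 * mesh n x C) ^ CARD('k) * (4 * e) ^ CARD('k)"
    using mesh_nonneg e mesh_le by (intro mult_left_mono power_mono) auto
  also have "\<dots> = ((1 / e)\<^sup>2 * (2 * mesh n x C) * (4 * e)) ^ CARD('k)"
    by (simp only: power_mult_distrib power_one_over power_mult[symmetric] mult.commute[of 2])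
  also have "(1 / e)\<^sup>2 * (2 * mesh n x C) * (4 * e) = 8 * (mesh n x C / e)"
    using e by (simp add: power2_eq_square)
  finally show ?thesis by (simp only: power_mult_distrib)
qed

lemma sum_weight_squares: "(\<Sum>i=1..n. (weight i t)\<^sup>2) \<le> weight_const L CARD('k) * (mesh n x C / e) ^ CARD('k)"
proof -
  let ?k = "CARD('k)"
  have k: "real ?k \<ge> 1" by (simp add: Suc_leI)
  have "(\<Sum>i=1..n. (weight i t)\<^sup>2)
    \<le> real (card {t}) * (3 * L / e ^ ?k)\<^sup>2 * (2 * mesh n x C) ^ ?k * (2 * (e + mesh n x C)) ^ ?k"
  proof (rule sum_squares_cells_le)
    show "\<bar>weight i t\<bar> \<le> 3 * L / e ^ CARD('k) * measure lborel (C i)" for i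
      unfolding kernel_weight_def abs_mult using e L_ge_1 scaled_kernel_nonneg[OF e] scaled_kernel_le[OF e]
      by (intro mult_mono) (auto simp del: times_divide_eq_left)
  qed (use e L_ge_1 scaled_kernel_zero[OF e] in \<open>auto simp: kernel_weight_def\<close>)
  also have "\<dots> = 9 * L\<^sup>2 * ((1 / e ^ ?k)\<^sup>2 * (2 * mesh n x C) ^ ?k * (2 * (e + mesh n x C)) ^ ?k)"
    by (simp add: power_divide power_mult_distrib)
  also have "\<dots> \<le> 9 * L\<^sup>2 * (8 ^ ?k * (mesh n x C / e) ^ ?k)"
    by (intro mult_left_mono scaling) auto
  also have "\<dots> \<le> (9 * L\<^sup>2 * (real ?k)\<^sup>2) * (8 ^ ?k * (mesh n x C / e) ^ ?k)"
  proof (rule mult_right_mono)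
    have "9 * L\<^sup>2 * 1 \<le> 9 * L\<^sup>2 * (real ?k)\<^sup>2"
      using k by (intro mult_left_mono) auto
    then show "9 * L\<^sup>2 \<le> 9 * L\<^sup>2 * (real ?k)\<^sup>2" by simp
  qed (use mesh_nonneg e in auto)
  finally show ?thesis unfolding weight_const_def by (simp add: mult_ac)
qed

lemma sum_weight_diff_squares: "(\<Sum>i=1..n. (weight i s - weight i t)\<^sup>2)
    \<le> weight_const L CARD('k) * (mesh n x C / e) ^ CARD('k) * (infnorm (s - t) / e)\<^sup>2"
proof -
  let ?k = "CARD('k)"
  define d where "d = infnorm (s - t) / e"
  have d: "d \<ge> 0" unfolding d_def using e by (simp add: infnorm_pos_le)
  have "(\<Sum>i=1..n. (weight i s - weight i t)\<^sup>2)
    \<le> real (card {s, t}) * (L * real ?k / e ^ ?k * d)\<^sup>2 * (2 * mesh n x C) ^ ?k * (2 * (e + mesh n x C)) ^ ?k"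
  proof (rule sum_squares_cells_le)
    show "\<bar>weight i s - weight i t\<bar> \<le> L * real ?k / e ^ ?k * d * measure lborel (C i)" for i
      using scaled_kernel_lipschitz[OF e, of "s - x i" "t - x i"]
      unfolding kernel_weight_def left_diff_distrib[symmetric] abs_mult d_def
      by (intro mult_mono) (auto simp: infnorm_pos_le)
  qed (use e d L_ge_1 scaled_kernel_zero[OF e] in \<open>auto simp: kernel_weight_def\<close>)
  also have "\<dots> = real (card {s, t}) * L\<^sup>2 * (real ?k)\<^sup>2 * d\<^sup>2
      * ((1 / e ^ ?k)\<^sup>2 * (2 * mesh n x C) ^ ?k * (2 * (e + mesh n x C)) ^ ?k)"
    by (simp add: power_divide power_mult_distrib)
  also have "\<dots> \<le> (9 * L\<^sup>2 * (real ?k)\<^sup>2 * d\<^sup>2) * (8 ^ ?k * (mesh n x C / e) ^ ?k)"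
  proof (rule mult_mono)
    \<comment> \<open>There are at most two points; enlarging the count to 9 matches the constant
      for the weights themselves.\<close>
    have "real (card {s, t}) \<le> 9" using card_insert_le_m1[of 2 "{t}" s] by simp
    then show "real (card {s, t}) * L\<^sup>2 * (real ?k)\<^sup>2 * d\<^sup>2 \<le> 9 * L\<^sup>2 * (real ?k)\<^sup>2 * d\<^sup>2"
      by (intro mult_right_mono) auto
  qed (use scaling mesh_nonneg e in auto)
  finally show ?thesis unfolding weight_const_def d_def by (simp add: mult_ac)
qed

text \<open>Replacing \<open>y\<close> by the design point of its cell is compared only where \<open>y\<close> lies in the support of
  the kernel, a set of volume \<open>(2 e)\<^sup>k\<close>; elsewhere nonnegativity suffices.\<close>

lemma sum_weight_lower:
  assumes b: "boundary_condition \<rho> e\<^sub>0 K" and e0: "e \<le> e\<^sub>0" and t: "t \<in> unit_cube"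
    and small: "mesh n x C \<le> e * (\<rho> / (real CARD('k) * 2 ^ (CARD('k) + 1) * L))"
  shows "(\<Sum>i=1..n. weight i t) \<ge> \<rho> / 2"
proof -
  let ?k = "CARD('k)"
  have \<rho>: "\<rho> > 0" using b unfolding boundary_condition_def by auto
  have int: "(LINT y:unit_cube|lborel. scaled_kernel K e (t - y)) \<ge> \<rho>"
    using b e e0 t unfolding boundary_condition_def by auto
  define c where "c = L * real ?k / e ^ ?k * (mesh n x C / e)"
  have c: "c \<ge> 0" unfolding c_def using L_ge_1 e mesh_nonneg by auto
  let ?B = "{y. infnorm (y - t) \<le> e}"
  let ?g = "\<lambda>y. (\<Sum>i=1..n. scaled_kernel K e (t - x i) * indicat_real (C i) y) + c * indicat_real ?B y"
  have intB: "integrable lborel (indicat_real ?B)"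
    using infnorm_ball_fmeasurable[of t e] by (simp add: fmeasurable_def)
  have intC: "integrable lborel (indicat_real (C i))" if "i \<in> {1..n}" for i
    using cell_fmeasurable[OF that] by (simp add: fmeasurable_def)
  \<comment> \<open>A positive value forces integrability, since the integral of a non-integrable
    function is 0 by convention.\<close>
  have lhs: "integrable lborel (\<lambda>y. indicat_real unit_cube y *\<^sub>R scaled_kernel K e (t - y))"
    using int \<rho> not_integrable_integral_eq unfolding set_lebesgue_integral_def by fastforce
  have "\<rho> \<le> (\<integral>y. indicat_real unit_cube y *\<^sub>R scaled_kernel K e (t - y) \<partial>lborel)"
    using int unfolding set_lebesgue_integral_def .
  also have "\<dots> \<le> (\<integral>y. ?g y \<partial>lborel)"
  proof (rule integral_mono[OF lhs])
    show "integrable lborel ?g"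
      using intB intC by (intro Bochner_Integration.integrable_add Bochner_Integration.integrable_sum) auto
    fix y :: "real ^ 'k"
    have g0: "0 \<le> ?g y"
      using c scaled_kernel_nonneg[OF e] by (intro add_nonneg_nonneg sum_nonneg) auto
    show "indicat_real unit_cube y *\<^sub>R scaled_kernel K e (t - y) \<le> ?g y"
    proof (cases "y \<in> unit_cube \<and> y \<in> ?B")
      case False
      then have "indicat_real unit_cube y *\<^sub>R scaled_kernel K e (t - y) = 0"
        using scaled_kernel_zero[OF e, of "t - y"] by (auto simp: infnorm_sub[of t y])
      then show ?thesis using g0 by (simp only:)
    next
      case True
      then obtain i where i: "i \<in> {1..n}" "y \<in> C i"
        using C unfolding borel_partition_def by blast
      have "scaled_kernel K e (t - y) \<le> scaled_kernel K e (t - x i) + L * real ?k / e ^ ?k * (infnorm (x i - y) / e)"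
        using scaled_kernel_lipschitz[OF e, of "t - y" "t - x i"] by simp
      also have "L * real ?k / e ^ ?k * (infnorm (x i - y) / e) \<le> c"
        unfolding c_def using infnorm_cell[OF i] e L_ge_1
        by (intro mult_left_mono divide_right_mono) (auto simp: infnorm_sub)
      also have "scaled_kernel K e (t - x i) = scaled_kernel K e (t - x i) * indicat_real (C i) y"
        using i by simp
      also have "\<dots> \<le> (\<Sum>i=1..n. scaled_kernel K e (t - x i) * indicat_real (C i) y)"
        using i scaled_kernel_nonneg[OF e] by (intro member_le_sum) auto
      finally show ?thesis using True by simp
    qed
  qed
  also have "\<dots> = (\<Sum>i=1..n. weight i t) + c * (2 * e) ^ ?k"
  proof -
    have "(\<integral>y. ?g y \<partial>lborel) = (\<integral>y. (\<Sum>i=1..n. scaled_kernel K e (t - x i) * indicat_real (C i) y) \<partial>lborel)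
       + (\<integral>y. c * indicat_real ?B y \<partial>lborel)"
      using intB intC by (intro Bochner_Integration.integral_add Bochner_Integration.integrable_sum) auto
    also have "(\<integral>y. (\<Sum>i=1..n. scaled_kernel K e (t - x i) * indicat_real (C i) y) \<partial>lborel)
        = (\<Sum>i=1..n. weight i t)"
      using intC by (subst Bochner_Integration.integral_sum) (auto simp: kernel_weight_def)
    also have "(\<integral>y. c * indicat_real ?B y \<partial>lborel) = c * (2 * e) ^ ?k"
      using measure_infnorm_ball[of e t] e by simp
    finally show ?thesis .
  qed
  also have "c * (2 * e) ^ ?k \<le> \<rho> / 2"
  proof -
    \<comment> \<open>Lipschitz error times the volume of the support; requiring this to be at most
      \<open>\<rho> / 2\<close> dictates the constant in the bound on the mesh.\<close>
    have "c * (2 * e) ^ ?k = L * real ?k * 2 ^ ?k * (mesh n x C / e)"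
      unfolding c_def using e by (simp add: power_mult_distrib)
    also have "\<dots> \<le> L * real ?k * 2 ^ ?k * (\<rho> / (real ?k * 2 ^ (?k + 1) * L))"
      using small e L_ge_1 by (intro mult_left_mono) (auto simp: field_simps)
    also have "\<dots> = \<rho> / 2" using L_ge_1 by simp
    finally show ?thesis .
  qed
  finally show ?thesis by simp
qed

text \<open>The weights are nonnegative and normalised by their own sum, so subtracting
  \<open>c\<close> leaves a convex combination of the deviations \<open>\<phi> i - c\<close>, which
  is at most \<open>w\<close>, plus the normalised noise sum. The quantitative lower bound on the
  denominator enters through the latter.\<close>

lemma estimator_error:
  assumes J: "(\<Sum>i=1..n. weight i t) \<ge> \<rho> / 2" and \<rho>: "\<rho> > 0" and w: "w \<ge> 0"
    and osc: "\<And>i. i \<in> {1..n} \<Longrightarrow> infnorm (t - x i) \<le> e \<Longrightarrow> \<bar>\<phi> i - c\<bar> \<le> w"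
  shows "\<bar>kernel_estimator K e n x C (\<lambda>i. \<phi> i + \<xi> i) t - c\<bar>
    \<le> w + 2 / \<rho> * \<bar>\<Sum>i=1..n. weight i t * \<xi> i\<bar>"
proof -
  let ?J = "\<Sum>i=1..n. weight i t"
  have Jp: "?J > 0" using J \<rho> by linarith
  have w0: "weight i t \<ge> 0" for i unfolding kernel_weight_def using scaled_kernel_nonneg[OF e] by simp
  have "kernel_estimator K e n x C (\<lambda>i. \<phi> i + \<xi> i) t = (\<Sum>i=1..n. (\<phi> i + \<xi> i) * weight i t) / ?J"
    unfolding kernel_estimator_def kernel_weight_def by (simp add: mult.assoc)
  also have "\<dots> - c = ((\<Sum>i=1..n. (\<phi> i + \<xi> i) * weight i t) - c * ?J) / ?J"
    using Jp by (simp add: field_simps)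
  also have "(\<Sum>i=1..n. (\<phi> i + \<xi> i) * weight i t) - c * ?J
     = (\<Sum>i=1..n. (\<phi> i - c) * weight i t) + (\<Sum>i=1..n. weight i t * \<xi> i)"
    by (simp add: sum_distrib_left sum.distrib sum_subtractf algebra_simps)
  finally have "\<bar>kernel_estimator K e n x C (\<lambda>i. \<phi> i + \<xi> i) t - c\<bar>
     \<le> (\<bar>\<Sum>i=1..n. (\<phi> i - c) * weight i t\<bar> + \<bar>\<Sum>i=1..n. weight i t * \<xi> i\<bar>) / ?J"
    using Jp by (simp add: divide_right_mono)
  also have "\<dots> = \<bar>\<Sum>i=1..n. (\<phi> i - c) * weight i t\<bar> / ?J + \<bar>\<Sum>i=1..n. weight i t * \<xi> i\<bar> / ?J"
    by (rule add_divide_distrib)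
  also have "\<dots> \<le> w + 2 / \<rho> * \<bar>\<Sum>i=1..n. weight i t * \<xi> i\<bar>"
  proof (rule add_mono)
    have "\<bar>\<Sum>i=1..n. (\<phi> i - c) * weight i t\<bar> \<le> (\<Sum>i=1..n. \<bar>(\<phi> i - c) * weight i t\<bar>)"
      by (rule sum_abs)
    also have "\<dots> \<le> (\<Sum>i=1..n. w * weight i t)"
    proof (rule sum_mono)
      fix i assume i: "i \<in> {1..n}"
      show "\<bar>(\<phi> i - c) * weight i t\<bar> \<le> w * weight i t"
      proof (cases "infnorm (t - x i) \<le> e")
        case True
        then show ?thesis using osc[OF i] w0[of i] by (simp add: abs_mult mult_right_mono)
      next
        case False
        then show ?thesis using scaled_kernel_zero[OF e, of "t - x i"] by (simp add: kernel_weight_def)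
      qed
    qed
    also have "\<dots> = w * ?J" by (simp add: sum_distrib_left)
    finally show "\<bar>\<Sum>i=1..n. (\<phi> i - c) * weight i t\<bar> / ?J \<le> w"
      using Jp by (simp add: pos_divide_le_eq)
    have "\<bar>\<Sum>i=1..n. weight i t * \<xi> i\<bar> / ?J \<le> \<bar>\<Sum>i=1..n. weight i t * \<xi> i\<bar> / (\<rho> / 2)"
      using J \<rho> by (intro divide_left_mono mult_pos_pos) auto
    then show "\<bar>\<Sum>i=1..n. weight i t * \<xi> i\<bar> / ?J \<le> 2 / \<rho> * \<bar>\<Sum>i=1..n. weight i t * \<xi> i\<bar>"
      by (simp add: mult.commute)
  qed
  finally show ?thesis .
qed

end


section \<open>The noise field\<close>

text \<open>The two square-sum bounds become the two moment hypotheses of chaining; under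
  \<open>powr (p / 2)\<close> the squared distance in the increment bound turns into the p-th power
  required there.\<close>

lemma (in kernel_design) noise_expectation:
  fixes \<xi> :: "nat \<Rightarrow> 'a \<Rightarrow> real"
  assumes M: "prob_space M"
    and md: "martingale_differences M n \<xi>" and p: "p \<ge> 2" "p > real CARD('k)"
    and int: "\<And>i. i \<in> {1..n} \<Longrightarrow> integrable M (\<lambda>\<omega>. \<bar>\<xi> i \<omega>\<bar> powr p)"
    and bound: "\<And>i. i \<in> {1..n} \<Longrightarrow> (\<integral>\<omega>. \<bar>\<xi> i \<omega>\<bar> powr p \<partial>M) \<le> m"
    and m: "m \<ge> 0" and e1: "e \<le> 1" and \<tau>: "\<tau> > 0"
  shows "(\<integral>\<^sup>+\<omega>. (SUP t\<in>dyadic_points. ennreal \<bar>\<Sum>i=1..n. weight i t * \<xi> i \<omega>\<bar>) \<partial>M)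
    \<le> ennreal ((1 + 1 / (1 - chain_ratio CARD('k) p)) * (\<tau> + \<tau> powr (1 - p) *
        (8 ^ CARD('k) * moment_const p * weight_const L CARD('k) powr (p / 2) * m *
         (e powr (- (real CARD('k) * (p / 2 + 1))) * mesh n x C powr (real CARD('k) * p / 2)))))"
proof -
  interpret prob_space M by fact
  let ?k = "CARD('k)"
  define W where "W = weight_const L ?k * (mesh n x C / e) ^ ?k"
  have W: "W \<ge> 0" unfolding W_def weight_const_def using mesh_nonneg e by auto
  have mc: "moment_const p \<ge> 0" unfolding moment_const_def by simp
  define A where "A = moment_const p * W powr (p / 2) * m"
  have A: "A \<ge> 0" unfolding A_def using mc m by simp
  have meas: "\<xi> i \<in> borel_measurable M" if "i \<in> {1..n}" for i
    using md that unfolding martingale_differences_def by (auto dest: borel_measurable_integrable)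
  \<comment> \<open>Stated for arbitrary coefficients, so that it serves the weights and their
    increments alike.\<close>
  have nn: "(\<integral>\<^sup>+\<omega>. ennreal (\<bar>\<Sum>i=1..n. a i * \<xi> i \<omega>\<bar> powr p) \<partial>M)
      \<le> ennreal (moment_const p * v powr (p / 2) * m)"
    if "(\<Sum>i=1..n. (a i)\<^sup>2) \<le> v" for a v
  proof -
    have mt: "integrable M (\<lambda>\<omega>. \<bar>\<Sum>i=1..n. a i * \<xi> i \<omega>\<bar> powr p)"
      "(\<integral>\<omega>. \<bar>\<Sum>i=1..n. a i * \<xi> i \<omega>\<bar> powr p \<partial>M)
      \<le> moment_const p * (\<Sum>i=1..n. (a i)\<^sup>2) powr (p / 2) * m"
      using martingale_transform_moment[OF md p(1) int bound m, of a] by auto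
    have "(\<integral>\<^sup>+\<omega>. ennreal (\<bar>\<Sum>i=1..n. a i * \<xi> i \<omega>\<bar> powr p) \<partial>M)
      = ennreal (\<integral>\<omega>. \<bar>\<Sum>i=1..n. a i * \<xi> i \<omega>\<bar> powr p \<partial>M)"
      using mt(1) by (intro nn_integral_eq_integral) auto
    also have "\<dots> \<le> ennreal (moment_const p * v powr (p / 2) * m)"
      using mt(2) that mc m p
      by (intro ennreal_leI) (meson mult_left_mono mult_right_mono order_trans powr_mono2 sum_nonneg
          zero_le_power2 divide_nonneg_nonneg zero_le_numeral)
    finally show ?thesis .
  qed
  have "(\<integral>\<^sup>+\<omega>. (SUP t\<in>dyadic_points. ennreal \<bar>\<Sum>i=1..n. weight i t * \<xi> i \<omega>\<bar>) \<partial>M)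
    \<le> ennreal ((1 + 1 / (1 - chain_ratio ?k p)) * (\<tau> + \<tau> powr (1 - p) * ((8 / e) ^ ?k * A)))"
  proof (rule nn_integral_SUP_chaining[OF M _ _ _ A e e1 p(2) \<tau>])
    show "(\<lambda>\<omega>. \<Sum>i=1..n. weight i t * \<xi> i \<omega>) \<in> borel_measurable M" for t
      by (intro borel_measurable_sum borel_measurable_times meas) auto
    show "(\<integral>\<^sup>+\<omega>. ennreal (\<bar>\<Sum>i=1..n. weight i t * \<xi> i \<omega>\<bar> powr p) \<partial>M) \<le> ennreal A" for t
      unfolding A_def W_def by (rule nn[OF sum_weight_squares])
    show "(\<integral>\<^sup>+\<omega>. ennreal (\<bar>(\<Sum>i=1..n. weight i s * \<xi> i \<omega>) - (\<Sum>i=1..n. weight i t * \<xi> i \<omega>)\<bar> powr p) \<partial>M)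
      \<le> ennreal (A * (infnorm (s - t) / e) powr p)" for s t
    proof -
      have "(\<integral>\<^sup>+\<omega>. ennreal (\<bar>(\<Sum>i=1..n. (weight i s - weight i t) * \<xi> i \<omega>)\<bar> powr p) \<partial>M)
        \<le> ennreal (moment_const p * (W * (infnorm (s - t) / e)\<^sup>2) powr (p / 2) * m)"
        unfolding W_def by (rule nn[OF sum_weight_diff_squares])
      also have "(W * (infnorm (s - t) / e)\<^sup>2) powr (p / 2) = W powr (p / 2) * (infnorm (s - t) / e) powr p"
      proof -
        have "((infnorm (s - t) / e)\<^sup>2) powr (p / 2) = (infnorm (s - t) / e) powr p"
          using e by (simp add: infnorm_pos_le powr_powr flip: powr_numeral)
        then show ?thesis using W by (simp add: powr_mult)
      qed
      finally show ?thesis unfolding A_def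
        by (simp add: sum_subtractf[symmetric] algebra_simps)
    qed
  qed
  also have "(8 / e) ^ ?k * A = 8 ^ ?k * moment_const p * weight_const L ?k powr (p / 2) * m *
         (e powr (- (real ?k * (p / 2 + 1))) * mesh n x C powr (real ?k * p / 2))"
  proof -
    have "W powr (p / 2) = weight_const L ?k powr (p / 2) * ((mesh n x C / e) ^ ?k) powr (p / 2)"
      unfolding W_def by (rule powr_mult)
    also have "((mesh n x C / e) ^ ?k) powr (p / 2) = (mesh n x C / e) powr (real ?k * (p / 2))"
      using mesh_nonneg e by (simp add: powr_powr flip: powr_realpow')
    also have "\<dots> = mesh n x C powr (real ?k * (p / 2)) / e powr (real ?k * (p / 2))"
      by (rule powr_divide)
    finally have 1: "W powr (p / 2) = weight_const L ?k powr (p / 2) *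
      (mesh n x C powr (real ?k * (p / 2)) / e powr (real ?k * (p / 2)))" .
    have 2: "e powr (- (real ?k * (p / 2 + 1))) = 1 / (e powr (real ?k * (p / 2)) * e ^ ?k)"
      by (simp only: powr_minus_divide distrib_left mult_1_right powr_add powr_realpow[OF e])
    show ?thesis unfolding A_def 1 2 by (simp add: power_divide mult_ac)
  qed
  finally show ?thesis .
qed

text \<open>Independence of the generated sigma-algebras says that the joint law agrees with the
  product law on rectangles, hence everywhere; the identity is then Tonelli's theorem.\<close>

lemma (in prob_space) indep_set_nn_integral:
  assumes X[measurable]: "X \<in> measurable M S" and Y[measurable]: "Y \<in> measurable M T"
    and indep: "indep_set (sets (vimage_algebra (space M) Y T)) (sets (vimage_algebra (space M) X S))"
    and h[measurable]: "h \<in> borel_measurable (S \<Otimes>\<^sub>M T)"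
  shows "(\<integral>\<^sup>+\<omega>. h (X \<omega>, Y \<omega>) \<partial>M) = (\<integral>\<^sup>+\<omega>'. (\<integral>\<^sup>+\<omega>. h (X \<omega>', Y \<omega>) \<partial>M) \<partial>M)"
proof -
  interpret PX: prob_space "distr M S X" by (rule prob_space_distr) fact
  interpret PY: prob_space "distr M T Y" by (rule prob_space_distr) fact
  have eq: "distr M S X \<Otimes>\<^sub>M distr M T Y = distr M (S \<Otimes>\<^sub>M T) (\<lambda>\<omega>. (X \<omega>, Y \<omega>))"
  proof (rule pair_measure_eqI)
    fix A B assume "A \<in> sets (distr M S X)" "B \<in> sets (distr M T Y)"
    then have AB[measurable]: "A \<in> sets S" "B \<in> sets T" by auto
    let ?A = "X -` A \<inter> space M" and ?B = "Y -` B \<inter> space M"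
    have "prob (?B \<inter> ?A) = prob ?B * prob ?A"
      using indep AB by (intro indep_setD) (auto intro!: in_vimage_algebra)
    then have "emeasure M (?B \<inter> ?A) = emeasure M ?B * emeasure M ?A"
      by (simp add: emeasure_eq_measure ennreal_mult)
    moreover have "(\<lambda>\<omega>. (X \<omega>, Y \<omega>)) -` (A \<times> B) \<inter> space M = ?B \<inter> ?A" by auto
    ultimately show "emeasure (distr M S X) A * emeasure (distr M T Y) B =
        emeasure (distr M (S \<Otimes>\<^sub>M T) (\<lambda>\<omega>. (X \<omega>, Y \<omega>))) (A \<times> B)"
      by (simp add: emeasure_distr mult.commute)
  qed (auto intro: PX.sigma_finite_measure_axioms PY.sigma_finite_measure_axioms cong: sets_pair_measure_cong)
  have hh: "h \<in> borel_measurable (S \<Otimes>\<^sub>M distr M T Y)" "h \<in> borel_measurable (distr M S X \<Otimes>\<^sub>M distr M T Y)"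
    by (simp_all cong: measurable_cong_sets sets_pair_measure_cong)
  have "(\<integral>\<^sup>+\<omega>. h (X \<omega>, Y \<omega>) \<partial>M) = (\<integral>\<^sup>+z. h z \<partial>(distr M S X \<Otimes>\<^sub>M distr M T Y))"
    unfolding eq by (simp add: nn_integral_distr)
  also have "\<dots> = (\<integral>\<^sup>+x. (\<integral>\<^sup>+y. h (x, y) \<partial>distr M T Y) \<partial>distr M S X)"
    by (rule PY.nn_integral_fst[OF hh(2), symmetric])
  also have "\<dots> = (\<integral>\<^sup>+\<omega>'. (\<integral>\<^sup>+y. h (X \<omega>', y) \<partial>distr M T Y) \<partial>M)"
    using PY.borel_measurable_nn_integral_fst[OF hh(1)] by (simp add: nn_integral_distr)
  also have "\<dots> = (\<integral>\<^sup>+\<omega>'. (\<integral>\<^sup>+\<omega>. h (X \<omega>', Y \<omega>) \<partial>M) \<partial>M)"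
    by (intro nn_integral_cong nn_integral_distr)
       (use X in \<open>auto dest: measurable_space intro!: measurable_compose[OF _ h]\<close>)
  finally show ?thesis .
qed

definition noise_sup ::
  "(real ^ 'k \<Rightarrow> real) \<Rightarrow> real \<Rightarrow> nat \<Rightarrow> ((nat \<Rightarrow> real ^ 'k) \<Rightarrow> nat \<Rightarrow> (real ^ 'k) set)
     \<Rightarrow> (nat \<Rightarrow> real ^ 'k) \<Rightarrow> (nat \<Rightarrow> real) \<Rightarrow> ennreal" where
  "noise_sup K e n D x v = (if mesh n x (D x) \<le> e
     then SUP t\<in>dyadic_points. ennreal \<bar>\<Sum>i=1..n. kernel_weight K e x (D x) i t * v i\<bar> else 0)"

lemma (in kernel_setup) noise_sup_measurable:
  fixes D :: "(nat \<Rightarrow> real ^ 'k) \<Rightarrow> nat \<Rightarrow> (real ^ 'k) set"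
  assumes D: "partition_rule n D"
  shows "(\<lambda>(x, v). noise_sup K e n D x v) \<in> borel_measurable (design_space n \<Otimes>\<^sub>M error_space n)"
proof -
  let ?P = "design_space n \<Otimes>\<^sub>M error_space n :: ((nat \<Rightarrow> real ^ 'k) \<times> (nat \<Rightarrow> real)) measure"
  have m[measurable]: "(\<lambda>x. mesh n x (D x)) \<in> borel_measurable (design_space n)"
    and v: "i \<in> {1..n} \<Longrightarrow> (\<lambda>x. measure lborel (D x i)) \<in> borel_measurable (design_space n)" for i
    using D unfolding partition_rule_def by auto
  have xc: "(\<lambda>z. fst z i) \<in> borel_measurable ?P" if i: "i \<in> {1..n}" for i
    by (intro measurable_compose[OF measurable_compose[OF measurable_fst measurable_component_singleton[OF i]]]
        measurable_restrict_space1 measurable_ident_sets) simp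
  have vc: "(\<lambda>z. snd z i) \<in> borel_measurable ?P" if i: "i \<in> {1..n}" for i
    using measurable_compose[OF measurable_snd measurable_component_singleton[OF i]] .
  have w: "(\<lambda>z. kernel_weight K e (fst z) (D (fst z)) i t * snd z i) \<in> borel_measurable ?P"
    if i: "i \<in> {1..n}" for i t
    unfolding kernel_weight_def
    by (intro borel_measurable_times vc[OF i] measurable_compose[OF measurable_fst v[OF i]]
        measurable_compose[OF _ scaled_kernel_measurable] borel_measurable_diff xc[OF i]) auto
  have "(\<lambda>z. SUP t\<in>dyadic_points. ennreal \<bar>\<Sum>i=1..n. kernel_weight K e (fst z) (D (fst z)) i t * snd z i\<bar>)
      \<in> borel_measurable ?P"
    by (intro borel_measurable_SUP countable_dyadic_points measurable_compose[OF _ measurable_ennreal]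
        borel_measurable_abs borel_measurable_sum w)
  then show ?thesis
    unfolding noise_sup_def case_prod_beta by measurable
qed

lemma model_measurable:
  assumes "regression_model M n X f \<xi>"
  shows design_vec_measurable: "design_vec n X \<in> measurable M (design_space n)"
    and field_path_measurable: "field_path f \<in> measurable M field_space"
    and error_vec_measurable: "error_vec n \<xi> \<in> measurable M (error_space n)"
    and model_vec_measurable: "model_vec n X f \<xi> \<in> measurable M (model_space n)"
proof -
  show d: "design_vec n X \<in> measurable M (design_space n)"
    unfolding design_vec_def using assms unfolding regression_model_def
    by (intro measurable_restrict measurable_restrict_space2) auto
  show f: "field_path f \<in> measurable M field_space"
    unfolding field_path_def using assms unfolding regression_model_def continuous_field_def
    by (intro measurable_restrict) auto
  show e: "error_vec n \<xi> \<in> measurable M (error_space n)"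
    unfolding error_vec_def using assms unfolding regression_model_def martingale_differences_def
    by (intro measurable_restrict) (auto dest: borel_measurable_integrable)
  show "model_vec n X f \<xi> \<in> measurable M (model_space n)"
    unfolding model_vec_def using d f e by (intro measurable_Pair)
qed

text \<open>The errors are integrated first, with the design frozen. The resulting bound is affine
  in a power of the mesh, so integrating over the design reproduces exactly the expectation in the
  rate.\<close>

lemma noise_sup_expectation:
  fixes K :: "real ^ 'k \<Rightarrow> real" and X :: "nat \<Rightarrow> 'a \<Rightarrow> real ^ 'k"
  assumes M: "prob_space M" and K: "smoothing_kernel L K" and D: "partition_rule n D" and n: "n \<ge> 1"
    and model: "regression_model M n X f \<xi>"
    and p: "p \<ge> 2" "p > real CARD('k)"
    and int: "\<And>i. i \<in> {1..n} \<Longrightarrow> integrable M (\<lambda>\<omega>. \<bar>\<xi> i \<omega>\<bar> powr p)"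
    and bound: "\<And>i. i \<in> {1..n} \<Longrightarrow> (\<integral>\<omega>. \<bar>\<xi> i \<omega>\<bar> powr p \<partial>M) \<le> m"
    and m: "m \<ge> 0" and e: "0 < e" "e \<le> 1" and \<tau>: "\<tau> > 0"
  shows "(\<integral>\<^sup>+\<omega>. noise_sup K e n D (design_vec n X \<omega>) (error_vec n \<xi> \<omega>) \<partial>M)
    \<le> ennreal ((1 + 1 / (1 - chain_ratio CARD('k) p)) * (\<tau> + \<tau> powr (1 - p) *
        (8 ^ CARD('k) * moment_const p * weight_const L CARD('k) powr (p / 2) * m *
         (e powr (- (real CARD('k) * (p / 2 + 1))) *
          (\<integral>\<omega>. mesh n (design_vec n X \<omega>) (D (design_vec n X \<omega>)) powr (real CARD('k) * p / 2) \<partial>M)))))"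
proof -
  interpret prob_space M by fact
  interpret kernel_setup L K by unfold_locales fact
  note e_le_1 = e(2)
  define d where "d \<omega> = mesh n (design_vec n X \<omega>) (D (design_vec n X \<omega>))" for \<omega>
  let ?q = "real CARD('k) * p / 2"
  define c where "c = (1 + 1 / (1 - chain_ratio CARD('k) p))"
  define c' where "c' = \<tau> powr (1 - p) * (8 ^ CARD('k) * moment_const p * weight_const L CARD('k) powr (p / 2) * m *
         e powr (- (real CARD('k) * (p / 2 + 1))))"
  have c: "c \<ge> 0" unfolding c_def using chain_ratio[OF p(2)] by auto
  have c': "c' \<ge> 0" unfolding c'_def moment_const_def using m by auto
  note mm = model_measurable[OF model]
  have dp: "design_partition n (design_vec n X \<omega>) (D (design_vec n X \<omega>))" if "\<omega> \<in> space M" for \<omega>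
  proof
    have "design_vec n X \<omega> \<in> space (design_space n)"
      using mm(1) that by (rule measurable_space)
    then show "borel_partition n (D (design_vec n X \<omega>))"
      using D unfolding partition_rule_def by auto
    show "design_vec n X \<omega> i \<in> unit_cube" if "i \<in> {1..n}" for i
      using model that \<open>\<omega> \<in> space M\<close> unfolding regression_model_def design_vec_def by auto
  qed fact
  have dm[measurable]: "d \<in> borel_measurable M"
    unfolding d_def using D mm(1) unfolding partition_rule_def by (auto intro: measurable_compose)
  have d01: "0 \<le> d \<omega> \<and> d \<omega> \<le> 1" if "\<omega> \<in> space M" for \<omega>
    using design_partition.mesh_nonneg[OF dp[OF that]] design_partition.mesh_le_1[OF dp[OF that]]
    unfolding d_def by auto
  have dint: "integrable M (\<lambda>\<omega>. d \<omega> powr ?q)"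
  proof (rule integrable_const_bound[where B = 1])
    show "AE \<omega> in M. norm (d \<omega> powr ?q) \<le> 1"
    proof (rule AE_I2)
      fix \<omega> assume "\<omega> \<in> space M"
      then have "d \<omega> powr ?q \<le> 1 powr ?q" using d01 p by (intro powr_mono2) auto
      then show "norm (d \<omega> powr ?q) \<le> 1" by simp
    qed
  qed simp
  have eqv: "(\<Sum>i=1..n. w i * error_vec n \<xi> \<omega> i) = (\<Sum>i=1..n. w i * \<xi> i \<omega>)" for w \<omega>
    by (intro sum.cong) (auto simp: error_vec_def)
  \<comment> \<open>The field is an argument because the errors are assumed independent of the pair
    of design and field.\<close>
  define h where "h = (\<lambda>((x, \<phi> :: real ^ 'k \<Rightarrow> real), v). noise_sup K e n D x v :: ennreal)"
  let ?XF = "\<lambda>\<omega>. (design_vec n X \<omega>, field_path f \<omega>)"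
  have "(\<integral>\<^sup>+\<omega>. noise_sup K e n D (design_vec n X \<omega>) (error_vec n \<xi> \<omega>) \<partial>M)
      = (\<integral>\<^sup>+\<omega>. h (?XF \<omega>, error_vec n \<xi> \<omega>) \<partial>M)"
    unfolding h_def by simp
  also have "\<dots> = (\<integral>\<^sup>+\<omega>'. (\<integral>\<^sup>+\<omega>. h (?XF \<omega>', error_vec n \<xi> \<omega>) \<partial>M) \<partial>M)"
  proof (rule indep_set_nn_integral)
    show "?XF \<in> measurable M (design_space n \<Otimes>\<^sub>M field_space)" using mm by (intro measurable_Pair)
    show "error_vec n \<xi> \<in> measurable M (error_space n)" by (rule mm)
    show "indep_set (sets (vimage_algebra (space M) (error_vec n \<xi>) (error_space n)))
      (sets (vimage_algebra (space M) ?XF (design_space n \<Otimes>\<^sub>M field_space)))"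
      using model unfolding regression_model_def by auto
    have "(\<lambda>z. (fst (fst z), snd z)) \<in> measurable ((design_space n \<Otimes>\<^sub>M field_space) \<Otimes>\<^sub>M error_space n)
        (design_space n \<Otimes>\<^sub>M error_space n)" by measurable
    from measurable_compose[OF this noise_sup_measurable[OF D, of e]]
    show "h \<in> borel_measurable ((design_space n \<Otimes>\<^sub>M field_space) \<Otimes>\<^sub>M error_space n)"
      unfolding h_def by (simp add: case_prod_beta')
  qed
  also have "\<dots> \<le> (\<integral>\<^sup>+\<omega>'. ennreal (c * (\<tau> + c' * d \<omega>' powr ?q)) \<partial>M)"
  proof (rule nn_integral_mono)
    fix \<omega>' assume \<omega>': "\<omega>' \<in> space M"
    let ?x = "design_vec n X \<omega>'"
    show "(\<integral>\<^sup>+\<omega>. h (?XF \<omega>', error_vec n \<xi> \<omega>) \<partial>M) \<le> ennreal (c * (\<tau> + c' * d \<omega>' powr ?q))"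
    proof (cases "d \<omega>' \<le> e")
      case False
      then show ?thesis unfolding h_def noise_sup_def d_def by simp
    next
      case True
      interpret design_partition n ?x "D ?x" by (rule dp[OF \<omega>'])
      interpret kernel_design L K n ?x "D ?x" e
        using True e unfolding d_def by unfold_locales auto
      have "(\<integral>\<^sup>+\<omega>. h (?XF \<omega>', error_vec n \<xi> \<omega>) \<partial>M)
        = (\<integral>\<^sup>+\<omega>. (SUP t\<in>dyadic_points. ennreal \<bar>\<Sum>i=1..n. weight i t * \<xi> i \<omega>\<bar>) \<partial>M)"
        using True unfolding h_def noise_sup_def d_def by (simp only: eqv prod.case if_True)
      also have "\<dots> \<le> ennreal (c * (\<tau> + c' * d \<omega>' powr ?q))"
        using noise_expectation[OF M _ p int bound m e_le_1 \<tau>] model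
        unfolding c_def c'_def d_def regression_model_def by (simp add: mult_ac)
      finally show ?thesis .
    qed
  qed
  also have "\<dots> = ennreal (\<integral>\<omega>'. c * (\<tau> + c' * d \<omega>' powr ?q) \<partial>M)"
    using c c' \<tau> dint by (intro nn_integral_eq_integral) auto
  also have "(\<integral>\<omega>'. c * (\<tau> + c' * d \<omega>' powr ?q) \<partial>M) = c * (\<tau> + c' * (\<integral>\<omega>'. d \<omega>' powr ?q \<partial>M))"
    using dint by (simp add: prob_space)
  finally show ?thesis unfolding c_def c'_def d_def by (simp add: mult_ac)
qed


section \<open>Oscillations and the law of large numbers\<close>

lemma tendsto_0_ennrealI:
  fixes X :: "nat \<Rightarrow> ennreal"
  assumes "\<And>\<eta>::real. \<eta> > 0 \<Longrightarrow> eventually (\<lambda>n. X n \<le> ennreal \<eta>) sequentially"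
  shows "X \<longlonglongrightarrow> 0"
proof (rule order_tendstoI)
  fix a :: ennreal assume "0 < a"
  then obtain b where b: "0 < b" "b < a" using dense by blast
  then have "b < top" using top.not_eq_extremum by fastforce
  then obtain \<eta> where \<eta>: "\<eta> \<ge> 0" "b = ennreal \<eta>" by (cases b) auto
  with b have "\<eta> > 0" by (simp add: ennreal_less_zero_iff)
  from assms[OF this] show "eventually (\<lambda>n. X n < a) sequentially"
    using b(2) \<eta>(2) by (auto elim!: eventually_mono intro: le_less_trans)
qed simp

section \<open>The modulus of continuity of the field and its expectation\<close>

text \<open>Countably many pairs make it measurable for the cylinder sigma-algebra. The strict
  inequality is an open condition, so it passes to nearby dyadic pairs.\<close>

definition osc :: "real \<Rightarrow> (real ^ 'k \<Rightarrow> real) \<Rightarrow> ennreal" where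
  "osc h \<phi> = (SUP z\<in>{z\<in>dyadic_points \<times> dyadic_points. infnorm (fst z - snd z) < h}.
     ennreal \<bar>\<phi> (fst z) - \<phi> (snd z)\<bar>)"

lemma osc_measurable[measurable]: "osc h \<in> borel_measurable field_space"
  unfolding osc_def
proof (rule borel_measurable_SUP)
  show "countable {z\<in>dyadic_points \<times> dyadic_points. infnorm (fst z - snd z :: real ^ 'k) < h}"
    by (rule countable_subset[OF _ countable_SIGMA[OF countable_dyadic_points countable_dyadic_points]]) auto
  fix z :: "(real ^ 'k) \<times> (real ^ 'k)"
  assume "z \<in> {z\<in>dyadic_points \<times> dyadic_points. infnorm (fst z - snd z) < h}"
  then have "fst z \<in> unit_cube" "snd z \<in> unit_cube" using dyadic_points_subset_cube by auto
  then show "(\<lambda>\<phi>. ennreal \<bar>\<phi> (fst z) - \<phi> (snd z)\<bar>) \<in> borel_measurable field_space"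
    by (intro measurable_compose[OF _ measurable_ennreal] borel_measurable_abs borel_measurable_diff
        measurable_component_singleton)
qed

text \<open>The snapped pair eventually satisfies the strict inequality as well; continuity gives
  the bound in the limit.\<close>

lemma osc_upper:
  fixes \<phi> :: "real ^ 'k \<Rightarrow> real"
  assumes \<phi>: "continuous_on unit_cube \<phi>" and st: "s \<in> unit_cube" "t \<in> unit_cube" "infnorm (s - t) < h"
  shows "ennreal \<bar>\<phi> s - \<phi> t\<bar> \<le> osc h \<phi>"
proof (rule tendsto_upperbound)
  show "(\<lambda>m. ennreal \<bar>\<phi> (snap m s) - \<phi> (snap m t)\<bar>) \<longlonglongrightarrow> ennreal \<bar>\<phi> s - \<phi> t\<bar>"
    by (intro tendsto_intros continuous_snap_tendsto \<phi> st)
  have "(\<lambda>m. infnorm (snap m s - snap m t)) \<longlonglongrightarrow> infnorm (s - t)"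
    by (intro tendsto_intros snap_tendsto)
  then have "eventually (\<lambda>m. infnorm (snap m s - snap m t) < h) sequentially"
    using st(3) by (rule order_tendstoD)
  then show "eventually (\<lambda>m. ennreal \<bar>\<phi> (snap m s) - \<phi> (snap m t)\<bar> \<le> osc h \<phi>) sequentially"
  proof eventually_elim
    case (elim m)
    then show ?case unfolding osc_def
      using SUP_upper[of "(snap m s, snap m t)" "{z\<in>dyadic_points \<times> dyadic_points. infnorm (fst z - snd z) < h}"
          "\<lambda>z. ennreal \<bar>\<phi> (fst z) - \<phi> (snd z)\<bar>"] snap_in_dyadic_points[OF st(1)] snap_in_dyadic_points[OF st(2)]
      by simp
  qed
qed simp

text \<open>Provides the integrable majorant for dominated convergence.\<close>

lemma osc_le_twice_SUP: "osc h \<phi> \<le> 2 * (SUP t\<in>dyadic_points. ennreal \<bar>\<phi> t\<bar>)"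
  unfolding osc_def
proof (rule SUP_least)
  fix z :: "(real ^ 'a) \<times> (real ^ 'a)"
  assume z: "z \<in> {z\<in>dyadic_points \<times> dyadic_points. infnorm (fst z - snd z) < h}"
  have "ennreal \<bar>\<phi> (fst z) - \<phi> (snd z)\<bar> \<le> ennreal (\<bar>\<phi> (fst z)\<bar> + \<bar>\<phi> (snd z)\<bar>)"
    by (intro ennreal_leI) auto
  also have "\<dots> = ennreal \<bar>\<phi> (fst z)\<bar> + ennreal \<bar>\<phi> (snd z)\<bar>" by (simp add: ennreal_plus)
  also have "\<dots> \<le> (SUP t\<in>dyadic_points. ennreal \<bar>\<phi> t\<bar>) + (SUP t\<in>dyadic_points. ennreal \<bar>\<phi> t\<bar>)"
    using z by (intro add_mono SUP_upper) auto
  finally show "ennreal \<bar>\<phi> (fst z) - \<phi> (snd z)\<bar> \<le> 2 * (SUP t\<in>dyadic_points. ennreal \<bar>\<phi> t\<bar>)"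
    by (simp add: mult_2)
qed

lemma osc_tendsto_0:
  fixes \<phi> :: "real ^ 'k \<Rightarrow> real"
  assumes \<phi>: "continuous_on unit_cube \<phi>" and h: "h \<longlonglongrightarrow> 0"
  shows "(\<lambda>n. osc (h n) \<phi>) \<longlonglongrightarrow> 0"
proof (rule tendsto_0_ennrealI)
  fix \<eta> :: real assume \<eta>: "\<eta> > 0"
  have "uniformly_continuous_on unit_cube \<phi>"
    using \<phi> compact_unit_cube by (rule compact_uniformly_continuous)
  then obtain d where d: "d > 0" "\<And>s t. s \<in> unit_cube \<Longrightarrow> t \<in> unit_cube \<Longrightarrow> dist s t < d \<Longrightarrow> dist (\<phi> s) (\<phi> t) < \<eta>"
    using \<eta> unfolding uniformly_continuous_on_def by metis
  \<comment> \<open>The factor converts the sup-norm into the Euclidean distance in which uniform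
    continuity is stated.\<close>
  have "(\<lambda>n. sqrt (real DIM(real ^ 'k)) * h n) \<longlonglongrightarrow> 0"
    using tendsto_mult_left[OF h, of "sqrt (real DIM(real ^ 'k))"] by simp
  then have "eventually (\<lambda>n. sqrt (real DIM(real ^ 'k)) * h n < d) sequentially"
    using d(1) by (rule order_tendstoD)
  then show "eventually (\<lambda>n. osc (h n) \<phi> \<le> ennreal \<eta>) sequentially"
  proof eventually_elim
    case (elim n)
    show ?case unfolding osc_def
    proof (rule SUP_least)
      fix z :: "(real ^ 'k) \<times> (real ^ 'k)"
      assume z: "z \<in> {z\<in>dyadic_points \<times> dyadic_points. infnorm (fst z - snd z) < h n}"
      then have c: "fst z \<in> unit_cube" "snd z \<in> unit_cube" using dyadic_points_subset_cube by auto
      have "dist (fst z) (snd z) \<le> sqrt (real DIM(real ^ 'k)) * infnorm (fst z - snd z)"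
        unfolding dist_norm by (rule norm_le_infnorm)
      also have "\<dots> \<le> sqrt (real DIM(real ^ 'k)) * h n"
        using z by (intro mult_left_mono) auto
      finally have "dist (\<phi> (fst z)) (\<phi> (snd z)) < \<eta>" using elim by (intro d(2) c) auto
      then show "ennreal \<bar>\<phi> (fst z) - \<phi> (snd z)\<bar> \<le> ennreal \<eta>"
        by (intro ennreal_leI) (auto simp: dist_real_def)
    qed
  qed
qed

lemma field_path_eq: "t \<in> unit_cube \<Longrightarrow> field_path f \<omega> t = f t \<omega>"
  by (simp add: field_path_def)

lemma continuous_field_path:
  "continuous_on unit_cube (field_path f \<omega>) \<longleftrightarrow> continuous_on unit_cube (\<lambda>t. f t \<omega>)"
  by (intro continuous_on_cong) (auto simp: field_path_eq)

lemma continuous_field_measurable: "continuous_field M f \<Longrightarrow> field_path f \<in> measurable M field_space"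
  unfolding field_path_def continuous_field_def by (intro measurable_restrict) auto

lemma SUP_dyadic_measurable:
  fixes f :: "real ^ 'k \<Rightarrow> 'a \<Rightarrow> real"
  assumes "continuous_field M f"
  shows "(\<lambda>\<omega>. SUP t\<in>dyadic_points. ennreal \<bar>f t \<omega>\<bar>) \<in> borel_measurable M"
  using assms dyadic_points_subset_cube unfolding continuous_field_def
  by (intro borel_measurable_SUP countable_dyadic_points measurable_compose[OF _ measurable_ennreal]
      borel_measurable_abs) auto

lemma SUP_dyadic_integrable:
  fixes f :: "real ^ 'k \<Rightarrow> 'a \<Rightarrow> real"
  assumes "(\<integral>\<^sup>+\<omega>. (SUP t\<in>unit_cube. ennreal \<bar>f t \<omega>\<bar>) \<partial>M) < \<infinity>"
  shows "(\<integral>\<^sup>+\<omega>. (SUP t\<in>dyadic_points. ennreal \<bar>f t \<omega>\<bar>) \<partial>M) < \<infinity>"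
  by (rule le_less_trans[OF nn_integral_mono assms])
     (intro SUP_subset_mono dyadic_points_subset_cube order_refl)

text \<open>Uniform continuity of almost every path gives pointwise convergence, and twice the
  supremum of the field dominates; the integrability of that supremum enters here.\<close>

lemma expected_osc_tendsto_0:
  fixes f :: "real ^ 'k \<Rightarrow> 'a \<Rightarrow> real"
  assumes f: "continuous_field M f"
    and fin: "(\<integral>\<^sup>+\<omega>. (SUP t\<in>unit_cube. ennreal \<bar>f t \<omega>\<bar>) \<partial>M) < \<infinity>"
    and h: "h \<longlonglongrightarrow> 0"
  shows "(\<lambda>n. \<integral>\<^sup>+\<omega>. osc (h n) (field_path f \<omega>) \<partial>M) \<longlonglongrightarrow> 0"
proof -
  have "(\<lambda>n. \<integral>\<^sup>+\<omega>. osc (h n) (field_path f \<omega>) \<partial>M) \<longlonglongrightarrow> (\<integral>\<^sup>+\<omega>. 0 \<partial>M)"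
  proof (rule nn_integral_dominated_convergence[where w = "\<lambda>\<omega>. 2 * (SUP t\<in>dyadic_points. ennreal \<bar>f t \<omega>\<bar>)"])
    show "(\<lambda>\<omega>. osc (h n) (field_path f \<omega>)) \<in> borel_measurable M" for n
      by (rule measurable_compose[OF continuous_field_measurable[OF f] osc_measurable])
    show "(\<lambda>\<omega>. 2 * (SUP t\<in>dyadic_points. ennreal \<bar>f t \<omega>\<bar>)) \<in> borel_measurable M"
      using SUP_dyadic_measurable[OF f] by measurable
    show "AE \<omega> in M. osc (h j) (field_path f \<omega>) \<le> 2 * (SUP t\<in>dyadic_points. ennreal \<bar>f t \<omega>\<bar>)" for j
    proof (rule AE_I2)
      fix \<omega>
      have "(SUP t\<in>dyadic_points. ennreal \<bar>field_path f \<omega> t\<bar>) = (SUP t\<in>dyadic_points. ennreal \<bar>f t \<omega>\<bar>)"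
        using dyadic_points_subset_cube by (intro SUP_cong) (auto simp: field_path_eq)
      then show "osc (h j) (field_path f \<omega>) \<le> 2 * (SUP t\<in>dyadic_points. ennreal \<bar>f t \<omega>\<bar>)"
        using osc_le_twice_SUP[of "h j" "field_path f \<omega>"] by simp
    qed
    show "(\<integral>\<^sup>+\<omega>. 2 * (SUP t\<in>dyadic_points. ennreal \<bar>f t \<omega>\<bar>) \<partial>M) < \<infinity>"
      using SUP_dyadic_integrable[OF fin] SUP_dyadic_measurable[OF f]
      by (simp add: nn_integral_cmult ennreal_mult_less_top)
    show "AE \<omega> in M. (\<lambda>i. osc (h i) (field_path f \<omega>)) \<longlonglongrightarrow> 0"
      using f unfolding continuous_field_def continuous_field_path[symmetric]
      by (auto intro: osc_tendsto_0[OF _ h])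
  qed simp
  then show ?thesis by simp
qed

lemma field_integrable:
  fixes f :: "real ^ 'k \<Rightarrow> 'a \<Rightarrow> real"
  assumes f: "continuous_field M f"
    and fin: "(\<integral>\<^sup>+\<omega>. (SUP t\<in>unit_cube. ennreal \<bar>f t \<omega>\<bar>) \<partial>M) < \<infinity>"
    and t: "t \<in> unit_cube"
  shows "integrable M (f t)"
proof (rule integrableI_bounded)
  show "f t \<in> borel_measurable M" using f t unfolding continuous_field_def by auto
  show "(\<integral>\<^sup>+\<omega>. ennreal (norm (f t \<omega>)) \<partial>M) < \<infinity>"
    by (rule le_less_trans[OF nn_integral_mono fin]) (use t in \<open>auto intro: SUP_upper\<close>)
qed

text \<open>The expected oscillation is also a modulus of continuity of the mean function, so the
  mean calls for no continuity argument of its own.\<close>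

lemma expected_field_osc:
  fixes f :: "real ^ 'k \<Rightarrow> 'a \<Rightarrow> real"
  assumes f: "continuous_field M f"
    and fin: "(\<integral>\<^sup>+\<omega>. (SUP t\<in>unit_cube. ennreal \<bar>f t \<omega>\<bar>) \<partial>M) < \<infinity>"
    and st: "s \<in> unit_cube" "t \<in> unit_cube" "infnorm (s - t) < h"
  shows "ennreal \<bar>(\<integral>\<omega>. f s \<omega> \<partial>M) - (\<integral>\<omega>. f t \<omega> \<partial>M)\<bar> \<le> (\<integral>\<^sup>+\<omega>. osc h (field_path f \<omega>) \<partial>M)"
proof -
  note int = field_integrable[OF f fin]
  have "ennreal \<bar>(\<integral>\<omega>. f s \<omega> \<partial>M) - (\<integral>\<omega>. f t \<omega> \<partial>M)\<bar> = ennreal (norm (\<integral>\<omega>. f s \<omega> - f t \<omega> \<partial>M))"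
    using int st by simp
  also have "\<dots> \<le> (\<integral>\<^sup>+\<omega>. ennreal (norm (f s \<omega> - f t \<omega>)) \<partial>M)"
    using int st by (intro integral_norm_bound_ennreal) auto
  also have "\<dots> \<le> (\<integral>\<^sup>+\<omega>. osc h (field_path f \<omega>) \<partial>M)"
  proof (rule nn_integral_mono_AE)
    have "AE \<omega> in M. continuous_on unit_cube (field_path f \<omega>)"
      using f unfolding continuous_field_def continuous_field_path by simp
    then show "AE \<omega> in M. ennreal (norm (f s \<omega> - f t \<omega>)) \<le> osc h (field_path f \<omega>)"
    proof eventually_elim
      case (elim \<omega>)
      then show ?case using osc_upper[OF elim st] st by (simp add: field_path_eq)
    qed
  qed
  finally show ?thesis .
qed

section \<open>A weak law of large numbers for arrays\<close>

text \<open>Independence removes the mixed terms, so the second moment of the sum \<open>S\<close>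
  is at most \<open>N * b\<^sup>2\<close>; the first moment follows from
  \<open>2 * c * \<bar>S\<bar> \<le> c\<^sup>2 + S\<^sup>2\<close>.\<close>

lemma (in prob_space) centered_sum_L1:
  fixes A :: "nat \<Rightarrow> 'a \<Rightarrow> real"
  assumes indep: "indep_vars (\<lambda>_. borel) A {1..N}"
    and bd: "\<And>j \<omega>. j \<in> {1..N} \<Longrightarrow> \<bar>A j \<omega>\<bar> \<le> b"
    and mean: "\<And>j. j \<in> {1..N} \<Longrightarrow> (\<integral>\<omega>. A j \<omega> \<partial>M) = 0"
    and N: "N \<ge> 1" and b: "b > 0"
  shows "(\<integral>\<omega>. \<bar>\<Sum>j=1..N. A j \<omega>\<bar> \<partial>M) \<le> b * sqrt (real N)"
proof -
  have meas[measurable]: "j \<in> {1..N} \<Longrightarrow> A j \<in> borel_measurable M" for j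
    using indep by (auto simp: indep_vars_def)
  have int: "integrable M (A j)" if "j \<in> {1..N}" for j
    using bd[OF that] meas[OF that] by (intro integrable_const_bound[where B = b]) auto
  have int2: "integrable M (\<lambda>\<omega>. A i \<omega> * A j \<omega>)" if "i \<in> {1..N}" "j \<in> {1..N}" for i j
    using bd[OF that(1)] bd[OF that(2)] meas[OF that(1)] meas[OF that(2)] b
    by (intro integrable_const_bound[where B = "b * b"]) (auto simp: abs_mult intro!: mult_mono)
  have prod0: "(\<integral>\<omega>. A i \<omega> * A j \<omega> \<partial>M) \<le> (if i = j then b\<^sup>2 else 0)"
    if ij: "i \<in> {1..N}" "j \<in> {1..N}" for i j
  proof (cases "i = j")
    case True
    have "A i \<omega> * A i \<omega> \<le> b\<^sup>2" for \<omega>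
      using power_mono[OF bd[OF ij(1), of \<omega>] abs_ge_zero, of 2] by (simp add: power2_eq_square)
    then have "(\<integral>\<omega>. A i \<omega> * A i \<omega> \<partial>M) \<le> (\<integral>\<omega>. b\<^sup>2 \<partial>M)"
      using int2[OF ij(1) ij(1)] by (intro integral_mono) auto
    then show ?thesis using True by (simp add: prob_space)
  next
    case False
    have "indep_vars (\<lambda>_. borel) A {i, j}"
      using indep ij by (rule_tac indep_vars_subset) auto
    then have "(\<integral>\<omega>. (\<Prod>l\<in>{i, j}. A l \<omega>) \<partial>M) = (\<Prod>l\<in>{i, j}. \<integral>\<omega>. A l \<omega> \<partial>M)"
      using int ij by (intro indep_vars_lebesgue_integral) auto
    then show ?thesis using False mean ij by simp
  qed
  let ?S = "\<lambda>\<omega>. \<Sum>j=1..N. A j \<omega>"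
  have sq: "(?S \<omega>)\<^sup>2 = (\<Sum>i=1..N. \<Sum>j=1..N. A i \<omega> * A j \<omega>)" for \<omega>
    by (simp add: power2_eq_square sum_product)
  have sqint: "integrable M (\<lambda>\<omega>. (?S \<omega>)\<^sup>2)"
    unfolding sq using int2 by (intro Bochner_Integration.integrable_sum) auto
  have "(\<integral>\<omega>. (?S \<omega>)\<^sup>2 \<partial>M) = (\<Sum>i=1..N. \<Sum>j=1..N. \<integral>\<omega>. A i \<omega> * A j \<omega> \<partial>M)"
  proof -
    have "(\<integral>\<omega>. (?S \<omega>)\<^sup>2 \<partial>M) = (\<Sum>i=1..N. \<integral>\<omega>. (\<Sum>j=1..N. A i \<omega> * A j \<omega>) \<partial>M)"
      unfolding sq by (intro Bochner_Integration.integral_sum Bochner_Integration.integrable_sum int2)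
    also have "\<dots> = (\<Sum>i=1..N. \<Sum>j=1..N. \<integral>\<omega>. A i \<omega> * A j \<omega> \<partial>M)"
      by (intro sum.cong refl Bochner_Integration.integral_sum int2)
    finally show ?thesis .
  qed
  also have "\<dots> \<le> (\<Sum>i=1..N. \<Sum>j=1..N. if i = j then b\<^sup>2 else 0)"
    by (intro sum_mono prod0) auto
  also have "\<dots> = (\<Sum>i=1..N. b\<^sup>2)"
    by (intro sum.cong refl) (simp add: sum.delta)
  also have "\<dots> = real N * b\<^sup>2" by simp
  finally have S2: "(\<integral>\<omega>. (?S \<omega>)\<^sup>2 \<partial>M) \<le> real N * b\<^sup>2" .
  \<comment> \<open>The expected size of the sum, which equalises the two terms of the quadratic
    inequality used in place of Cauchy-Schwarz.\<close>
  define c where "c = b * sqrt (real N)"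
  have c: "c > 0" "c\<^sup>2 = real N * b\<^sup>2" unfolding c_def using b N by (auto simp: power_mult_distrib)
  have Sint: "integrable M ?S" using int by (intro Bochner_Integration.integrable_sum) auto
  have "(\<integral>\<omega>. \<bar>?S \<omega>\<bar> \<partial>M) \<le> (\<integral>\<omega>. (c + (?S \<omega>)\<^sup>2 / c) / 2 \<partial>M)"
  proof (rule integral_mono)
    fix \<omega>
    have "0 \<le> (\<bar>?S \<omega>\<bar> - c)\<^sup>2" by simp
    then have "2 * (c * \<bar>?S \<omega>\<bar>) \<le> c\<^sup>2 + (?S \<omega>)\<^sup>2" by (simp add: power2_diff mult_ac)
    then show "\<bar>?S \<omega>\<bar> \<le> (c + (?S \<omega>)\<^sup>2 / c) / 2" using c(1) by (simp add: field_simps power2_eq_square)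
  qed (use Sint sqint in auto)
  also have "\<dots> = (c + (\<integral>\<omega>. (?S \<omega>)\<^sup>2 \<partial>M) / c) / 2"
    using sqint by (simp add: prob_space)
  also have "\<dots> \<le> (c + c\<^sup>2 / c) / 2" unfolding c(2) using S2 c(1)
    by (intro divide_right_mono add_left_mono) auto
  also have "\<dots> = c" using c(1) by (simp add: power2_eq_square)
  finally show ?thesis unfolding c_def .
qed

text \<open>Only a first moment is available, so \<open>Z\<close> is truncated at \<open>B\<close>:
  the bounded part is handled by second moments, and the tail is charged twice, once for the copies
  and once for the mean.\<close>

lemma (in prob_space) average_L1_bound:
  fixes Z :: "'a \<Rightarrow> real" and Z' :: "nat \<Rightarrow> 'a \<Rightarrow> real"
  assumes Z: "integrable M Z"
    and indep: "indep_vars (\<lambda>_. borel) Z' {1..N}"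
    and law: "\<And>j. j \<in> {1..N} \<Longrightarrow> distr M borel (Z' j) = distr M borel Z"
    and N: "N \<ge> 1" and B: "B > 0"
  shows "(\<integral>\<^sup>+\<omega>. ennreal \<bar>(\<Sum>j=1..N. Z' j \<omega>) / real N - (\<integral>\<omega>. Z \<omega> \<partial>M)\<bar> \<partial>M)
    \<le> ennreal (2 * B / sqrt (real N) + 2 * (\<integral>\<omega>. (if \<bar>Z \<omega>\<bar> \<le> B then 0 else \<bar>Z \<omega>\<bar>) \<partial>M))"
proof -
  define T where "T z = (if \<bar>z\<bar> \<le> B then z else 0)" for z :: real
  define R where "R z = (if \<bar>z\<bar> \<le> B then 0 else \<bar>z\<bar>)" for z :: real
  have [measurable]: "T \<in> borel_measurable borel" "R \<in> borel_measurable borel"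
    unfolding T_def R_def by measurable
  have Zm[measurable]: "Z \<in> borel_measurable M" using Z by auto
  have meas[measurable]: "j \<in> {1..N} \<Longrightarrow> Z' j \<in> borel_measurable M" for j
    using indep by (auto simp: indep_vars_def)
  have transfer: "integrable M (\<lambda>\<omega>. g (Z' j \<omega>)) \<longleftrightarrow> integrable M (\<lambda>\<omega>. g (Z \<omega>))"
     "(\<integral>\<omega>. g (Z' j \<omega>) \<partial>M) = (\<integral>\<omega>. g (Z \<omega>) \<partial>M)"
    if j: "j \<in> {1..N}" and g: "g \<in> borel_measurable borel" for g :: "real \<Rightarrow> real" and j
    using integrable_distr_eq[OF meas[OF j] g] integrable_distr_eq[OF Zm g]
      integral_distr[OF meas[OF j] g] integral_distr[OF Zm g] law[OF j] by auto
  have Tb: "\<bar>T z\<bar> \<le> B" for z unfolding T_def using B by auto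
  have split: "\<bar>z - T z\<bar> = R z" for z unfolding T_def R_def by auto
  have Tint: "integrable M (\<lambda>\<omega>. T (Z \<omega>))"
    using Tb by (intro integrable_const_bound[where B = B]) auto
  have Rint: "integrable M (\<lambda>\<omega>. R (Z \<omega>))"
    using Z by (rule Bochner_Integration.integrable_bound) (auto simp: R_def)
  define \<mu> where "\<mu> = (\<integral>\<omega>. T (Z \<omega>) \<partial>M)"
  have \<mu>: "\<bar>\<mu>\<bar> \<le> B"
  proof -
    have "\<bar>\<mu>\<bar> \<le> (\<integral>\<omega>. \<bar>T (Z \<omega>)\<bar> \<partial>M)" unfolding \<mu>_def by (rule integral_abs_bound)
    also have "\<dots> \<le> (\<integral>\<omega>. B \<partial>M)" using Tint Tb by (intro integral_mono) auto
    finally show ?thesis by (simp add: prob_space)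
  qed
  define A where "A j \<omega> = T (Z' j \<omega>) - \<mu>" for j \<omega>
  have sum_le: "(\<integral>\<omega>. \<bar>\<Sum>j=1..N. A j \<omega>\<bar> \<partial>M) \<le> (2 * B) * sqrt (real N)"
  proof (rule centered_sum_L1)
    show "indep_vars (\<lambda>_. borel) A {1..N}"
      unfolding A_def by (rule indep_vars_compose2[OF indep]) auto
    show "\<bar>A j \<omega>\<bar> \<le> 2 * B" for j \<omega> unfolding A_def using Tb[of "Z' j \<omega>"] \<mu> by linarith
    show "(\<integral>\<omega>. A j \<omega> \<partial>M) = 0" if "j \<in> {1..N}" for j
      unfolding A_def using transfer[OF that, of T] Tint by (simp add: prob_space \<mu>_def)
  qed (use N B in auto)
  have main: "(\<integral>\<omega>. \<bar>\<Sum>j=1..N. A j \<omega>\<bar> / real N \<partial>M) \<le> 2 * B / sqrt (real N)"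
  proof -
    have "(\<integral>\<omega>. \<bar>\<Sum>j=1..N. A j \<omega>\<bar> / real N \<partial>M) = (\<integral>\<omega>. \<bar>\<Sum>j=1..N. A j \<omega>\<bar> \<partial>M) / real N"
      by simp
    also have "\<dots> \<le> (2 * B) * sqrt (real N) / real N"
      using sum_le by (intro divide_right_mono) auto
    also have "\<dots> = 2 * B * (sqrt (real N) / real N)" by simp
    also have "sqrt (real N) / real N = 1 / sqrt (real N)"
      by (simp add: sqrt_divide_self_eq inverse_eq_divide)
    finally show ?thesis by simp
  qed
  have Aint: "integrable M (A j)" if "j \<in> {1..N}" for j
    unfolding A_def using transfer[OF that, of T] Tint by simp
  have RZint: "integrable M (\<lambda>\<omega>. R (Z' j \<omega>))" if "j \<in> {1..N}" for j
    using transfer[OF that, of R] Rint by simp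
  let ?r = "\<integral>\<omega>. R (Z \<omega>) \<partial>M"
  have EZ: "\<bar>\<mu> - (\<integral>\<omega>. Z \<omega> \<partial>M)\<bar> \<le> ?r"
  proof -
    have "\<mu> - (\<integral>\<omega>. Z \<omega> \<partial>M) = (\<integral>\<omega>. T (Z \<omega>) - Z \<omega> \<partial>M)"
      unfolding \<mu>_def using Tint Z by simp
    also have "\<bar>\<dots>\<bar> \<le> (\<integral>\<omega>. \<bar>T (Z \<omega>) - Z \<omega>\<bar> \<partial>M)" by (rule integral_abs_bound)
    also have "\<dots> = ?r" using split by (simp add: abs_minus_commute)
    finally show ?thesis .
  qed
  let ?H = "\<lambda>\<omega>. \<bar>\<Sum>j=1..N. A j \<omega>\<bar> / real N + (\<Sum>j=1..N. R (Z' j \<omega>)) / real N + ?r"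
  have Hint: "integrable M ?H"
    using Aint RZint by (intro Bochner_Integration.integrable_add integrable_divide_zero
        integrable_abs Bochner_Integration.integrable_sum) auto
  have point: "\<bar>(\<Sum>j=1..N. Z' j \<omega>) / real N - (\<integral>\<omega>. Z \<omega> \<partial>M)\<bar> \<le> ?H \<omega>" for \<omega>
  proof -
    have "(\<Sum>j=1..N. Z' j \<omega>) = (\<Sum>j=1..N. A j \<omega>) + (\<Sum>j=1..N. Z' j \<omega> - T (Z' j \<omega>)) + real N * \<mu>"
      unfolding A_def by (simp add: sum_subtractf)
    then have "(\<Sum>j=1..N. Z' j \<omega>) / real N = (\<Sum>j=1..N. A j \<omega>) / real N
        + (\<Sum>j=1..N. Z' j \<omega> - T (Z' j \<omega>)) / real N + \<mu>"
      using N by (simp add: add_divide_distrib)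
    moreover have "\<bar>(\<Sum>j=1..N. Z' j \<omega> - T (Z' j \<omega>)) / real N\<bar> \<le> (\<Sum>j=1..N. R (Z' j \<omega>)) / real N"
      using sum_abs[of "\<lambda>j. Z' j \<omega> - T (Z' j \<omega>)" "{1..N}"] unfolding split
      by (simp add: divide_right_mono)
    moreover have "\<bar>(\<Sum>j=1..N. A j \<omega>) / real N\<bar> = \<bar>\<Sum>j=1..N. A j \<omega>\<bar> / real N" by simp
    ultimately show ?thesis using EZ by linarith
  qed
  have "(\<integral>\<^sup>+\<omega>. ennreal \<bar>(\<Sum>j=1..N. Z' j \<omega>) / real N - (\<integral>\<omega>. Z \<omega> \<partial>M)\<bar> \<partial>M) \<le> (\<integral>\<^sup>+\<omega>. ennreal (?H \<omega>) \<partial>M)"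
    by (intro nn_integral_mono ennreal_leI point)
  also have "\<dots> = ennreal (\<integral>\<omega>. ?H \<omega> \<partial>M)"
    using Hint point by (intro nn_integral_eq_integral) (auto intro: order_trans[OF abs_ge_zero])
  also have "(\<integral>\<omega>. ?H \<omega> \<partial>M) = (\<integral>\<omega>. \<bar>\<Sum>j=1..N. A j \<omega>\<bar> / real N \<partial>M) + (\<Sum>j=1..N. \<integral>\<omega>. R (Z' j \<omega>) \<partial>M) / real N + ?r"
  proof -
    have i: "integrable M (\<lambda>\<omega>. \<bar>\<Sum>j=1..N. A j \<omega>\<bar> / real N)" "integrable M (\<lambda>\<omega>. (\<Sum>j=1..N. R (Z' j \<omega>)) / real N)"
      using Aint RZint by (intro integrable_divide_zero integrable_abs Bochner_Integration.integrable_sum; simp)+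
    have "(\<integral>\<omega>. (\<Sum>j=1..N. R (Z' j \<omega>)) / real N \<partial>M) = (\<Sum>j=1..N. \<integral>\<omega>. R (Z' j \<omega>) \<partial>M) / real N"
      using RZint by (simp only: integral_divide_zero Bochner_Integration.integral_sum)
    then show ?thesis using i by (simp only: Bochner_Integration.integral_add
        Bochner_Integration.integrable_add integrable_const lebesgue_integral_const prob_space scaleR_one)
  qed
  also have "(\<Sum>j=1..N. \<integral>\<omega>. R (Z' j \<omega>) \<partial>M) / real N = ?r"
    using N transfer(2)[of _ R] by simp
  also have "(\<integral>\<omega>. \<bar>\<Sum>j=1..N. A j \<omega>\<bar> / real N \<partial>M) + ?r + ?r \<le> 2 * B / sqrt (real N) + 2 * ?r"
    using main by simp
  finally show ?thesis unfolding R_def by (simp add: ennreal_leI)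
qed

text \<open>Each \<open>n\<close> has its own family, with no assumption relating different
  \<open>n\<close>, so the result is an L1 statement for rows. The truncation level is fixed first,
  from the tail of \<open>Z\<close>; then \<open>N n\<close> grows.\<close>

lemma (in prob_space) average_L1_tendsto_0:
  fixes Z :: "'a \<Rightarrow> real" and Z' :: "nat \<Rightarrow> nat \<Rightarrow> 'a \<Rightarrow> real"
  assumes Z: "integrable M Z"
    and indep: "\<And>n. n \<ge> 1 \<Longrightarrow> indep_vars (\<lambda>_. borel) (Z' n) {1..N n}"
    and law: "\<And>n j. n \<ge> 1 \<Longrightarrow> j \<in> {1..N n} \<Longrightarrow> distr M borel (Z' n j) = distr M borel Z"
    and N: "filterlim N at_top sequentially"
  shows "(\<lambda>n. \<integral>\<^sup>+\<omega>. ennreal \<bar>(\<Sum>j=1..N n. Z' n j \<omega>) / real (N n) - (\<integral>\<omega>. Z \<omega> \<partial>M)\<bar> \<partial>M) \<longlonglongrightarrow> 0"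
proof (rule tendsto_0_ennrealI)
  fix \<eta> :: real assume \<eta>: "\<eta> > 0"
  have Zm[measurable]: "Z \<in> borel_measurable M" using Z by auto
  have "(\<lambda>m. \<integral>\<omega>. (if \<bar>Z \<omega>\<bar> \<le> real m then 0 else \<bar>Z \<omega>\<bar>) \<partial>M) \<longlonglongrightarrow> (\<integral>\<omega>. 0 \<partial>M)"
  proof (rule integral_dominated_convergence[where w = "\<lambda>\<omega>. \<bar>Z \<omega>\<bar>"])
    show "AE \<omega> in M. (\<lambda>m. if \<bar>Z \<omega>\<bar> \<le> real m then 0 else \<bar>Z \<omega>\<bar>) \<longlonglongrightarrow> 0"
    proof (rule AE_I2)
      fix \<omega>
      have "eventually (\<lambda>m. \<bar>Z \<omega>\<bar> \<le> real m) sequentially"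
        using real_arch_simple[of "\<bar>Z \<omega>\<bar>"] by (metis (mono_tags, lifting) eventually_sequentially of_nat_mono order_trans)
      then show "(\<lambda>m. if \<bar>Z \<omega>\<bar> \<le> real m then 0 else \<bar>Z \<omega>\<bar>) \<longlonglongrightarrow> 0"
        by (intro tendsto_eventually) (erule eventually_mono, simp)
    qed
  qed (use Z in auto)
  then have "eventually (\<lambda>m. (\<integral>\<omega>. (if \<bar>Z \<omega>\<bar> \<le> real m then 0 else \<bar>Z \<omega>\<bar>) \<partial>M) < \<eta> / 4) sequentially"
    using \<eta> by (intro order_tendstoD(2)) auto
  then have "eventually (\<lambda>m. (\<integral>\<omega>. (if \<bar>Z \<omega>\<bar> \<le> real m then 0 else \<bar>Z \<omega>\<bar>) \<partial>M) < \<eta> / 4 \<and> m \<ge> 1) sequentially"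
    using eventually_ge_at_top by (rule eventually_conj)
  then obtain m :: nat where m: "(\<integral>\<omega>. (if \<bar>Z \<omega>\<bar> \<le> real m then 0 else \<bar>Z \<omega>\<bar>) \<partial>M) < \<eta> / 4" "m \<ge> 1"
    by (auto simp: eventually_sequentially)
  have "((\<lambda>x. 2 * real m / sqrt x) \<longlongrightarrow> 0) at_top" by real_asymp
  moreover have "filterlim (\<lambda>n. real (N n)) at_top sequentially"
    by (rule filterlim_compose[OF filterlim_real_sequentially N])
  ultimately have "(\<lambda>n. 2 * real m / sqrt (real (N n))) \<longlonglongrightarrow> 0"
    by (rule filterlim_compose)
  then have "eventually (\<lambda>n. 2 * real m / sqrt (real (N n)) < \<eta> / 2) sequentially"
    using \<eta> by (intro order_tendstoD(2)) auto
  moreover have "eventually (\<lambda>n. N n \<ge> 1) sequentially"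
    using N by (auto simp: filterlim_at_top)
  ultimately show "eventually (\<lambda>n. (\<integral>\<^sup>+\<omega>. ennreal \<bar>(\<Sum>j=1..N n. Z' n j \<omega>) / real (N n) - (\<integral>\<omega>. Z \<omega> \<partial>M)\<bar> \<partial>M) \<le> ennreal \<eta>) sequentially"
    using eventually_ge_at_top[of 1]
  proof eventually_elim
    case (elim n)
    have "(\<integral>\<^sup>+\<omega>. ennreal \<bar>(\<Sum>j=1..N n. Z' n j \<omega>) / real (N n) - (\<integral>\<omega>. Z \<omega> \<partial>M)\<bar> \<partial>M)
      \<le> ennreal (2 * real m / sqrt (real (N n)) + 2 * (\<integral>\<omega>. (if \<bar>Z \<omega>\<bar> \<le> real m then 0 else \<bar>Z \<omega>\<bar>) \<partial>M))"
      using elim m by (intro average_L1_bound Z indep law) auto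
    also have "\<dots> \<le> ennreal \<eta>" using elim m by (intro ennreal_leI) linarith
    finally show ?case .
  qed
qed

lemma (in kernel_design) estimator_error_osc:
  assumes J: "(\<Sum>i=1..n. weight i t) \<ge> \<rho> / 2" and \<rho>: "\<rho> > 0"
    and \<phi>: "continuous_on unit_cube \<phi>" and t: "t \<in> unit_cube"
  shows "ennreal \<bar>kernel_estimator K e n x C (\<lambda>i. \<phi> (x i) + v i) t - \<phi> t\<bar>
    \<le> osc (2 * e) \<phi> + ennreal (2 / \<rho>) * (SUP t\<in>dyadic_points. ennreal \<bar>\<Sum>i=1..n. weight i t * v i\<bar>)"
proof (cases "osc (2 * e) \<phi>")
  case (real w)
  have "\<bar>kernel_estimator K e n x C (\<lambda>i. \<phi> (x i) + v i) t - \<phi> t\<bar>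
    \<le> w + 2 / \<rho> * \<bar>\<Sum>i=1..n. weight i t * v i\<bar>"
  proof (rule estimator_error[OF J \<rho> real(1)])
    fix i assume i: "i \<in> {1..n}" "infnorm (t - x i) \<le> e"
    \<comment> \<open>The support of the kernel includes distance \<open>e\<close>, while
      \<open>osc\<close> uses a strict inequality; hence the scale \<open>2 * e\<close>.\<close>
    then have "infnorm (x i - t) < 2 * e" using e by (simp add: infnorm_sub)
    then have "ennreal \<bar>\<phi> (x i) - \<phi> t\<bar> \<le> ennreal w"
      unfolding real(2)[symmetric] by (intro osc_upper \<phi> x i t)
    then show "\<bar>\<phi> (x i) - \<phi> t\<bar> \<le> w" using real(1) by simp
  qed
  then have "ennreal \<bar>kernel_estimator K e n x C (\<lambda>i. \<phi> (x i) + v i) t - \<phi> t\<bar>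
    \<le> ennreal w + ennreal (2 / \<rho>) * ennreal \<bar>\<Sum>i=1..n. weight i t * v i\<bar>"
    using real(1) \<rho> by (simp add: ennreal_leI flip: ennreal_mult ennreal_plus)
  \<comment> \<open>The weights are continuous in \<open>t\<close>, so the noise at any
    \<open>t\<close> is bounded by its supremum over dyadic points.\<close>
  also have "ennreal \<bar>\<Sum>i=1..n. weight i t * v i\<bar>
      \<le> (SUP t\<in>dyadic_points. ennreal \<bar>\<Sum>i=1..n. weight i t * v i\<bar>)"
    unfolding kernel_weight_def
    by (intro SUP_dyadic_points_upper t continuous_intros continuous_scaled_kernel)
  finally show ?thesis using real(2) by (simp add: add_left_mono mult_left_mono)
qed simp


section \<open>Averages over the copies\<close>

text \<open>The level \<open>\<tau>\<close> is fixed first as a multiple of the target accuracy; the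
  rate then annihilates the term with the large factor \<open>\<tau> powr (1 - p)\<close>.\<close>

lemma noise_expectation_tendsto_0:
  fixes K :: "real ^ 'k \<Rightarrow> real" and X :: "nat \<Rightarrow> nat \<Rightarrow> 'a \<Rightarrow> real ^ 'k" and e :: "nat \<Rightarrow> real"
  assumes M: "prob_space M" and K: "smoothing_kernel L K"
    and D: "\<And>n. n \<ge> 1 \<Longrightarrow> partition_rule n (D n)"
    and model: "\<And>n. n \<ge> 1 \<Longrightarrow> regression_model M n (X n) f (\<xi> n)"
    and p: "p > real CARD('k)" "p \<ge> 2"
    and moments: "(SUP n\<in>{1..}. SUP i\<in>{1..n}. \<integral>\<^sup>+\<omega>. ennreal (\<bar>\<xi> n i \<omega>\<bar> powr p) \<partial>M) < \<infinity>"
    and e: "\<And>n. e n > 0" "e \<longlonglongrightarrow> 0"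
    and rate: "(\<lambda>n. e n powr (- (real CARD('k) * (p / 2 + 1))) *
        (\<integral>\<omega>. mesh n (design_vec n (X n) \<omega>) (D n (design_vec n (X n) \<omega>)) powr (real CARD('k) * p / 2) \<partial>M)) \<longlonglongrightarrow> 0"
  shows "(\<lambda>n. \<integral>\<^sup>+\<omega>. noise_sup K (e n) n (D n) (design_vec n (X n) \<omega>) (error_vec n (\<xi> n) \<omega>) \<partial>M) \<longlonglongrightarrow> 0"
proof (rule tendsto_0_ennrealI)
  define S where "S = (SUP n\<in>{1..}. SUP i\<in>{1..n}. \<integral>\<^sup>+\<omega>. ennreal (\<bar>\<xi> n i \<omega>\<bar> powr p) \<partial>M)"
  define m where "m = enn2real S"
  \<comment> \<open>Finiteness of the supremum yields one real moment bound valid for all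
    \<open>n\<close> and \<open>i\<close>.\<close>
  have S: "S = ennreal m" unfolding m_def using moments by (simp add: S_def)
  have m: "m \<ge> 0" unfolding m_def by simp
  have mom: "integrable M (\<lambda>\<omega>. \<bar>\<xi> n i \<omega>\<bar> powr p) \<and> (\<integral>\<omega>. \<bar>\<xi> n i \<omega>\<bar> powr p \<partial>M) \<le> m"
    if n: "n \<ge> 1" and i: "i \<in> {1..n}" for n i
  proof -
    have "(\<integral>\<^sup>+\<omega>. ennreal (\<bar>\<xi> n i \<omega>\<bar> powr p) \<partial>M) \<le> (SUP i\<in>{1..n}. \<integral>\<^sup>+\<omega>. ennreal (\<bar>\<xi> n i \<omega>\<bar> powr p) \<partial>M)"
      using i by (rule SUP_upper)
    also have "\<dots> \<le> S" unfolding S_def using n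
      by (intro SUP_upper[of n "{1..}" "\<lambda>n. SUP i\<in>{1..n}. \<integral>\<^sup>+\<omega>. ennreal (\<bar>\<xi> n i \<omega>\<bar> powr p) \<partial>M"]) simp
    finally have le: "(\<integral>\<^sup>+\<omega>. ennreal (\<bar>\<xi> n i \<omega>\<bar> powr p) \<partial>M) \<le> ennreal m" unfolding S .
    have [measurable]: "\<xi> n i \<in> borel_measurable M"
      using model[OF n] i unfolding regression_model_def martingale_differences_def
      by (auto dest: borel_measurable_integrable)
    have int: "integrable M (\<lambda>\<omega>. \<bar>\<xi> n i \<omega>\<bar> powr p)"
      using le by (intro integrableI_bounded) (auto simp: le_less_trans[OF le])
    moreover have "(\<integral>\<omega>. \<bar>\<xi> n i \<omega>\<bar> powr p \<partial>M) \<le> m"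
      using nn_integral_eq_integral[OF int] le m by simp
    ultimately show ?thesis by simp
  qed
  define c where "c = 1 + 1 / (1 - chain_ratio CARD('k) p)"
  define c' where "c' = 8 ^ CARD('k) * moment_const p * weight_const L CARD('k) powr (p / 2) * m"
  have c: "c > 0" unfolding c_def using chain_ratio[OF p(1)] by (intro add_pos_pos) auto
  let ?r = "\<lambda>n. e n powr (- (real CARD('k) * (p / 2 + 1))) *
        (\<integral>\<omega>. mesh n (design_vec n (X n) \<omega>) (D n (design_vec n (X n) \<omega>)) powr (real CARD('k) * p / 2) \<partial>M)"
  fix \<eta> :: real assume \<eta>: "\<eta> > 0"
  define \<tau> where "\<tau> = \<eta> / (2 * c)"
  have \<tau>: "\<tau> > 0" unfolding \<tau>_def using \<eta> c by simp
  have "(\<lambda>n. c * (\<tau> + \<tau> powr (1 - p) * (c' * ?r n))) \<longlonglongrightarrow> c * (\<tau> + \<tau> powr (1 - p) * (c' * 0))"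
    by (intro tendsto_intros rate)
  moreover have "c * (\<tau> + \<tau> powr (1 - p) * (c' * 0)) < \<eta>"
    unfolding \<tau>_def using c \<eta> by simp
  ultimately have "eventually (\<lambda>n. c * (\<tau> + \<tau> powr (1 - p) * (c' * ?r n)) < \<eta>) sequentially"
    by (rule order_tendstoD)
  moreover have "eventually (\<lambda>n. e n < 1) sequentially"
    using e(2) by (rule order_tendstoD) simp
  ultimately show "eventually (\<lambda>n. (\<integral>\<^sup>+\<omega>. noise_sup K (e n) n (D n) (design_vec n (X n) \<omega>) (error_vec n (\<xi> n) \<omega>) \<partial>M) \<le> ennreal \<eta>) sequentially"
    using eventually_ge_at_top[of 1]
  proof eventually_elim
    case (elim n)
    have "(\<integral>\<^sup>+\<omega>. noise_sup K (e n) n (D n) (design_vec n (X n) \<omega>) (error_vec n (\<xi> n) \<omega>) \<partial>M)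
      \<le> ennreal (c * (\<tau> + \<tau> powr (1 - p) * (c' * ?r n)))"
      unfolding c_def c'_def
      using elim mom[OF elim(3)] by (intro noise_sup_expectation[where f = f] M K D model p m e \<tau>) auto
    also have "\<dots> \<le> ennreal \<eta>" using elim(1) by (intro ennreal_leI) simp
    finally show ?case .
  qed
qed

lemma kernel_estimator_cong:
  "(\<And>i. i \<in> {1..n} \<Longrightarrow> y i = y' i) \<Longrightarrow> kernel_estimator K e n x C y t = kernel_estimator K e n x C y' t"
  unfolding kernel_estimator_def by (auto intro!: arg_cong2[where f = "(/)"] sum.cong)

text \<open>A statement about one realisation. The error splits into estimator minus field at
  \<open>t\<close>, field at \<open>t\<close> minus field at a grid point \<open>s\<close>, average
  minus mean at \<open>s\<close>, and mean at \<open>s\<close> minus mean at \<open>t\<close>.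
  Summing over the whole grid removes the dependence of \<open>s\<close> on
  \<open>t\<close>.\<close>

lemma average_error_bound:
  fixes K :: "real ^ 'k \<Rightarrow> real" and \<phi> :: "nat \<Rightarrow> real ^ 'k \<Rightarrow> real" and x :: "nat \<Rightarrow> nat \<Rightarrow> real ^ 'k"
  assumes K: "smoothing_kernel L K" "boundary_condition \<rho> e\<^sub>0 K"
    and e: "0 < e" "e \<le> e\<^sub>0" and N: "N \<ge> 1"
    and part: "\<And>j. j \<in> {1..N} \<Longrightarrow> design_partition n (x j) (D (x j))"
    and small: "\<And>j. j \<in> {1..N} \<Longrightarrow>
      mesh n (x j) (D (x j)) \<le> e * min 1 (\<rho> / (real CARD('k) * 2 ^ (CARD('k) + 1) * L))"
    and \<phi>: "\<And>j. j \<in> {1..N} \<Longrightarrow> continuous_on unit_cube (\<phi> j)"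
    and h: "1 / 2 ^ m < h"
    and \<mu>: "\<And>s t. s \<in> unit_cube \<Longrightarrow> t \<in> unit_cube \<Longrightarrow> infnorm (s - t) < h \<Longrightarrow> ennreal \<bar>\<mu> s - \<mu> t\<bar> \<le> E"
    and t: "t \<in> unit_cube"
  shows "ennreal \<bar>(\<Sum>j=1..N. kernel_estimator K e n (x j) (D (x j)) (\<lambda>i. \<phi> j (x j i) + v j i) t) / real N - \<mu> t\<bar>
    \<le> (\<Sum>j=1..N. ennreal (1 / real N) *
        (osc (2 * e) (\<phi> j) + ennreal (2 / \<rho>) * noise_sup K e n D (x j) (v j) + osc h (\<phi> j)))
      + (\<Sum>s\<in>dyadic_grid m. ennreal \<bar>(\<Sum>j=1..N. \<phi> j s) / real N - \<mu> s\<bar>) + E"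
proof -
  note boundary = K(2)
  have \<rho>: "\<rho> > 0" using K unfolding boundary_condition_def by auto
  define est where "est j = kernel_estimator K e n (x j) (D (x j)) (\<lambda>i. \<phi> j (x j i) + v j i) t" for j
  define s where "s = snap m t"
  have s: "s \<in> dyadic_grid m" unfolding s_def using t by (rule snap_in_dyadic_grid)
  then have sc: "s \<in> unit_cube" using dyadic_grid_subset_cube by blast
  have st: "infnorm (s - t) < h"
    using infnorm_snap[of t m] h unfolding s_def by (simp add: infnorm_sub)
  have est: "ennreal \<bar>est j - \<phi> j t\<bar> \<le> osc (2 * e) (\<phi> j) + ennreal (2 / \<rho>) * noise_sup K e n D (x j) (v j)"
    if j: "j \<in> {1..N}" for j
  proof -
    interpret design_partition n "x j" "D (x j)" by (rule part[OF j])
    have sm: "mesh n (x j) (D (x j)) \<le> e"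
      "mesh n (x j) (D (x j)) \<le> e * (\<rho> / (real CARD('k) * 2 ^ (CARD('k) + 1) * L))"
      using order_trans[OF small[OF j] mult_left_mono[OF min.cobounded1]]
        order_trans[OF small[OF j] mult_left_mono[OF min.cobounded2]] e by simp_all
    interpret kernel_design L K n "x j" "D (x j)" e
      using K(1) e(1) sm(1) by unfold_locales auto
    show ?thesis
      using estimator_error_osc[OF sum_weight_lower[OF boundary \<open>e \<le> e\<^sub>0\<close> t sm(2)] \<rho> \<phi>[OF j] t, of "v j"] sm(1)
      unfolding est_def noise_sup_def by simp
  qed
  have dec: "(\<Sum>j=1..N. est j) / real N - \<mu> t
     = (\<Sum>j=1..N. 1 / real N * (est j - \<phi> j t)) + (\<Sum>j=1..N. 1 / real N * (\<phi> j t - \<phi> j s))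
       + ((\<Sum>j=1..N. \<phi> j s) / real N - \<mu> s) + (\<mu> s - \<mu> t)"
    by (simp add: sum_subtractf diff_divide_distrib flip: sum_divide_distrib)
  have tri: "ennreal \<bar>a + b + c + d\<bar> \<le> ennreal \<bar>a\<bar> + ennreal \<bar>b\<bar> + ennreal \<bar>c\<bar> + ennreal \<bar>d\<bar>" for a b c d :: real
    by (simp add: ennreal_leI flip: ennreal_plus)
  have avg: "ennreal \<bar>\<Sum>j=1..N. 1 / real N * a j\<bar> \<le> (\<Sum>j=1..N. ennreal (1 / real N) * ennreal \<bar>a j\<bar>)" for a :: "nat \<Rightarrow> real"
  proof -
    have "ennreal \<bar>\<Sum>j=1..N. 1 / real N * a j\<bar> \<le> ennreal (\<Sum>j=1..N. \<bar>1 / real N * a j\<bar>)"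
      by (intro ennreal_leI sum_abs)
    also have "\<dots> = (\<Sum>j=1..N. ennreal \<bar>1 / real N * a j\<bar>)"
      by (rule sum_ennreal[symmetric]) simp
    also have "\<dots> = (\<Sum>j=1..N. ennreal (1 / real N) * ennreal \<bar>a j\<bar>)"
      by (intro sum.cong refl) (simp add: abs_mult flip: ennreal_mult)
    finally show ?thesis .
  qed
  have "ennreal \<bar>(\<Sum>j=1..N. est j) / real N - \<mu> t\<bar>
    \<le> ennreal \<bar>\<Sum>j=1..N. 1 / real N * (est j - \<phi> j t)\<bar> + ennreal \<bar>\<Sum>j=1..N. 1 / real N * (\<phi> j t - \<phi> j s)\<bar>
      + ennreal \<bar>(\<Sum>j=1..N. \<phi> j s) / real N - \<mu> s\<bar> + ennreal \<bar>\<mu> s - \<mu> t\<bar>"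
    unfolding dec by (rule tri)
  also have "\<dots> \<le> (\<Sum>j=1..N. ennreal (1 / real N) * (osc (2 * e) (\<phi> j) + ennreal (2 / \<rho>) * noise_sup K e n D (x j) (v j)))
      + (\<Sum>j=1..N. ennreal (1 / real N) * osc h (\<phi> j))
      + (\<Sum>s\<in>dyadic_grid m. ennreal \<bar>(\<Sum>j=1..N. \<phi> j s) / real N - \<mu> s\<bar>) + E"
  proof (intro add_mono \<mu> sc t st)
    show "ennreal \<bar>\<Sum>j=1..N. 1 / real N * (est j - \<phi> j t)\<bar>
      \<le> (\<Sum>j=1..N. ennreal (1 / real N) * (osc (2 * e) (\<phi> j) + ennreal (2 / \<rho>) * noise_sup K e n D (x j) (v j)))"
      by (rule order_trans[OF avg]) (intro sum_mono mult_left_mono est, auto)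
    show "ennreal \<bar>\<Sum>j=1..N. 1 / real N * (\<phi> j t - \<phi> j s)\<bar> \<le> (\<Sum>j=1..N. ennreal (1 / real N) * osc h (\<phi> j))"
      by (rule order_trans[OF avg])
         (intro sum_mono mult_left_mono osc_upper \<phi> t sc, use st in \<open>auto simp: infnorm_sub\<close>)
    show "ennreal \<bar>(\<Sum>j=1..N. \<phi> j s) / real N - \<mu> s\<bar>
      \<le> (\<Sum>s\<in>dyadic_grid m. ennreal \<bar>(\<Sum>j=1..N. \<phi> j s) / real N - \<mu> s\<bar>)"
      using s finite_dyadic_grid by (intro member_le_sum) auto
  qed
  finally show ?thesis
    unfolding est_def by (simp only: sum.distrib[symmetric] distrib_left[symmetric])
qed

lemma copy_nn_integral:
  assumes law: "distr M S Y' = distr M S Y" and Y: "Y' \<in> measurable M S" "Y \<in> measurable M S"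
    and g: "g \<in> borel_measurable S"
  shows "(\<integral>\<^sup>+\<omega>. g (Y' \<omega>) \<partial>M) = (\<integral>\<^sup>+\<omega>. g (Y \<omega>) \<partial>M)"
  using nn_integral_distr[OF Y(1), of g] nn_integral_distr[OF Y(2), of g] law g by simp

text \<open>The indicator term charges \<open>\<eta>\<close> to a copy whose mesh exceeds \<open>b\<close>, so that Markov's inequality
  for the sum of the copy errors covers the exceptional event as well.\<close>

definition copy_error ::
  "(real ^ 'k \<Rightarrow> real) \<Rightarrow> real \<Rightarrow> real \<Rightarrow> real \<Rightarrow> real \<Rightarrow> real \<Rightarrow> nat \<Rightarrow> nat \<Rightarrow> ((nat \<Rightarrow> real ^ 'k) \<Rightarrow> nat \<Rightarrow> (real ^ 'k) set)
    \<Rightarrow> (nat \<Rightarrow> real ^ 'k) \<times> (real ^ 'k \<Rightarrow> real) \<times> (nat \<Rightarrow> real) \<Rightarrow> ennreal" where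
  "copy_error K \<rho> e b h \<eta> N n D = (\<lambda>(x, \<phi>, v).
     ennreal (1 / real N) * (osc (2 * e) \<phi> + ennreal (2 / \<rho>) * noise_sup K e n D x v + osc h \<phi>)
     + ennreal \<eta> * indicator {b<..} (mesh n x (D x)))"

lemma (in kernel_setup) copy_error_measurable:
  assumes D: "partition_rule n D"
  shows "copy_error K \<rho> e b h \<eta> N n D \<in> borel_measurable (model_space n)"
proof -
  have [measurable]: "(\<lambda>x. mesh n x (D x)) \<in> borel_measurable (design_space n)"
    using D unfolding partition_rule_def by auto
  have "(\<lambda>z. (fst z, snd (snd z))) \<in> measurable (model_space n) (design_space n \<Otimes>\<^sub>M error_space n)"
    by measurable
  from measurable_compose[OF this noise_sup_measurable[OF D, of e]]
  have [measurable]: "(\<lambda>z. noise_sup K e n D (fst z) (snd (snd z))) \<in> borel_measurable (model_space n)"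
    by simp
  show ?thesis unfolding copy_error_def case_prod_beta by measurable
qed

text \<open>The event is covered by a measurable set and a null set, so Markov's inequality for
  \<open>H\<close> bounds its outer measure. Each copy is then replaced by the original model;
  \<open>N\<close> cancels against the averaging factor except in the mesh term, where it survives
  as in the tail condition.\<close>

lemma copies_outer_measure_bound:
  fixes K :: "real ^ 'k \<Rightarrow> real" and X :: "nat \<Rightarrow> 'a \<Rightarrow> real ^ 'k" and f :: "real ^ 'k \<Rightarrow> 'a \<Rightarrow> real"
  assumes M: "prob_space M" and K: "smoothing_kernel L K" "boundary_condition \<rho> e\<^sub>0 K"
    and D: "partition_rule n D" and n: "n \<ge> 1" and N: "N \<ge> 1" and e: "0 < e" "e \<le> e\<^sub>0"
    and model: "regression_model M n X f \<xi>"
    and copies: "independent_copies M n X f \<xi> N X' f' \<xi>'"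
    and fin: "(\<integral>\<^sup>+\<omega>. (SUP t\<in>unit_cube. ennreal \<bar>f t \<omega>\<bar>) \<partial>M) < \<infinity>"
    and h: "1 / 2 ^ m < h" and \<eta>: "\<eta> > 0"
    and b: "b = e * min 1 (\<rho> / (real CARD('k) * 2 ^ (CARD('k) + 1) * L))"
  shows "outer_measure_of M {\<omega> \<in> space M. (SUP t\<in>unit_cube. ennreal
      \<bar>(\<Sum>j=1..N. kernel_estimator K e n (design_vec n (X' j) \<omega>) (D (design_vec n (X' j) \<omega>))
         (\<lambda>i. f' j (X' j i \<omega>) \<omega> + \<xi>' j i \<omega>) t) / real N - (\<integral>\<omega>'. f t \<omega>' \<partial>M)\<bar>) > ennreal \<eta>}
    \<le> ennreal (1 / \<eta>) * (
        ((\<integral>\<^sup>+\<omega>. osc (2 * e) (field_path f \<omega>) \<partial>M)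
         + ennreal (2 / \<rho>) * (\<integral>\<^sup>+\<omega>. noise_sup K e n D (design_vec n X \<omega>) (error_vec n \<xi> \<omega>) \<partial>M)
         + (\<integral>\<^sup>+\<omega>. osc h (field_path f \<omega>) \<partial>M))
        + ennreal \<eta> * ennreal (real N * measure M {\<omega> \<in> space M. mesh n (design_vec n X \<omega>) (D (design_vec n X \<omega>)) > b})
        + (\<Sum>s\<in>dyadic_grid m. \<integral>\<^sup>+\<omega>. ennreal \<bar>(\<Sum>j=1..N. f' j s \<omega>) / real N - (\<integral>\<omega>. f s \<omega> \<partial>M)\<bar> \<partial>M)
        + (\<integral>\<^sup>+\<omega>. osc h (field_path f \<omega>) \<partial>M))"
    (is "outer_measure_of M {\<omega> \<in> space M. ?Z \<omega> > _} \<le> _")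
proof -
  interpret prob_space M by fact
  note kernel = K
  interpret kernel_setup L K by unfold_locales (rule K)
  define mv where "mv = model_vec n X f \<xi>"
  define mv' where "mv' j = model_vec n (X' j) (f' j) (\<xi>' j)" for j
  have mv: "mv \<in> measurable M (model_space n)"
    unfolding mv_def by (rule model_vec_measurable[OF model])
  have mv': "mv' j \<in> measurable M (model_space n)" if "j \<in> {1..N}" for j
    using copies that unfolding independent_copies_def indep_vars_def mv'_def by auto
  have law: "distr M (model_space n) (mv' j) = distr M (model_space n) mv" if "j \<in> {1..N}" for j
    using copies that unfolding independent_copies_def mv_def mv'_def by auto
  have f: "continuous_field M f" using model unfolding regression_model_def by auto
  have f': "continuous_field M (f' j)" if "j \<in> {1..N}" for j
    using copies that unfolding independent_copies_def by auto
  define G where "G = copy_error K \<rho> e b h \<eta> N n D"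
  have G[measurable]: "G \<in> borel_measurable (model_space n)"
    unfolding G_def using D by (rule copy_error_measurable)
  define E where "E = (\<integral>\<^sup>+\<omega>. osc h (field_path f \<omega>) \<partial>M)"
  define Q where "Q s \<omega> = ennreal \<bar>(\<Sum>j=1..N. f' j s \<omega>) / real N - (\<integral>\<omega>. f s \<omega> \<partial>M)\<bar>" for s \<omega>
  have Q: "Q s \<in> borel_measurable M" if "s \<in> dyadic_grid m" for s
  proof -
    have "s \<in> unit_cube" using that dyadic_grid_subset_cube by blast
    then have "f' j s \<in> borel_measurable M" if "j \<in> {1..N}" for j
      using f'[OF that] unfolding continuous_field_def by auto
    then have "(\<lambda>\<omega>. \<Sum>j=1..N. f' j s \<omega>) \<in> borel_measurable M" by (rule borel_measurable_sum)
    then show ?thesis unfolding Q_def by measurable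
  qed
  define H where "H \<omega> = (\<Sum>j=1..N. G (mv' j \<omega>)) + (\<Sum>s\<in>dyadic_grid m. Q s \<omega>) + E" for \<omega>
  have Gm: "(\<lambda>\<omega>. G (mv' j \<omega>)) \<in> borel_measurable M" if "j \<in> {1..N}" for j
    using mv'[OF that] G by (rule measurable_compose)
  have sums: "(\<lambda>\<omega>. \<Sum>j=1..N. G (mv' j \<omega>)) \<in> borel_measurable M"
    "(\<lambda>\<omega>. \<Sum>s\<in>dyadic_grid m. Q s \<omega>) \<in> borel_measurable M"
    using Gm Q by (auto intro!: borel_measurable_sum)
  have H[measurable]: "H \<in> borel_measurable M"
    unfolding H_def[abs_def] using sums by (intro borel_measurable_add) auto
  \<comment> \<open>The copies are finitely many, so one null set serves them all.\<close>
  have "AE \<omega> in M. \<forall>j\<in>{1..N}. continuous_on unit_cube (field_path (f' j) \<omega>)"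
    using f' unfolding continuous_field_def continuous_field_path by (intro AE_finite_allI) auto
  then obtain Null where Null: "Null \<in> null_sets M"
    "\<And>\<omega>. \<omega> \<in> space M - Null \<Longrightarrow> \<forall>j\<in>{1..N}. continuous_on unit_cube (field_path (f' j) \<omega>)"
    by (auto elim!: AE_E3)
  let ?A = "{\<omega> \<in> space M. 1 \<le> ennreal (1 / \<eta>) * H \<omega>}"
  have sub: "{\<omega> \<in> space M. ?Z \<omega> > ennreal \<eta>} \<subseteq> ?A \<union> Null"
  proof
    fix \<omega> assume "\<omega> \<in> {\<omega> \<in> space M. ?Z \<omega> > ennreal \<eta>}"
    then have \<omega>: "\<omega> \<in> space M" and Z: "?Z \<omega> > ennreal \<eta>" by auto
    show "\<omega> \<in> ?A \<union> Null"
    proof (cases "\<omega> \<in> Null")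
      case False
      then have cont: "continuous_on unit_cube (field_path (f' j) \<omega>)" if "j \<in> {1..N}" for j
        using Null(2) \<omega> that by auto
      \<comment> \<open>That a copied design lies in the cube is extracted from the measurability of
        the copy into the restricted space.\<close>
      have dv: "design_vec n (X' j) \<omega> \<in> space (design_space n)" if "j \<in> {1..N}" for j
        using measurable_space[OF mv'[OF that] \<omega>] unfolding mv'_def model_vec_def by (auto simp: space_pair_measure)
      have cube: "design_vec n (X' j) \<omega> i \<in> unit_cube" if "j \<in> {1..N}" "i \<in> {1..n}" for j i
        using dv[OF that(1)] that(2) by (auto simp: space_PiM space_restrict_space)
      have part: "design_partition n (design_vec n (X' j) \<omega>) (D (design_vec n (X' j) \<omega>))" if "j \<in> {1..N}" for j
        using n cube[OF that] D dv[OF that] unfolding partition_rule_def by unfold_locales auto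
      let ?d = "\<lambda>j. mesh n (design_vec n (X' j) \<omega>) (D (design_vec n (X' j) \<omega>))"
      have "ennreal \<eta> \<le> H \<omega>"
      proof (cases "\<exists>j\<in>{1..N}. ?d j > b")
        case True
        then obtain j where j: "j \<in> {1..N}" "?d j > b" by auto
        have "ennreal \<eta> \<le> G (mv' j \<omega>)"
          unfolding G_def copy_error_def mv'_def model_vec_def using j(2) by simp
        also have "\<dots> \<le> (\<Sum>j=1..N. G (mv' j \<omega>))" using j(1) by (intro member_le_sum) auto
        also have "\<dots> \<le> H \<omega>" unfolding H_def by (simp add: add.assoc)
        finally show ?thesis .
      next
        case small: False
        have "?Z \<omega> \<le> H \<omega>"
        proof (rule SUP_least)
          fix t :: "real ^ 'k" assume t: "t \<in> unit_cube"
          have "ennreal \<bar>(\<Sum>j=1..N. kernel_estimator K e n (design_vec n (X' j) \<omega>) (D (design_vec n (X' j) \<omega>))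
              (\<lambda>i. field_path (f' j) \<omega> (design_vec n (X' j) \<omega> i) + error_vec n (\<xi>' j) \<omega> i) t) / real N - (\<integral>\<omega>'. f t \<omega>' \<partial>M)\<bar>
            \<le> (\<Sum>j=1..N. ennreal (1 / real N) * (osc (2 * e) (field_path (f' j) \<omega>)
               + ennreal (2 / \<rho>) * noise_sup K e n D (design_vec n (X' j) \<omega>) (error_vec n (\<xi>' j) \<omega>)
               + osc h (field_path (f' j) \<omega>)))
            + (\<Sum>s\<in>dyadic_grid m. ennreal \<bar>(\<Sum>j=1..N. field_path (f' j) \<omega> s) / real N - (\<integral>\<omega>'. f s \<omega>' \<partial>M)\<bar>) + E"
          proof (rule average_error_bound[where x = "\<lambda>j. design_vec n (X' j) \<omega>" and \<phi> = "\<lambda>j. field_path (f' j) \<omega>"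
                and v = "\<lambda>j. error_vec n (\<xi>' j) \<omega>" and \<mu> = "\<lambda>t. \<integral>\<omega>'. f t \<omega>' \<partial>M",
                OF kernel e N part _ cont h _ t])
            show "?d j \<le> e * min 1 (\<rho> / (real CARD('k) * 2 ^ (CARD('k) + 1) * L))" if "j \<in> {1..N}" for j
              using small that unfolding b by (meson not_less)
            show "ennreal \<bar>(\<integral>\<omega>'. f s \<omega>' \<partial>M) - (\<integral>\<omega>'. f t \<omega>' \<partial>M)\<bar> \<le> E"
              if "s \<in> unit_cube" "t \<in> unit_cube" "infnorm (s - t) < h" for s t
              unfolding E_def using that by (rule expected_field_osc[OF f fin])
          qed
          also have "(\<Sum>s\<in>dyadic_grid m. ennreal \<bar>(\<Sum>j=1..N. field_path (f' j) \<omega> s) / real N - (\<integral>\<omega>'. f s \<omega>' \<partial>M)\<bar>)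
            = (\<Sum>s\<in>dyadic_grid m. Q s \<omega>)"
          proof (rule sum.cong)
            fix s :: "real ^ 'k" assume "s \<in> dyadic_grid m"
            then have "s \<in> unit_cube" using dyadic_grid_subset_cube by blast
            then show "ennreal \<bar>(\<Sum>j=1..N. field_path (f' j) \<omega> s) / real N - (\<integral>\<omega>'. f s \<omega>' \<partial>M)\<bar> = Q s \<omega>"
              unfolding Q_def by (simp add: field_path_eq)
          qed simp
          also have "(\<Sum>j=1..N. ennreal (1 / real N) * (osc (2 * e) (field_path (f' j) \<omega>)
               + ennreal (2 / \<rho>) * noise_sup K e n D (design_vec n (X' j) \<omega>) (error_vec n (\<xi>' j) \<omega>)
               + osc h (field_path (f' j) \<omega>))) \<le> (\<Sum>j=1..N. G (mv' j \<omega>))"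
            unfolding G_def copy_error_def mv'_def model_vec_def by (intro sum_mono) simp
          also have "(\<Sum>j=1..N. kernel_estimator K e n (design_vec n (X' j) \<omega>) (D (design_vec n (X' j) \<omega>))
              (\<lambda>i. field_path (f' j) \<omega> (design_vec n (X' j) \<omega> i) + error_vec n (\<xi>' j) \<omega> i) t)
            = (\<Sum>j=1..N. kernel_estimator K e n (design_vec n (X' j) \<omega>) (D (design_vec n (X' j) \<omega>))
              (\<lambda>i. f' j (X' j i \<omega>) \<omega> + \<xi>' j i \<omega>) t)"
          proof (intro sum.cong refl kernel_estimator_cong)
            fix j i assume "j \<in> {1..N}" "i \<in> {1..n}"
            then show "field_path (f' j) \<omega> (design_vec n (X' j) \<omega> i) + error_vec n (\<xi>' j) \<omega> i
              = f' j (X' j i \<omega>) \<omega> + \<xi>' j i \<omega>"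
              using cube[of j i] by (simp add: field_path_eq) (simp add: design_vec_def error_vec_def)
          qed
          finally show "ennreal \<bar>(\<Sum>j=1..N. kernel_estimator K e n (design_vec n (X' j) \<omega>) (D (design_vec n (X' j) \<omega>))
              (\<lambda>i. f' j (X' j i \<omega>) \<omega> + \<xi>' j i \<omega>) t) / real N - (\<integral>\<omega>'. f t \<omega>' \<partial>M)\<bar> \<le> H \<omega>"
            unfolding H_def by (simp add: add_right_mono)
        qed
        then show ?thesis using Z by simp
      qed
      then have "ennreal (1 / \<eta>) * ennreal \<eta> \<le> ennreal (1 / \<eta>) * H \<omega>" by (intro mult_left_mono) auto
      moreover have "ennreal (1 / \<eta>) * ennreal \<eta> = 1" using \<eta> by (simp flip: ennreal_mult)
      ultimately show ?thesis using \<omega> by simp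
    qed simp
  qed
  have "outer_measure_of M {\<omega> \<in> space M. ?Z \<omega> > ennreal \<eta>} \<le> outer_measure_of M (?A \<union> Null)"
    by (rule outer_measure_of_mono[OF sub])
  also have "\<dots> = emeasure M (?A \<union> Null)"
    using Null(1) by (intro outer_measure_of_eq sets.Un) auto
  also have "\<dots> = emeasure M ?A" using Null(1) by (intro emeasure_Un_null_set) auto
  also have "\<dots> \<le> ennreal (1 / \<eta>) * (\<integral>\<^sup>+\<omega>. H \<omega> * indicator (space M) \<omega> \<partial>M)"
    by (rule nn_integral_Markov_inequality) auto
  also have "(\<integral>\<^sup>+\<omega>. H \<omega> * indicator (space M) \<omega> \<partial>M) = (\<integral>\<^sup>+\<omega>. H \<omega> \<partial>M)"
    by (intro nn_integral_cong) auto
  also have "\<dots> = (\<Sum>j=1..N. \<integral>\<^sup>+\<omega>. G (mv' j \<omega>) \<partial>M) + (\<Sum>s\<in>dyadic_grid m. \<integral>\<^sup>+\<omega>. Q s \<omega> \<partial>M) + E"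
  proof -
    have "(\<integral>\<^sup>+\<omega>. H \<omega> \<partial>M) = (\<integral>\<^sup>+\<omega>. (\<Sum>j=1..N. G (mv' j \<omega>)) + (\<Sum>s\<in>dyadic_grid m. Q s \<omega>) \<partial>M) + (\<integral>\<^sup>+\<omega>. E \<partial>M)"
      unfolding H_def using sums by (intro nn_integral_add borel_measurable_add) auto
    also have "(\<integral>\<^sup>+\<omega>. E \<partial>M) = E" by (simp add: emeasure_space_1)
    also have "(\<integral>\<^sup>+\<omega>. (\<Sum>j=1..N. G (mv' j \<omega>)) + (\<Sum>s\<in>dyadic_grid m. Q s \<omega>) \<partial>M)
       = (\<integral>\<^sup>+\<omega>. (\<Sum>j=1..N. G (mv' j \<omega>)) \<partial>M) + (\<integral>\<^sup>+\<omega>. (\<Sum>s\<in>dyadic_grid m. Q s \<omega>) \<partial>M)"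
      using sums by (rule nn_integral_add)
    also have "(\<integral>\<^sup>+\<omega>. (\<Sum>j=1..N. G (mv' j \<omega>)) \<partial>M) = (\<Sum>j=1..N. \<integral>\<^sup>+\<omega>. G (mv' j \<omega>) \<partial>M)"
      using Gm by (rule nn_integral_sum)
    also have "(\<integral>\<^sup>+\<omega>. (\<Sum>s\<in>dyadic_grid m. Q s \<omega>) \<partial>M) = (\<Sum>s\<in>dyadic_grid m. \<integral>\<^sup>+\<omega>. Q s \<omega> \<partial>M)"
      using Q by (rule nn_integral_sum)
    finally show ?thesis .
  qed
  also have "(\<Sum>j=1..N. \<integral>\<^sup>+\<omega>. G (mv' j \<omega>) \<partial>M) = (\<Sum>j=1..N. \<integral>\<^sup>+\<omega>. G (mv \<omega>) \<partial>M)"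
    by (intro sum.cong refl copy_nn_integral[OF law] mv' mv G)
  also have "\<dots> = ennreal (real N) * (\<integral>\<^sup>+\<omega>. G (mv \<omega>) \<partial>M)"
    by (simp add: ennreal_of_nat_eq_real_of_nat)
  also have "(\<integral>\<^sup>+\<omega>. G (mv \<omega>) \<partial>M) = ennreal (1 / real N) * ((\<integral>\<^sup>+\<omega>. osc (2 * e) (field_path f \<omega>) \<partial>M)
         + ennreal (2 / \<rho>) * (\<integral>\<^sup>+\<omega>. noise_sup K e n D (design_vec n X \<omega>) (error_vec n \<xi> \<omega>) \<partial>M)
         + (\<integral>\<^sup>+\<omega>. osc h (field_path f \<omega>) \<partial>M))
        + ennreal \<eta> * emeasure M {\<omega> \<in> space M. mesh n (design_vec n X \<omega>) (D (design_vec n X \<omega>)) > b}"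
  proof -
    note mm[measurable] = design_vec_measurable[OF model] field_path_measurable[OF model] error_vec_measurable[OF model]
    have [measurable]: "(\<lambda>x. mesh n x (D x)) \<in> borel_measurable (design_space n)"
      using D unfolding partition_rule_def by auto
    have [measurable]: "(\<lambda>\<omega>. noise_sup K e n D (design_vec n X \<omega>) (error_vec n \<xi> \<omega>)) \<in> borel_measurable M"
      using measurable_compose[OF measurable_Pair[OF mm(1,3)] noise_sup_measurable[OF D, of e]] by simp
    have "(\<integral>\<^sup>+\<omega>. indicator {b<..} (mesh n (design_vec n X \<omega>) (D (design_vec n X \<omega>))) \<partial>M)
      = (\<integral>\<^sup>+\<omega>. indicator {\<omega> \<in> space M. mesh n (design_vec n X \<omega>) (D (design_vec n X \<omega>)) > b} \<omega> \<partial>M)"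
      by (intro nn_integral_cong) (auto simp: indicator_def)
    also have "\<dots> = emeasure M {\<omega> \<in> space M. mesh n (design_vec n X \<omega>) (D (design_vec n X \<omega>)) > b}"
      by (rule nn_integral_indicator) measurable
    finally have ind: "(\<integral>\<^sup>+\<omega>. indicator {b<..} (mesh n (design_vec n X \<omega>) (D (design_vec n X \<omega>))) \<partial>M)
      = emeasure M {\<omega> \<in> space M. mesh n (design_vec n X \<omega>) (D (design_vec n X \<omega>)) > b}" .
    show ?thesis
      unfolding G_def copy_error_def mv_def model_vec_def ind[symmetric]
      by (simp add: nn_integral_add nn_integral_cmult)
  qed
  also have "ennreal (real N) * (ennreal (1 / real N) * a + ennreal \<eta> * emeasure M B)
      = a + ennreal \<eta> * ennreal (real N * measure M B)" for a B
  proof -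
    have "ennreal (real N) * ennreal (1 / real N) = 1"
      using N by (simp flip: ennreal_mult)
    then have "ennreal (real N) * (ennreal (1 / real N) * a) = a"
      by (simp add: mult.assoc[symmetric])
    then show ?thesis
      by (simp add: distrib_left emeasure_eq_measure ennreal_mult mult_ac)
  qed
  finally show ?thesis unfolding Q_def E_def by simp
qed

theorem theorem2:
  fixes M :: "'a measure"
    and K :: "real ^ 'k \<Rightarrow> real"
    and L \<rho> \<epsilon>\<^sub>0 p :: real
    and X :: "nat \<Rightarrow> nat \<Rightarrow> 'a \<Rightarrow> real ^ 'k"
    and f :: "real ^ 'k \<Rightarrow> 'a \<Rightarrow> real"
    and \<xi> :: "nat \<Rightarrow> nat \<Rightarrow> 'a \<Rightarrow> real"
    and D :: "nat \<Rightarrow> (nat \<Rightarrow> real ^ 'k) \<Rightarrow> nat \<Rightarrow> (real ^ 'k) set"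
    and \<delta> :: "nat \<Rightarrow> 'a \<Rightarrow> real"
    and \<epsilon> :: "nat \<Rightarrow> real"
    and N :: "nat \<Rightarrow> nat"
    and X' :: "nat \<Rightarrow> nat \<Rightarrow> nat \<Rightarrow> 'a \<Rightarrow> real ^ 'k"
    and f' :: "nat \<Rightarrow> nat \<Rightarrow> real ^ 'k \<Rightarrow> 'a \<Rightarrow> real"
    and \<xi>' :: "nat \<Rightarrow> nat \<Rightarrow> nat \<Rightarrow> 'a \<Rightarrow> real"
  defines "\<delta> \<equiv> \<lambda>n \<omega>. mesh n (design_vec n (X n) \<omega>) (D n (design_vec n (X n) \<omega>))"
  assumes prob: "prob_space M"
    and kernel: "smoothing_kernel L K" "boundary_condition \<rho> \<epsilon>\<^sub>0 K"
    and model: "\<And>n. n \<ge> 1 \<Longrightarrow> regression_model M n (X n) f (\<xi> n)"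
    and moments: "p > real CARD('k)" "p \<ge> 2"
      "(SUP n\<in>{1..}. SUP i\<in>{1..n}. \<integral>\<^sup>+\<omega>. ennreal (\<bar>\<xi> n i \<omega>\<bar> powr p) \<partial>M) < \<infinity>"
    and partition: "\<And>n. n \<ge> 1 \<Longrightarrow> partition_rule n (D n)"
    and mesh_to_0: "tends_to_0_in_prob M (\<lambda>n \<omega>. ennreal (\<delta> n \<omega>))"
    and sup_integrable: "(\<integral>\<^sup>+\<omega>. (SUP t\<in>unit_cube. ennreal \<bar>f t \<omega>\<bar>) \<partial>M) < \<infinity>"
    and copies: "\<And>n. n \<ge> 1 \<Longrightarrow>
      independent_copies M n (X n) f (\<xi> n) (N n) (X' n) (f' n) (\<xi>' n)"
    and bandwidth: "\<And>n. \<epsilon> n > 0" "\<epsilon> \<longlonglongrightarrow> 0"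
    and N_infinite: "filterlim N at_top sequentially"
    and rate: "(\<lambda>n. \<epsilon> n powr (- (real CARD('k) * (p / 2 + 1))) *
        (\<integral>\<omega>. \<delta> n \<omega> powr (real CARD('k) * p / 2) \<partial>M)) \<longlonglongrightarrow> 0"
    and tail: "(\<lambda>n. real (N n) * measure M {\<omega> \<in> space M.
        \<delta> n \<omega> > \<epsilon> n * min 1 (\<rho> / (real CARD('k) * 2 ^ (CARD('k) + 1) * L))}) \<longlonglongrightarrow> 0"
  shows "tends_to_0_in_prob M (\<lambda>n \<omega>. SUP t\<in>unit_cube. ennreal
    \<bar>(\<Sum>j=1..N n. kernel_estimator K (\<epsilon> n) n
         (design_vec n (X' n j) \<omega>) (D n (design_vec n (X' n j) \<omega>))
         (\<lambda>i. f' n j (X' n j i \<omega>) \<omega> + \<xi>' n j i \<omega>) t) / real (N n)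
      - (\<integral>\<omega>'. f t \<omega>' \<partial>M)\<bar>)"
  unfolding tends_to_0_in_prob_def
proof (intro allI impI)
  interpret prob_space M by fact
  fix \<eta> :: real assume \<eta>: "\<eta> > 0"
  have f: "continuous_field M f" using model[of 1] unfolding regression_model_def by simp
  have f': "continuous_field M (f' n j)" if "n \<ge> 1" "j \<in> {1..N n}" for n j
    using copies[OF that(1)] that(2) unfolding independent_copies_def by auto
  \<comment> \<open>Twice the grid spacing, because \<open>osc\<close> only sees distances strictly
    below its scale.\<close>
  let ?h = "\<lambda>m. 2 / 2 ^ m :: real"
  let ?E = "\<lambda>h. \<integral>\<^sup>+\<omega>. osc h (field_path f \<omega>) \<partial>M"
  let ?B = "\<lambda>n. \<integral>\<^sup>+\<omega>. noise_sup K (\<epsilon> n) n (D n) (design_vec n (X n) \<omega>) (error_vec n (\<xi> n) \<omega>) \<partial>M"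
  let ?P = "\<lambda>n. real (N n) * measure M {\<omega> \<in> space M.
        \<delta> n \<omega> > \<epsilon> n * min 1 (\<rho> / (real CARD('k) * 2 ^ (CARD('k) + 1) * L))}"
  let ?Q = "\<lambda>m n. \<Sum>s\<in>dyadic_grid m. \<integral>\<^sup>+\<omega>. ennreal \<bar>(\<Sum>j=1..N n. f' n j s \<omega>) / real (N n) - (\<integral>\<omega>. f s \<omega> \<partial>M)\<bar> \<partial>M"
  \<comment> \<open>Collects the terms that vanish as \<open>n\<close> grows with the grid level
    \<open>m\<close> fixed. The oscillation at scale \<open>?h m\<close> vanishes only as
    \<open>m\<close> grows and is kept apart.\<close>
  define R where "R m n = ?E (2 * \<epsilon> n) + ennreal (2 / \<rho>) * ?B n + ennreal \<eta> * ennreal (?P n) + ?Q m n" for m n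
  have B: "?B \<longlonglongrightarrow> 0"
    using noise_expectation_tendsto_0[OF prob kernel(1) partition model moments bandwidth rate[unfolded \<delta>_def]] .
  have Q: "?Q m \<longlonglongrightarrow> 0" for m
  proof -
    have "?Q m \<longlonglongrightarrow> (\<Sum>s\<in>(dyadic_grid m :: (real ^ 'k) set). 0)"
    proof (intro tendsto_sum average_L1_tendsto_0 N_infinite)
      fix s :: "real ^ 'k" assume "s \<in> dyadic_grid m"
      then have s: "s \<in> unit_cube" using dyadic_grid_subset_cube by blast
      show "integrable M (f s)" by (rule field_integrable[OF f sup_integrable s])
      \<comment> \<open>Evaluation at \<open>s\<close> transports both the independence and the
        common law from whole models to field values.\<close>
      define ev where "ev = (\<lambda>z :: (nat \<Rightarrow> real ^ 'k) \<times> (real ^ 'k \<Rightarrow> real) \<times> (nat \<Rightarrow> real). fst (snd z) s)"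
      have ev: "ev \<in> borel_measurable (model_space n)" for n
        unfolding ev_def using s by measurable
      have ev_eq: "ev (model_vec n Y g \<zeta> \<omega>) = g s \<omega>" for n Y g \<zeta> and \<omega> :: 'a
        unfolding ev_def model_vec_def using s by (simp add: field_path_eq)
      fix n :: nat assume n: "n \<ge> 1"
      have ind: "indep_vars (\<lambda>_. model_space n) (\<lambda>j. model_vec n (X' n j) (f' n j) (\<xi>' n j)) {1..N n}"
        using copies[OF n] unfolding independent_copies_def by auto
      from indep_vars_compose2[OF this, of "\<lambda>_. ev" "\<lambda>_. borel"] ev
      show "indep_vars (\<lambda>_. borel) (\<lambda>j \<omega>. f' n j s \<omega>) {1..N n}" by (simp add: ev_eq)
      fix j assume j: "j \<in> {1..N n}"
      have mv: "model_vec n (X' n j) (f' n j) (\<xi>' n j) \<in> measurable M (model_space n)"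
        using ind j unfolding indep_vars_def by auto
      have "distr M borel (\<lambda>\<omega>. f' n j s \<omega>) = distr (distr M (model_space n) (model_vec n (X' n j) (f' n j) (\<xi>' n j))) borel ev"
        using distr_distr[OF ev mv] by (simp add: comp_def ev_eq)
      also have "\<dots> = distr (distr M (model_space n) (model_vec n (X n) f (\<xi> n))) borel ev"
        using copies[OF n] j unfolding independent_copies_def by auto
      also have "\<dots> = distr M borel (\<lambda>\<omega>. f s \<omega>)"
        using distr_distr[OF ev model_vec_measurable[OF model[OF n]]] by (simp add: comp_def ev_eq)
      finally show "distr M borel (f' n j s) = distr M borel (f s)" .
    qed
    then show ?thesis by simp
  qed
  have P: "(\<lambda>n. ennreal (?P n)) \<longlonglongrightarrow> 0"
    using tail by (subst ennreal_tendsto_0_iff) auto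
  have "(\<lambda>n. 2 * \<epsilon> n) \<longlonglongrightarrow> 0" using tendsto_mult_left[OF bandwidth(2), of 2] by simp
  then have E: "(\<lambda>n. ?E (2 * \<epsilon> n)) \<longlonglongrightarrow> 0" by (rule expected_osc_tendsto_0[OF f sup_integrable])
  have R: "(\<lambda>n. ennreal (1 / \<eta>) * R m n) \<longlonglongrightarrow> 0" for m
  proof -
    have "(\<lambda>n. ennreal (1 / \<eta>) * R m n) \<longlonglongrightarrow> ennreal (1 / \<eta>) * (0 + ennreal (2 / \<rho>) * 0 + ennreal \<eta> * 0 + 0)"
      unfolding R_def by (intro ennreal_tendsto_cmult tendsto_add E B P Q) auto
    then show ?thesis by simp
  qed
  have "?h \<longlonglongrightarrow> 0" by real_asymp
  then have "(\<lambda>m. ?E (?h m)) \<longlonglongrightarrow> 0" by (rule expected_osc_tendsto_0[OF f sup_integrable])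
  \<comment> \<open>The oscillation at grid scale occurs twice, for the copies and for the mean,
    hence \<open>2 / \<eta>\<close>.\<close>
  then have h: "(\<lambda>m. ennreal (2 / \<eta>) * ?E (?h m)) \<longlonglongrightarrow> 0"
    using ennreal_tendsto_cmult[of "ennreal (2 / \<eta>)" "\<lambda>m. ?E (?h m)" 0] by simp
  show "(\<lambda>n. outer_measure_of M {\<omega> \<in> space M. (SUP t\<in>unit_cube. ennreal
    \<bar>(\<Sum>j=1..N n. kernel_estimator K (\<epsilon> n) n
         (design_vec n (X' n j) \<omega>) (D n (design_vec n (X' n j) \<omega>))
         (\<lambda>i. f' n j (X' n j i \<omega>) \<omega> + \<xi>' n j i \<omega>) t) / real (N n)
      - (\<integral>\<omega>'. f t \<omega>' \<partial>M)\<bar>) > ennreal \<eta>}) \<longlonglongrightarrow> 0"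
    (is "?O \<longlonglongrightarrow> 0")
  proof (rule tendsto_0_ennrealI)
    fix \<kappa> :: real assume \<kappa>: "\<kappa> > 0"
    then have k2: "(0::ennreal) < ennreal (\<kappa> / 2)" by simp
    \<comment> \<open>The grid level is chosen before \<open>n\<close>, because the law of large
      numbers is applied to a fixed finite set of points.\<close>
    obtain m where m: "ennreal (2 / \<eta>) * ?E (?h m) < ennreal (\<kappa> / 2)"
      using order_tendstoD(2)[OF h k2] by (auto simp: eventually_sequentially)
    have "eventually (\<lambda>n. ennreal (1 / \<eta>) * R m n < ennreal (\<kappa> / 2)) sequentially"
      by (rule order_tendstoD(2)[OF R k2])
    moreover have "eventually (\<lambda>n. N n \<ge> 1) sequentially"
      using N_infinite by (auto simp: filterlim_at_top)
    moreover have "eventually (\<lambda>n. \<epsilon> n < \<epsilon>\<^sub>0) sequentially"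
      using kernel(2) unfolding boundary_condition_def by (intro order_tendstoD(2)[OF bandwidth(2)]) auto
    ultimately show "eventually (\<lambda>n. ?O n \<le> ennreal \<kappa>) sequentially"
      using eventually_ge_at_top[of 1]
    proof eventually_elim
      case (elim n)
      have "?O n \<le> ennreal (1 / \<eta>) * ((?E (2 * \<epsilon> n) + ennreal (2 / \<rho>) * ?B n + ?E (?h m))
          + ennreal \<eta> * ennreal (?P n) + ?Q m n + ?E (?h m))"
        unfolding \<delta>_def
      proof (rule copies_outer_measure_bound[OF prob kernel partition _ _ bandwidth(1) _ model copies sup_integrable _ \<eta> refl])
        show "(1::real) / 2 ^ m < 2 / 2 ^ m" by (simp add: divide_strict_right_mono)
      qed (use elim in auto)
      also have "\<dots> = ennreal (1 / \<eta>) * R m n + (ennreal (1 / \<eta>) * 2) * ?E (?h m)"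
      proof -
        have "a * ((x + y + z) + w + q + z) = a * (x + y + w + q) + (a * 2) * z" for a x y z w q :: ennreal
          by (simp add: distrib_left distrib_right mult_2_right add_ac)
        then show ?thesis unfolding R_def .
      qed
      also have "ennreal (1 / \<eta>) * 2 = ennreal (2 / \<eta>)"
        using \<eta> by (simp flip: ennreal_numeral ennreal_mult)
      also have "ennreal (1 / \<eta>) * R m n + ennreal (2 / \<eta>) * ?E (?h m) \<le> ennreal (\<kappa> / 2) + ennreal (\<kappa> / 2)"
        using elim m by (intro add_mono) auto
      also have "\<dots> = ennreal \<kappa>" using \<kappa> by (simp flip: ennreal_plus)
      finally show ?case .
    qed
  qed
qed

end
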